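(* Let $\Omega$ be a bounded domain in $\mathbb{R}^n$, $n\ge 2$. (i) Assume $\Omega$ satisfies the Jones condition. Then for every $f\in \mathrm{VMO}(\Omega)$ there exists $F\in \mathrm{VMO}(\mathbb{R}^n)$ with $F=f$ on $\Omega$. Moreover, the map $f\mapsto F$ is linear and bounded: $$\|F\|_{\mathrm{BMO}(\mathbb{R}^n)}\le C\|f\|_{\mathrm{BMO}(\Omega)},$$ where the constant $C$ is independent of $f$. (ii) Suppose there exists a linear extension map which takes each $f\in \mathrm{VMO}(\Omega)$ to a function $F\in \mathrm{BMO}(\mathbb{R}^n)$ with $F=f$ on $\Omega$ and such that $\|F\|_{\mathrm{BMO}(\mathbb{R}^n)}\le C\|f\|_{\mathrm{BMO}(\Omega)}$ with $C$ independent of $f$. Then $\Omega$ satisfies the Jones condition.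
   Context: A domain is an open connected set. Cubes have sides parallel to the coordinate axes; $\ell(Q)$ is the sidelength of $Q$, $|Q|$ its volume, and $f_Q=\frac1{|Q|}\int_Q f$. Functions are real-valued. For a domain $\Omega\subset\mathbb{R}^n$ (including $\Omega=\mathbb{R}^n$) and $f\in L^1_{\rm loc}(\Omega)$, put $$\|f\|_{\mathrm{BMO}(\Omega)}=\sup_{Q\subset\Omega}\frac1{|Q|}\int_Q|f-f_Q|\,dx,\qquad \omega_\Omega(f,t)=\sup_{Q\subset\Omega,\ \ell(Q)<t}\frac1{|Q|}\int_Q|f-f_Q|\,dx.$$ $\mathrm{BMO}(\Omega)$ is the set of $f\in L^1_{\rm loc}(\Omega)$ with $\|f\|_{\mathrm{BMO}(\Omega)}<\infty$. For bounded $\Omega$, $f\in\mathrm{VMO}(\Omega)$ means $\lim_{t\to0}\omega_\Omega(f,t)=0$; $\mathrm{VMO}(\mathbb{R}^n)$ is the set of $f\in \mathrm{BMO}(\mathbb{R}^n)$ with $\lim_{t\to 0}\omega_{\mathbb{R}^n}(f,t)=0$. All these spaces are considered modulo constants. Jones condition. Fix a dyadic Whitney decomposition $E$ of $\Omega$: a countable collection of closed dyadic cubes with pairwise disjoint interiors, with union $\Omega$, such that $\ell(S)\le \mathrm{dist}(S,\Omega^c)\le 4\sqrt n\,\ell(S)$ for $S\in E$ and $\frac14\ell(S)\le\ell(S')\le4\ell(S)$ whenever $S,S'\in E$ are adjacent. Two cubes are adjacent (touch) if they are distinct members of the collection with nonempty intersection. A Whitney chain of length $m$ connecting $S,S'\in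 E$ is a finite sequence $Q_0=S,Q_1,\dots,Q_m=S'$ in $E$ with $Q_i$ touching $Q_{i+1}$ for $0\le i\le m-1$. For $S,S'\in E$, $d_1(S,S')$ is the length of a shortest Whitney chain connecting them. For any cubes $Q_1,Q_2$, $$d_2(Q_1,Q_2)=\left|\log\frac{\ell(Q_1)}{\ell(Q_2)}\right|+\log\left(2+\frac{d(Q_1,Q_2)}{\ell(Q_1)+\ell(Q_2)}\right),$$ where $d$ is Euclidean distance and $\log$ is the logarithm to base $2$. $\Omega$ satisfies the Jones condition if there is a constant $\kappa>0$ such that $d_1(Q_1,Q_2)\le\kappa\, d_2(Q_1,Q_2)$ for all $Q_1,Q_2\in E$. *)

theory Defs
  imports "HOL-Analysis.Analysis"
begin

text \<open>Cubes are closed and nondegenerate, with sides parallel to the axes.\<close>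

definition cube :: "real ^ 'n \<Rightarrow> real \<Rightarrow> (real ^ 'n) set" where
  "cube a l = cbox a (a + vec l)"

definition is_cube :: "(real ^ 'n) set \<Rightarrow> bool" where
  "is_cube Q \<longleftrightarrow> (\<exists>a l. 0 < l \<and> Q = cube a l)"

definition sidelength :: "(real ^ 'n) set \<Rightarrow> real" where
  "sidelength Q = (THE l. 0 < l \<and> (\<exists>a. Q = cube a l))"

lemma sidelength_cube:
  fixes a :: "real ^ 'n"
  assumes "0 < l"
  shows "sidelength (cube a l) = l"
  unfolding sidelength_def
proof (rule the_equality)
  show "0 < l \<and> (\<exists>b. cube a l = cube b l)"
    using assms by blast
next
  fix l' assume l': "0 < l' \<and> (\<exists>b. cube a l = cube b l')"
  then obtain b where b: "cbox a (a + vec l) = cbox b (b + vec l')"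
    by (auto simp: cube_def)
  have "cbox a (a + vec l) \<noteq> {}"
    using assms by (simp add: interval_ne_empty_cart)
  then have "a = b \<and> a + vec l = b + vec l'"
    using b by (metis eq_cbox)
  then have "(vec l :: real ^ 'n) = vec l'"
    by (metis add_left_cancel)
  then show "l' = l"
    by (metis vec_component)
qed

definition locally_integrable_on :: "(real ^ 'n \<Rightarrow> real) \<Rightarrow> (real ^ 'n) set \<Rightarrow> bool"
    (infixr \<open>locally'_integrable'_on\<close> 46) where
  "f locally_integrable_on \<Omega> \<longleftrightarrow>
     (\<forall>K. compact K \<and> K \<subseteq> \<Omega> \<longrightarrow> f absolutely_integrable_on K)"

definition mean :: "(real ^ 'n) set \<Rightarrow> (real ^ 'n \<Rightarrow> real) \<Rightarrow> real" where
  "mean Q f = (1 / measure lebesgue Q) * (LINT x:Q|lebesgue. f x)"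

definition mean_osc :: "(real ^ 'n) set \<Rightarrow> (real ^ 'n \<Rightarrow> real) \<Rightarrow> real" where
  "mean_osc Q f = mean Q (\<lambda>x. \<bar>f x - mean Q f\<bar>)"

text \<open>The suprema are taken in \<^typ>\<open>ennreal\<close>, so that they may be infinite.\<close>

definition bmo_norm :: "(real ^ 'n) set \<Rightarrow> (real ^ 'n \<Rightarrow> real) \<Rightarrow> ennreal" where
  "bmo_norm \<Omega> f = (SUP Q\<in>{Q. is_cube Q \<and> Q \<subseteq> \<Omega>}. ennreal (mean_osc Q f))"

definition osc_modulus :: "(real ^ 'n) set \<Rightarrow> (real ^ 'n \<Rightarrow> real) \<Rightarrow> real \<Rightarrow> ennreal" where
  "osc_modulus \<Omega> f t =
     (SUP Q\<in>{Q. is_cube Q \<and> Q \<subseteq> \<Omega> \<and> sidelength Q < t}. ennreal (mean_osc Q f))"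

text \<open>
  The spaces below are sets of representatives. A function on \<open>\<Omega>\<close> is a total function whose
  values off \<open>\<Omega>\<close> are irrelevant; the identification of functions that agree almost everywhere
  on \<open>\<Omega>\<close> up to an additive constant is \<open>eq_mod_const \<Omega>\<close>.
\<close>

definition BMO :: "(real ^ 'n) set \<Rightarrow> (real ^ 'n \<Rightarrow> real) set" where
  "BMO \<Omega> = {f. f locally_integrable_on \<Omega> \<and> bmo_norm \<Omega> f < \<infinity>}"

text \<open>VMO of a bounded domain; finiteness of the BMO norm is not part of the definition.\<close>

definition VMO :: "(real ^ 'n) set \<Rightarrow> (real ^ 'n \<Rightarrow> real) set" where
  "VMO \<Omega> = {f. f locally_integrable_on \<Omega> \<and> (osc_modulus \<Omega> f \<longlongrightarrow> 0) (at_right 0)}"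

text \<open>VMO of the whole space.\<close>

definition VMO_space :: "(real ^ 'n \<Rightarrow> real) set" where
  "VMO_space = {f \<in> BMO UNIV. (osc_modulus UNIV f \<longlongrightarrow> 0) (at_right 0)}"

definition eq_mod_const ::
    "(real ^ 'n) set \<Rightarrow> (real ^ 'n \<Rightarrow> real) \<Rightarrow> (real ^ 'n \<Rightarrow> real) \<Rightarrow> bool" where
  "eq_mod_const \<Omega> f g \<longleftrightarrow> (\<exists>c. AE x in lebesgue_on \<Omega>. f x = g x + c)"

text \<open>
  A linear map from the space \<open>A\<close> of functions on \<open>\<Omega>\<close> to the space \<open>B\<close> of functions on the whole
  space, both modulo constants, given on representatives: it is well defined and linear
  on classes. The representative \<open>T f\<close> is normalised by \<open>T f = f\<close> on \<open>\<Omega>\<close>; a class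
  whose restriction to \<open>\<Omega>\<close> is the class of \<open>f\<close> always has such a representative.
\<close>

definition linear_extension_map ::
    "(real ^ 'n) set \<Rightarrow> (real ^ 'n \<Rightarrow> real) set \<Rightarrow> (real ^ 'n \<Rightarrow> real) set \<Rightarrow>
     ((real ^ 'n \<Rightarrow> real) \<Rightarrow> (real ^ 'n \<Rightarrow> real)) \<Rightarrow> bool" where
  "linear_extension_map \<Omega> A B T \<longleftrightarrow>
     (\<forall>f\<in>A. T f \<in> B \<and> (AE x in lebesgue_on \<Omega>. T f x = f x)) \<and>
     (\<forall>f\<in>A. \<forall>g\<in>A. eq_mod_const \<Omega> f g \<longrightarrow> eq_mod_const UNIV (T f) (T g)) \<and>
     (\<forall>f\<in>A. \<forall>g\<in>A. \<forall>a b.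
        eq_mod_const UNIV (T (\<lambda>x. a * f x + b * g x)) (\<lambda>x. a * T f x + b * T g x))"

definition dyadic_cube :: "(real ^ 'n) set \<Rightarrow> bool" where
  "dyadic_cube Q \<longleftrightarrow>
     (\<exists>(j::int) (k::'n \<Rightarrow> int). Q = cube (\<chi> i. of_int (k i) * 2 powi j) (2 powi j))"

definition touches :: "(real ^ 'n) set \<Rightarrow> (real ^ 'n) set \<Rightarrow> bool" where
  "touches S S' \<longleftrightarrow> S \<noteq> S' \<and> S \<inter> S' \<noteq> {}"

definition whitney_decomposition ::
    "(real ^ 'n) set \<Rightarrow> (real ^ 'n) set set \<Rightarrow> bool" where
  "whitney_decomposition \<Omega> E \<longleftrightarrow>
     countable E \<and> (\<forall>S\<in>E. dyadic_cube S) \<and>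
     pairwise (\<lambda>S S'. interior S \<inter> interior S' = {}) E \<and>
     \<Union>E = \<Omega> \<and>
     (\<forall>S\<in>E. sidelength S \<le> setdist S (- \<Omega>) \<and>
             setdist S (- \<Omega>) \<le> 4 * sqrt (real CARD('n)) * sidelength S) \<and>
     (\<forall>S\<in>E. \<forall>S'\<in>E. touches S S' \<longrightarrow>
        sidelength S / 4 \<le> sidelength S' \<and> sidelength S' \<le> 4 * sidelength S)"

definition whitney_chain ::
    "(real ^ 'n) set set \<Rightarrow> (real ^ 'n) set \<Rightarrow> (real ^ 'n) set \<Rightarrow> nat \<Rightarrow>
     (nat \<Rightarrow> (real ^ 'n) set) \<Rightarrow> bool" where
  "whitney_chain E S S' m Q \<longleftrightarrow>
     Q 0 = S \<and> Q m = S' \<and> (\<forall>i\<le>m. Q i \<in> E) \<and> (\<forall>i<m. touches (Q i) (Q (Suc i)))"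

text \<open>In a Whitney decomposition of a connected open set, any two cubes are joined by a chain.\<close>

definition whitney_dist ::
    "(real ^ 'n) set set \<Rightarrow> (real ^ 'n) set \<Rightarrow> (real ^ 'n) set \<Rightarrow> nat" where
  "whitney_dist E S S' = (LEAST m. \<exists>Q. whitney_chain E S S' m Q)"

definition log_dist :: "(real ^ 'n) set \<Rightarrow> (real ^ 'n) set \<Rightarrow> real" where
  "log_dist Q1 Q2 =
     \<bar>log 2 (sidelength Q1 / sidelength Q2)\<bar> +
     log 2 (2 + setdist Q1 Q2 / (sidelength Q1 + sidelength Q2))"

definition jones_condition :: "(real ^ 'n) set set \<Rightarrow> bool" where
  "jones_condition E \<longleftrightarrow>
     (\<exists>\<kappa>>0. \<forall>Q1\<in>E. \<forall>Q2\<in>E. real (whitney_dist E Q1 Q2) \<le> \<kappa> * log_dist Q1 Q2)"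

end

theory Submission imports Defs begin

text \<open>
  Necessity. Given cubes \<open>S1\<close>, \<open>S2\<close> at chain distance \<open>N\<close>, a Lipschitz regularisation of the chain
  distance from \<open>S1\<close>, truncated at \<open>N\<close>, lies in VMO and has a BMO norm depending only on the dimension.
  Its means over \<open>S1\<close> and \<open>S2\<close> differ by \<open>N - 1\<close> or more, while the means of a BMO extension over two
  cubes differ by at most a constant times their logarithmic distance.

  Sufficiency. Outside the closure of the domain, \<open>f\<close> is extended by a weighted average of its means over
  the decomposition cubes near the point whose size is comparable to the distance from the domain.
  The Jones condition provides such cubes (a corkscrew property), makes the frontier porous, and bounds
  by \<open>O(i)\<close> the number of cubes in a chain from a cube of size comparable to \<open>t\<close> to one of size
  \<open>\<theta>^i t\<close> at distance \<open>O(t)\<close>. By porosity the part of a cube of side \<open>t\<close> that is closer than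
  \<open>\<theta>^i t\<close> to the frontier has relative measure at most \<open>q^i\<close>, so the oscillation is summable.
  For a function in VMO, short chains only meet small cubes and long chains carry little measure.
\<close>

subsection \<open>Cubes\<close>

text \<open>The chain distance is a step function on the cubes of the decomposition; its jumps keep
  it out of VMO, and the Lipschitz regularisation removes them. The Lipschitz constant depends on
  the pair of cubes and may be huge. This is harmless, because the hypothesis on the extension map
  only sees the BMO norm, and that stays below a dimensional constant.

  In the converse direction the difficult cubes are those that cross or approach the frontier, where
  means can be compared only along chains inside the domain. Their length grows linearly in the
  layer index, yet the summation is set up for quadratic growth: in deep layers of a VMO function
  the spare factor turns the global BMO bound into an arbitrarily small multiple.

  The averages outside have Lipschitz weights, so that the extension is continuous off the closure;
  assigning one cube to each region would create jumps and spoil VMO. Since the domain is bounded it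
  has no cubes comparable to large scales, so scales are capped at a fixed number
  \<open>D\<close>.\<close>

lemma mem_cube: "x \<in> cube a l \<longleftrightarrow> (\<forall>i. a$i \<le> x$i \<and> x$i \<le> a$i + l)"
  by (auto simp: cube_def mem_box_cart)

lemma cube_nonempty: "0 \<le> l \<Longrightarrow> cube a l \<noteq> {}"
  using mem_cube[of a a l] by force

lemma compact_cube: "compact (cube a l)"
  and closed_cube: "closed (cube a l)"
  and convex_cube: "convex (cube a l)"
  and bounded_cube: "bounded (cube a l)"
  and lmeasurable_cube: "cube a l \<in> lmeasurable"
  by (auto simp: cube_def)

lemma cube_sets [measurable]: "cube a l \<in> sets borel"
  by (simp add: cube_def)

lemma measure_cube:
  fixes a :: "real^'n" assumes "0 \<le> l"
  shows "measure lebesgue (cube a l) = l ^ CARD('n)"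
proof -
  have ne: "cbox a (a + vec l) \<noteq> {}"
    using cube_nonempty[OF assms, of a] by (simp add: cube_def)
  show ?thesis
    using content_cbox_cart[OF ne] by (simp add: cube_def measure_completion)
qed

lemma content_cube: "0 \<le> l \<Longrightarrow> measure lborel (cube (a::real^'n) l) = l ^ CARD('n)"
  using measure_cube[of l a] by (simp add: measure_completion)

lemma measure_cube_pos: "0 < l \<Longrightarrow> 0 < measure lebesgue (cube (a::real^'n) l)"
  by (simp only: measure_cube less_imp_le) simp

lemma cube_subset_iff:
  assumes "0 \<le> l"
  shows "cube a l \<subseteq> cube b m \<longleftrightarrow> (\<forall>i. b$i \<le> a$i \<and> a$i + l \<le> b$i + m)"
proof
  assume s: "cube a l \<subseteq> cube b m"
  have "a \<in> cube a l" "a + vec l \<in> cube a l" using assms by (auto simp: mem_cube)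
  with s have "a \<in> cube b m" "a + vec l \<in> cube b m" by auto
  thus "\<forall>i. b$i \<le> a$i \<and> a$i + l \<le> b$i + m" by (auto simp: mem_cube)
next
  assume h: "\<forall>i. b$i \<le> a$i \<and> a$i + l \<le> b$i + m"
  show "cube a l \<subseteq> cube b m"
  proof
    fix x assume "x \<in> cube a l"
    then show "x \<in> cube b m" unfolding mem_cube using h by (meson order_trans)
  qed
qed

lemma norm_le_sqrt_card:
  fixes x :: "real^'n"
  assumes "\<And>i. \<bar>x$i\<bar> \<le> b"
  shows "norm x \<le> sqrt (real CARD('n)) * b"
proof -
  \<comment> \<open>The index type is nonempty, so \<open>undefined\<close> names some
    coordinate.\<close>
  have b: "0 \<le> b" using assms[of undefined] by linarith
  have "norm x = sqrt (\<Sum>i\<in>UNIV. (norm (x$i))\<^sup>2)" by (simp add: norm_vec_def L2_set_def)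
  also have "\<dots> \<le> sqrt (\<Sum>i\<in>(UNIV::'n set). b\<^sup>2)"
    using assms b by (intro real_sqrt_le_mono sum_mono) (simp add: abs_le_square_iff[symmetric])
  also have "\<dots> = sqrt (real CARD('n)) * b" using b by (simp add: real_sqrt_mult)
  finally show ?thesis .
qed

lemma dist_cube_le:
  fixes a :: "real^'n"
  assumes "x \<in> cube a l" "y \<in> cube a l"
  shows "dist x y \<le> sqrt (real CARD('n)) * l"
  unfolding dist_norm
proof (rule norm_le_sqrt_card)
  fix i show "\<bar>(x - y)$i\<bar> \<le> l"
    using assms unfolding mem_cube by (smt (verit) vector_minus_component)
qed

text \<open>The closed ball of the maximum norm; \<open>r\<close> is half the side.\<close>

definition ccube :: "real^'n \<Rightarrow> real \<Rightarrow> (real^'n) set" where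
  "ccube x r = cube (x - vec r) (2 * r)"

lemma mem_ccube: "y \<in> ccube x r \<longleftrightarrow> (\<forall>i. \<bar>y$i - x$i\<bar> \<le> r)"
  unfolding ccube_def mem_cube by (auto simp: abs_le_iff algebra_simps)

lemma cube_eq_ccube: "cube a l = ccube (a + vec (l/2)) (l/2)"
  by (simp add: ccube_def)

lemma cball_subset_ccube: "cball x r \<subseteq> ccube x r"
proof
  fix y assume "y \<in> cball x r"
  then have "norm (y - x) \<le> r" by (simp add: dist_norm norm_minus_commute)
  then show "y \<in> ccube x r" unfolding mem_ccube
    by (metis component_le_norm_cart order_trans vector_minus_component)
qed

lemma ccube_subset_cball: "ccube (x::real^'n) r \<subseteq> cball x (sqrt (real CARD('n)) * r)"
proof
  fix y assume "y \<in> ccube x r"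
  then show "y \<in> cball x (sqrt (real CARD('n)) * r)"
    using norm_le_sqrt_card[of "y - x" r] by (simp add: mem_ccube dist_norm norm_minus_commute)
qed

lemma is_cube_cube: "0 < l \<Longrightarrow> is_cube (cube a l)"
  by (auto simp: is_cube_def)

subsection \<open>Means and oscillations\<close>

lemma abs_integrable_cube_const [simp]: "(\<lambda>x. c::real) absolutely_integrable_on cube a l"
  using lmeasurable_cube[of a l] by (simp add: lmeasurable_iff_integrable set_integrable_def)

lemma mean_const: "0 < l \<Longrightarrow> mean (cube (a::real^'n) l) (\<lambda>x. c) = c"
proof -
  assume l: "0 < l"
  have "(LINT x:cube a l|lebesgue. c) = measure lebesgue (cube a l) * c"
    using lmeasurable_cube[of a l] by (subst set_integral_const) (auto simp: fmeasurable_def)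
  then show ?thesis using measure_cube_pos[OF l, of a] by (simp add: mean_def)
qed

lemma mean_cong: "(\<And>x. x \<in> Q \<Longrightarrow> f x = g x) \<Longrightarrow> mean Q f = mean Q g"
  unfolding mean_def set_lebesgue_integral_def
  by (metis (mono_tags, lifting) indicator_simps(2) scaleR_eq_0_iff)

lemma mean_add: "f absolutely_integrable_on Q \<Longrightarrow> g absolutely_integrable_on Q \<Longrightarrow>
    mean Q (\<lambda>x. f x + g x) = mean Q f + mean Q g"
  by (simp add: mean_def algebra_simps)

lemma mean_diff: "f absolutely_integrable_on Q \<Longrightarrow> g absolutely_integrable_on Q \<Longrightarrow>
    mean Q (\<lambda>x. f x - g x) = mean Q f - mean Q g"
  by (simp add: mean_def algebra_simps)

lemma mean_cmult: "mean Q (\<lambda>x. c * f x) = c * mean Q f"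
  by (simp add: mean_def)

lemma mean_mono: "f absolutely_integrable_on Q \<Longrightarrow> g absolutely_integrable_on Q \<Longrightarrow>
    (\<And>x. x \<in> Q \<Longrightarrow> f x \<le> g x) \<Longrightarrow> mean Q f \<le> mean Q g"
  unfolding mean_def by (intro mult_left_mono set_integral_mono) auto

lemma mean_cong_AE:
  assumes "AE x in lebesgue. x \<in> Q \<longrightarrow> f x = g x" "f absolutely_integrable_on Q"
    "g absolutely_integrable_on Q"
  shows "mean Q f = mean Q g"
proof -
  have "(LINT x:Q|lebesgue. f x) = (LINT x:Q|lebesgue. g x)"
    unfolding set_lebesgue_integral_def
    using assms unfolding set_integrable_def
    by (intro integral_cong_AE) (auto elim!: AE_mp simp: indicator_def)
  then show ?thesis by (simp add: mean_def)
qed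

lemma abs_mean_le: "f absolutely_integrable_on Q \<Longrightarrow> \<bar>mean Q f\<bar> \<le> mean Q (\<lambda>x. \<bar>f x\<bar>)"
  using set_integral_norm_bound[of lebesgue Q f]
  by (simp add: mean_def abs_mult divide_right_mono)

lemma mean_nonneg: "(\<And>x. x \<in> Q \<Longrightarrow> 0 \<le> f x) \<Longrightarrow> 0 \<le> mean Q f"
  unfolding mean_def set_lebesgue_integral_def
  by (intro mult_nonneg_nonneg Bochner_Integration.integral_nonneg) (auto simp: indicator_def)

lemma abs_integrable_diff_const:
  "f absolutely_integrable_on cube a l \<Longrightarrow> (\<lambda>x. \<bar>f x - c\<bar>) absolutely_integrable_on cube a (l::real)"
  for f :: "real^'n \<Rightarrow> real"
  by (intro set_integrable_abs set_integral_diff) auto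

lemma abs_mean_diff_le:
  fixes a :: "real^'n"
  assumes "0 < l" "f absolutely_integrable_on cube a l"
  shows "\<bar>mean (cube a l) f - c\<bar> \<le> mean (cube a l) (\<lambda>x. \<bar>f x - c\<bar>)"
proof -
  have "mean (cube a l) f - c = mean (cube a l) (\<lambda>x. f x - c)"
    using assms by (simp add: mean_diff mean_const)
  then show ?thesis using abs_mean_le[where f = "\<lambda>x. f x - c" and Q = "cube a l"] assms by auto
qed

text \<open>The distance of the mean from \<open>c\<close> is at most the average of
  \<open>|f - c|\<close>, so the triangle inequality costs a factor 2. Later estimates may therefore
  use any convenient reference value in place of the mean.\<close>

lemma mean_osc_le:
  fixes a :: "real^'n"
  assumes "0 < l" "f absolutely_integrable_on cube a l"
  shows "mean_osc (cube a l) f \<le> 2 * mean (cube a l) (\<lambda>x. \<bar>f x - c\<bar>)"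
proof -
  let ?Q = "cube a l" let ?m = "mean ?Q f"
  have "mean_osc ?Q f \<le> mean ?Q (\<lambda>x. \<bar>f x - c\<bar> + \<bar>?m - c\<bar>)"
    unfolding mean_osc_def using assms
    by (intro mean_mono abs_integrable_diff_const set_integral_add) auto
  also have "\<dots> = mean ?Q (\<lambda>x. \<bar>f x - c\<bar>) + \<bar>?m - c\<bar>"
    using assms by (subst mean_add) (auto intro: abs_integrable_diff_const simp: mean_const)
  also have "\<dots> \<le> 2 * mean ?Q (\<lambda>x. \<bar>f x - c\<bar>)" using abs_mean_diff_le[OF assms] by simp
  finally show ?thesis .
qed

lemma mean_osc_nonneg: "0 \<le> mean_osc Q f"
  unfolding mean_osc_def by (rule mean_nonneg) simp

text \<open>Enlarging the domain of integration of a nonnegative function costs only the ratio of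
  the volumes.\<close>

lemma mean_subcube_le:
  fixes a :: "real^'n"
  assumes "0 < l'" "cube a' l' \<subseteq> cube a l" "g absolutely_integrable_on cube a l" "0 < l"
    "\<And>x. x \<in> cube a l \<Longrightarrow> 0 \<le> g x"
  shows "mean (cube a' l') g \<le> (l / l') ^ CARD('n) * mean (cube a l) g"
proof -
  have i: "g absolutely_integrable_on cube a' l'"
    using assms by (meson set_integrable_subset lmeasurable_cube fmeasurableD)
  have "(LINT x:cube a' l'|lebesgue. g x) \<le> (LINT x:cube a l|lebesgue. g x)"
    unfolding set_lebesgue_integral_def
    using i assms unfolding set_integrable_def
    by (intro integral_mono) (auto simp: indicator_def)
  then show ?thesis using assms
    using measure_cube_pos[OF assms(1), of a'] measure_cube_pos[OF assms(4), of a]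
    by (simp add: mean_def content_cube power_divide divide_right_mono)
qed

lemma mean_diff_subcube:
  fixes a :: "real^'n"
  assumes "0 < l'" "cube a' l' \<subseteq> cube a l" "f absolutely_integrable_on cube a l" "0 < l"
  shows "\<bar>mean (cube a' l') f - mean (cube a l) f\<bar> \<le> (l / l') ^ CARD('n) * mean_osc (cube a l) f"
proof -
  have i: "f absolutely_integrable_on cube a' l'"
    using assms by (meson set_integrable_subset lmeasurable_cube fmeasurableD)
  show ?thesis unfolding mean_osc_def
    by (rule order_trans[OF abs_mean_diff_le[OF assms(1) i] mean_subcube_le])
      (use assms in \<open>auto intro: abs_integrable_diff_const\<close>)
qed

text \<open>Doubling the small cube inside the big one costs \<open>2 ^ CARD('n) * B\<close> per
  step. The difference of means thus grows with the logarithm of the ratio of sides, not with the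
  ratio of volumes.\<close>

lemma mean_diff_nested:
  fixes f :: "real^'n \<Rightarrow> real"
  assumes B: "\<And>b m. 0 < m \<Longrightarrow> cube b m \<subseteq> cube a l \<Longrightarrow> mean_osc (cube b m) f \<le> B"
    and f: "f absolutely_integrable_on cube a l" and "0 < l"
  shows "0 < l' \<Longrightarrow> cube a' l' \<subseteq> cube a l \<Longrightarrow> l \<le> 2 ^ k * l' \<Longrightarrow>
    \<bar>mean (cube a' l') f - mean (cube a l) f\<bar> \<le> (real k + 1) * 2 ^ CARD('n) * B"
proof (induction k arbitrary: a' l')
  case 0
  have le: "l' \<le> l" using 0 cube_subset_iff[of l' a' a l] by (smt (verit))
  then have "l = l'" using 0 by simp
  have B0: "0 \<le> B" using B[of l a] \<open>0 < l\<close> mean_osc_nonneg[of "cube a l" f] by auto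
  have "\<bar>mean (cube a' l') f - mean (cube a l) f\<bar> \<le> (l / l') ^ CARD('n) * mean_osc (cube a l) f"
    by (rule mean_diff_subcube) (use 0 f \<open>0 < l\<close> in auto)
  also have "\<dots> = mean_osc (cube a l) f" using \<open>l = l'\<close> \<open>0 < l\<close> by simp
  also have "\<dots> \<le> B" using B \<open>0 < l\<close> by auto
  also have "B \<le> 2 ^ CARD('n) * B" using mult_right_mono[of 1 "2 ^ CARD('n)" B] B0 by simp
  finally show ?case by simp
next
  case (Suc k)
  have B0: "0 \<le> B" using B[of l a] \<open>0 < l\<close> mean_osc_nonneg[of "cube a l" f] by auto
  show ?case
  proof (cases "l \<le> 2 * l'")
    case True
    have "\<bar>mean (cube a' l') f - mean (cube a l) f\<bar> \<le> (l / l') ^ CARD('n) * mean_osc (cube a l) f"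
      by (rule mean_diff_subcube) (use Suc f \<open>0 < l\<close> in auto)
    also have "\<dots> \<le> 2 ^ CARD('n) * B"
      by (intro mult_mono power_mono) (use True Suc B \<open>0 < l\<close> B0 mean_osc_nonneg in \<open>auto simp: field_simps\<close>)
    also have "\<dots> \<le> (real (Suc k) + 1) * 2 ^ CARD('n) * B"
      using B0 by (simp add: algebra_simps)
    finally show ?thesis .
  next
    case False
    \<comment> \<open>The doubled cube must stay inside the big one: the corner of the small cube is
      pulled towards that of the big one by the fraction that reduces the slack
      \<open>l - l'\<close> to \<open>l - 2 * l'\<close>.\<close>
    define \<theta> where "\<theta> = l' / (l - l')"
    have th: "0 < \<theta>" "\<theta> \<le> 1" "\<theta> * (l - l') = l'"
      using False Suc.prems by (auto simp: \<theta>_def field_simps)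
    define b where "b = a' + \<theta> *\<^sub>R (a - a')"
    have sub: "a$i \<le> a'$i" "a'$i + l' \<le> a$i + l" for i
      using Suc.prems cube_subset_iff[of l' a' a l] by auto
    have s1: "cube a' l' \<subseteq> cube b (2 * l')"
    proof (subst cube_subset_iff, use Suc in simp, intro allI conjI)
      fix i
      have "\<theta> * (a$i - a'$i) \<le> 0" using th sub[of i] by (intro mult_nonneg_nonpos) auto
      then show "b$i \<le> a'$i" by (simp add: b_def)
      have "\<theta> * (a'$i - a$i) \<le> \<theta> * (l - l')" using th sub[of i] by (intro mult_left_mono) auto
      then show "a'$i + l' \<le> b$i + 2 * l'" using th by (simp add: b_def algebra_simps)
    qed
    have s2: "cube b (2 * l') \<subseteq> cube a l"
    proof (subst cube_subset_iff, use Suc in simp, intro allI conjI)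
      fix i
      have "(1 - \<theta>) * (a'$i - a$i) \<ge> 0" using th sub[of i] by (intro mult_nonneg_nonneg) auto
      then show "a$i \<le> b$i" by (simp add: b_def algebra_simps)
      have "(1 - \<theta>) * (a'$i - a$i) \<le> (1 - \<theta>) * (l - l')" using th sub[of i] by (intro mult_left_mono) auto
      then show "b$i + 2 * l' \<le> a$i + l" using th by (simp add: b_def algebra_simps)
    qed
    have IH: "\<bar>mean (cube b (2 * l')) f - mean (cube a l) f\<bar> \<le> (real k + 1) * 2 ^ CARD('n) * B"
      by (rule Suc.IH) (use Suc.prems s2 in auto)
    have "f absolutely_integrable_on cube b (2 * l')"
      using f s2 by (meson set_integrable_subset lmeasurable_cube fmeasurableD)
    then have "\<bar>mean (cube a' l') f - mean (cube b (2 * l')) f\<bar>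
        \<le> (2 * l' / l') ^ CARD('n) * mean_osc (cube b (2 * l')) f"
      by (intro mean_diff_subcube) (use Suc.prems s1 in auto)
    also have "\<dots> \<le> 2 ^ CARD('n) * B"
      using Suc.prems B[OF _ s2] by (auto intro: mult_left_mono)
    finally have "\<bar>mean (cube a' l') f - mean (cube a l) f\<bar> \<le> 2 ^ CARD('n) * B + (real k + 1) * 2 ^ CARD('n) * B"
      using IH by linarith
    then show ?thesis by (simp add: algebra_simps)
  qed
qed

section \<open>Summation over layers of geometrically decaying measure\<close>

definition layer_const :: "real \<Rightarrow> real \<Rightarrow> real" where
  "layer_const K q = 1 + K * (\<Sum>i. (real i + 2)\<^sup>2 * q ^ i)"

lemma summable_layer:
  assumes "0 \<le> q" "q < (1::real)"
  shows "summable (\<lambda>i. (real i + 2)\<^sup>2 * q ^ i)"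
proof (cases "q = 0")
  case True
  have "summable (\<lambda>i. if i = 0 then 4 else (0::real))" by simp
  moreover have "(\<lambda>i. (real i + 2)\<^sup>2 * q ^ i) = (\<lambda>i. if i = 0 then 4 else 0)"
    using True by (auto simp: fun_eq_iff)
  ultimately show ?thesis by simp
next
  case False
  have lim: "(\<lambda>i. ((real i + 3) / (real i + 2))\<^sup>2 * q) \<longlonglongrightarrow> 1\<^sup>2 * q"
  proof (intro tendsto_intros)
    have "(\<lambda>i. 1 + 1 / (real i + 2)) \<longlonglongrightarrow> 1 + 0"
      by (intro tendsto_intros tendsto_divide_0[OF tendsto_const] filterlim_at_top_imp_at_infinity
        filterlim_tendsto_add_at_top[OF tendsto_const, of _ _ 2, simplified add.commute]
        filterlim_real_sequentially)
    moreover have "(\<lambda>i. 1 + 1 / (real i + 2)) = (\<lambda>i. (real i + 3) / (real i + 2))"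
      by (auto simp: fun_eq_iff field_simps)
    ultimately show "(\<lambda>i. (real i + 3) / (real i + 2)) \<longlonglongrightarrow> 1" by simp
  qed
  obtain r where r: "q < r" "r < 1" using assms dense by blast
  have "eventually (\<lambda>i. ((real i + 3) / (real i + 2))\<^sup>2 * q < r) sequentially"
    using lim r by (auto intro: order_tendstoD)
  then obtain N where N: "\<And>i. i \<ge> N \<Longrightarrow> ((real i + 3) / (real i + 2))\<^sup>2 * q < r"
    by (auto simp: eventually_sequentially)
  show ?thesis
  proof (rule summable_ratio_test[OF r(2), of N])
    fix i assume "N \<le> i"
    have "(real i + 3)\<^sup>2 * q \<le> r * (real i + 2)\<^sup>2"
      using N[OF \<open>N \<le> i\<close>] by (simp add: power_divide field_simps)
    then have "(real i + 3)\<^sup>2 * q * q^i \<le> r * (real i + 2)\<^sup>2 * q^i"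
      using assms by (intro mult_right_mono) auto
    then show "norm ((real (Suc i) + 2)\<^sup>2 * q ^ Suc i) \<le> r * norm ((real i + 2)\<^sup>2 * q ^ i)"
      using assms by (simp add: algebra_simps abs_mult)
  qed
qed

lemma layer_const_ge_1: "0 \<le> q \<Longrightarrow> q < 1 \<Longrightarrow> 0 \<le> K \<Longrightarrow> 1 \<le> layer_const K q"
  unfolding layer_const_def using summable_layer[of q]
  by (auto intro!: mult_nonneg_nonneg suminf_nonneg)

text \<open>The layer of \<open>x\<close> is the least \<open>i\<close> with
  \<open>x \<notin> A i\<close>. If it is \<open>Suc k\<close>, then \<open>x\<close> lies in
  \<open>A k\<close> and the bound reads \<open>B * (k + 2)^2\<close>; the summand 1 of
  \<open>layer_const\<close> covers layer 0. The form with nonnegative integrals allows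
  integrability of \<open>g\<close> to be derived from the bound.\<close>

lemma layer_nn_integral_add:
  fixes g :: "real^'n \<Rightarrow> real"
  assumes q: "0 \<le> q" "q < 1" and K: "0 \<le> K" and B: "0 \<le> B"
    and Q: "Q \<in> lmeasurable"
    and A: "\<And>i. A i \<in> lmeasurable" "\<And>i. measure lebesgue (A i) \<le> K * q ^ i * measure lebesgue Q"
    and g: "\<And>x i. x \<in> Q \<Longrightarrow> x \<notin> A i \<Longrightarrow> ennreal \<bar>g x\<bar> \<le> ennreal (B * (real i + 1)\<^sup>2) + v x"
    and v [measurable]: "v \<in> borel_measurable lebesgue"
  shows "(\<integral>\<^sup>+x. ennreal \<bar>g x\<bar> * indicator Q x \<partial>lebesgue) \<le>
    ennreal (layer_const K q * B * measure lebesgue Q) + (\<integral>\<^sup>+x. v x \<partial>lebesgue)"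
proof -
  let ?h = "\<lambda>x. ennreal B * indicator Q x + (\<Sum>i. ennreal (B * (real i + 2)\<^sup>2) * indicator (A i) x)"
  have [measurable]: "Q \<in> sets lebesgue" "\<And>i. A i \<in> sets lebesgue" using Q A by auto
  have "(\<lambda>i. K * measure lebesgue Q * q^i) \<longlonglongrightarrow> K * measure lebesgue Q * 0"
    by (intro tendsto_intros LIMSEQ_realpow_zero q)
  then have lim: "(\<lambda>i. K * q^i * measure lebesgue Q) \<longlonglongrightarrow> 0" by (simp add: ac_simps)
  \<comment> \<open>Points lying in every \<open>A i\<close> have no layer; they form a null set
    because the measures tend to 0.\<close>
  have null: "(\<Inter>i. A i) \<in> null_sets lebesgue"
  proof -
    have "measure lebesgue (\<Inter>i. A i) \<le> K * q^i * measure lebesgue Q" for i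
      using measure_mono_fmeasurable[of "\<Inter>i. A i" "A i" lebesgue] A(1,2)[of i] by force
    then have "measure lebesgue (\<Inter>i. A i) \<le> 0"
      by (intro LIMSEQ_le_const[OF lim]) auto
    moreover have "(\<Inter>i. A i) \<in> lmeasurable"
      using A(1)[of 0] by (rule fmeasurableI2) auto
    ultimately show ?thesis
      by (metis antisym_conv fmeasurableD2 measure_nonneg emeasure_eq_ennreal_measure ennreal_0 fmeasurableD null_setsI top.not_eq_extremum)
  qed
  have dom: "(\<integral>\<^sup>+x. ennreal \<bar>g x\<bar> * indicator Q x \<partial>lebesgue) \<le> (\<integral>\<^sup>+x. ?h x + v x \<partial>lebesgue)"
  proof (rule nn_integral_mono_AE)
    have ae: "AE x in lebesgue. x \<notin> (\<Inter>i. A i)" using null by (rule AE_not_in)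
    have p: "ennreal \<bar>g x\<bar> * indicator Q x \<le> ?h x + v x" if x: "x \<notin> (\<Inter>i. A i)" for x
    proof (cases "x \<in> Q")
      case True
      define j where "j = (LEAST i. x \<notin> A i)"
      have j: "x \<notin> A j" using x unfolding j_def by (metis (mono_tags, lifting) INT_I LeastI)
      have gj: "ennreal \<bar>g x\<bar> \<le> ennreal (B * (real j + 1)\<^sup>2) + v x" using g True j by auto
      show ?thesis
      proof (cases j)
        case 0
        have "ennreal \<bar>g x\<bar> \<le> ennreal B + v x" using gj 0 by simp
        also have "\<dots> \<le> ?h x + v x" using True by (intro add_right_mono) (simp add: add_increasing2)
        finally show ?thesis using True by simp
      next
        case (Suc k)
        have "x \<in> A k" using Suc j_def not_less_Least[of k "\<lambda>i. x \<notin> A i"] by auto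
        have "ennreal \<bar>g x\<bar> \<le> ennreal (B * (real k + 2)\<^sup>2) * indicator (A k) x + v x"
          using gj Suc \<open>x \<in> A k\<close> by (simp add: add.commute)
        also have "ennreal (B * (real k + 2)\<^sup>2) * indicator (A k) x \<le> (\<Sum>i. ennreal (B * (real i + 2)\<^sup>2) * indicator (A i) x)"
          using sum_le_suminf[OF summableI, of "{k}" "\<lambda>i. ennreal (B * (real i + 2)\<^sup>2) * indicator (A i) x"]
          by (simp only: sum.insert sum.empty finite.emptyI finite.insertI empty_iff simp_thms add_0_right) simp
        also have "\<dots> \<le> ?h x" by simp
        finally show ?thesis using True by simp
      qed
    qed simp
    show "AE x in lebesgue. ennreal \<bar>g x\<bar> * indicator Q x \<le> ?h x + v x"
      using ae by (rule AE_mp) (use p in auto)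
  qed
  have "(\<integral>\<^sup>+x. ?h x \<partial>lebesgue) = ennreal B * emeasure lebesgue Q + (\<Sum>i. ennreal (B * (real i + 2)\<^sup>2) * emeasure lebesgue (A i))"
    by (simp add: nn_integral_add nn_integral_suminf nn_integral_cmult_indicator)
  also have "\<dots> \<le> ennreal (B * measure lebesgue Q) + (\<Sum>i. ennreal (B * (real i + 2)\<^sup>2 * (K * q^i * measure lebesgue Q)))"
    using Q A B K q
    by (intro add_mono suminf_le)
      (auto simp: emeasure_eq_measure2 ennreal_mult[symmetric] intro!: ennreal_leI mult_left_mono)
  also have "(\<Sum>i. ennreal (B * (real i + 2)\<^sup>2 * (K * q^i * measure lebesgue Q)))
     = (\<Sum>i. ennreal (B * K * measure lebesgue Q * ((real i + 2)\<^sup>2 * q^i)))"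
    by (simp add: ac_simps)
  also have "\<dots> = ennreal (\<Sum>i. B * K * measure lebesgue Q * ((real i + 2)\<^sup>2 * q^i))"
    using B K q by (intro suminf_ennreal2 summable_mult summable_layer) auto
  also have "(\<Sum>i. B * K * measure lebesgue Q * ((real i + 2)\<^sup>2 * q^i)) = B * K * measure lebesgue Q * (\<Sum>i. (real i + 2)\<^sup>2 * q^i)"
    by (rule suminf_mult[OF summable_layer[OF q]])
  also have "ennreal (B * measure lebesgue Q) + ennreal (B * K * measure lebesgue Q * (\<Sum>i. (real i + 2)\<^sup>2 * q^i))
     = ennreal (layer_const K q * B * measure lebesgue Q)"
    using B K q summable_layer[OF q]
    by (subst ennreal_plus[symmetric]) (auto simp: layer_const_def algebra_simps intro!: mult_nonneg_nonneg suminf_nonneg)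
  finally have "(\<integral>\<^sup>+x. ?h x \<partial>lebesgue) \<le> ennreal (layer_const K q * B * measure lebesgue Q)" .
  moreover have "(\<integral>\<^sup>+x. ?h x + v x \<partial>lebesgue) = (\<integral>\<^sup>+x. ?h x \<partial>lebesgue) + (\<integral>\<^sup>+x. v x \<partial>lebesgue)"
    by (rule nn_integral_add) measurable
  ultimately show ?thesis using dom by (metis (no_types, lifting) add_right_mono order_trans)
qed

lemma layer_nn_integral:
  fixes g :: "real^'n \<Rightarrow> real"
  assumes "0 \<le> q" "q < 1" "0 \<le> K" "0 \<le> B" "Q \<in> lmeasurable"
    and "\<And>i. A i \<in> lmeasurable" "\<And>i. measure lebesgue (A i) \<le> K * q ^ i * measure lebesgue Q"
    and "\<And>x i. x \<in> Q \<Longrightarrow> x \<notin> A i \<Longrightarrow> \<bar>g x\<bar> \<le> B * (real i + 1)\<^sup>2"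
  shows "(\<integral>\<^sup>+x. ennreal \<bar>g x\<bar> * indicator Q x \<partial>lebesgue) \<le> ennreal (layer_const K q * B * measure lebesgue Q)"
  using layer_nn_integral_add[OF assms(1-7), of g "\<lambda>_. 0"] assms(8) by (simp add: ennreal_leI)

subsection \<open>Whitney decompositions\<close>

lemma dyadic_intervals_meet:
  fixes x y u :: real and k K m :: int
  assumes "0 < u" "0 \<le> m" "of_int k * u \<le> x" "x \<le> of_int k * u + u"
    "of_int K * u \<le> y" "y \<le> of_int K * u + of_int m * u" "\<bar>x - y\<bar> < u"
  shows "of_int k * u \<le> of_int K * u + of_int m * u" "of_int K * u \<le> of_int k * u + u"
proof -
  have "real_of_int k * u < real_of_int (K + m + 1) * u"
    using assms by (simp add: algebra_simps)
  then have "k < K + m + 1" using assms(1) by (simp only: mult_less_cancel_right_pos of_int_less_iff)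
  then have "real_of_int k \<le> real_of_int (K + m)" by simp
  then show "of_int k * u \<le> of_int K * u + of_int m * u"
    using assms(1) mult_right_mono[of "real_of_int k" "real_of_int (K + m)" u] by (simp add: algebra_simps)
  have "real_of_int K * u < real_of_int (k + 2) * u"
    using assms by (simp add: algebra_simps)
  then have "K < k + 2" using assms(1) by (simp only: mult_less_cancel_right_pos of_int_less_iff)
  then have "real_of_int K \<le> real_of_int (k + 1)" by simp
  then show "of_int K * u \<le> of_int k * u + u"
    using assms(1) mult_right_mono[of "real_of_int K" "real_of_int (k + 1)" u] by (simp add: algebra_simps)
qed

text \<open>All corners of both cubes lie on the grid whose mesh \<open>u\<close> is the smaller
  side. Disjoint closed intervals with endpoints on the grid are at least one mesh apart, so the
  projections of the cubes meet in every coordinate.\<close>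

lemma dyadic_cubes_meet_aux:
  fixes k k' :: "'n::finite \<Rightarrow> int"
  assumes S: "S = cube (\<chi> i. of_int (k i) * 2 powi j) (2 powi j)"
    and S': "S' = cube (\<chi> i. of_int (k' i) * 2 powi j') (2 powi j')"
    and "j \<le> j'" "x \<in> S" "y \<in> S'" "\<And>i. \<bar>x$i - y$i\<bar> < 2 powi j"
  shows "S \<inter> S' \<noteq> {}"
proof -
  define u :: real where "u = 2 powi j"
  define m :: int where "m = 2 ^ nat (j' - j)"
  have u: "0 < u" by (simp add: u_def)
  have e: "(2::real) powi j' = of_int m * u"
  proof -
    have "j' = int (nat (j' - j)) + j" using \<open>j \<le> j'\<close> by simp
    then have "(2::real) powi j' = 2 powi (int (nat (j' - j))) * u"
      unfolding u_def by (metis power_int_add zero_neq_numeral)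
    then show ?thesis by (simp only: power_int_of_nat m_def of_int_power of_int_numeral)
  qed
  have m: "0 \<le> m" by (simp add: m_def)
  have x: "of_int (k i) * u \<le> x$i" "x$i \<le> of_int (k i) * u + u" for i
    using \<open>x \<in> S\<close> unfolding S mem_cube by (auto simp: u_def)
  have y: "of_int (k' i * m) * u \<le> y$i" "y$i \<le> of_int (k' i * m) * u + of_int m * u" for i
    using \<open>y \<in> S'\<close> unfolding S' mem_cube e by (auto simp: algebra_simps)
  have d: "\<bar>x$i - y$i\<bar> < u" for i using assms(6) by (simp add: u_def)
  note I = dyadic_intervals_meet[OF u m x y d]
  \<comment> \<open>The lower corner of the intersection: in every coordinate the larger of the two
    left endpoints.\<close>
  define z :: "real^'n" where "z = (\<chi> i. max (of_int (k i) * u) (of_int (k' i * m) * u))"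
  have "z \<in> S" unfolding S mem_cube using I u by (auto simp: z_def u_def[symmetric])
  moreover have "z \<in> S'" unfolding S' mem_cube e using I u m by (auto simp: z_def algebra_simps)
  ultimately show ?thesis by blast
qed

lemma dyadic_cube_cube:
  assumes "dyadic_cube S" shows "\<exists>a. S = cube a (sidelength S)" "0 < sidelength S"
proof -
  obtain j and k :: "'a \<Rightarrow> int" where S: "S = cube (\<chi> i. of_int (k i) * 2 powi j) (2 powi j)"
    using assms unfolding dyadic_cube_def by blast
  then have "sidelength S = 2 powi j" by (simp add: sidelength_cube)
  then show "\<exists>a. S = cube a (sidelength S)" "0 < sidelength S" using S by auto
qed

text \<open>Turns closeness of points into contact of cubes, which is how chains are built from
  paths.\<close>

lemma dyadic_cubes_meet:
  fixes S S' :: "(real^'n) set"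
  assumes "dyadic_cube S" "dyadic_cube S'" "x \<in> S" "y \<in> S'"
    "\<And>i. \<bar>x$i - y$i\<bar> < min (sidelength S) (sidelength S')"
  shows "S \<inter> S' \<noteq> {}"
proof -
  obtain j and k :: "'n \<Rightarrow> int" where S: "S = cube (\<chi> i. of_int (k i) * 2 powi j) (2 powi j)"
    using assms(1) unfolding dyadic_cube_def by blast
  obtain j' and k' :: "'n \<Rightarrow> int" where S': "S' = cube (\<chi> i. of_int (k' i) * 2 powi j') (2 powi j')"
    using assms(2) unfolding dyadic_cube_def by blast
  have l: "sidelength S = 2 powi j" "sidelength S' = 2 powi j'"
    unfolding S S' by (simp_all add: sidelength_cube)
  show ?thesis
  proof (cases "j \<le> j'")
    case True
    then show ?thesis using dyadic_cubes_meet_aux[OF S S' True assms(3,4)] assms(5) l by auto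
  next
    case False
    then show ?thesis using dyadic_cubes_meet_aux[OF S' S _ assms(4,3)] assms(5) l
      by (auto simp: abs_minus_commute)
  qed
qed

section \<open>Geometry of a Whitney decomposition of a nonempty bounded domain\<close>

locale whitney =
  fixes \<Omega> :: "(real^'n) set" and E :: "(real^'n) set set"
  assumes op: "open \<Omega>" and conn: "connected \<Omega>" and bdd: "bounded \<Omega>" and ne: "\<Omega> \<noteq> {}"
    and whit: "whitney_decomposition \<Omega> E"
begin

definition rn :: real where "rn = sqrt (real CARD('n))"
definition bd :: "real^'n \<Rightarrow> real" where "bd x = infdist x (- \<Omega>)"

abbreviation side :: "(real^'n) set \<Rightarrow> real" where "side \<equiv> sidelength"

lemma rn_ge_1: "1 \<le> rn" by (simp add: rn_def)
lemma rn_pos: "0 < rn" using rn_ge_1 by linarith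

lemma E_dyadic: "S \<in> E \<Longrightarrow> dyadic_cube S"
  and E_Union: "\<Union>E = \<Omega>"
  and E_countable: "countable E"
  and E_disjoint: "pairwise (\<lambda>S S'. interior S \<inter> interior S' = {}) E"
  and E_setdist: "S \<in> E \<Longrightarrow> side S \<le> setdist S (- \<Omega>)"
    "S \<in> E \<Longrightarrow> setdist S (- \<Omega>) \<le> 4 * sqrt (real CARD('n)) * side S"
  and E_touch: "S \<in> E \<Longrightarrow> S' \<in> E \<Longrightarrow> touches S S' \<Longrightarrow> side S / 4 \<le> side S' \<and> side S' \<le> 4 * side S"
  using whit unfolding whitney_decomposition_def by blast+

lemma E_cubeE:
  assumes "S \<in> E" obtains a l where "0 < l" "S = cube a l" "side S = l"
proof -
  from dyadic_cube_cube[OF E_dyadic[OF assms]] obtain a where "S = cube a (side S)" "0 < side S" by auto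
  then show ?thesis by (rule that[OF _ _ refl, rotated])
qed

lemma side_pos: "S \<in> E \<Longrightarrow> 0 < side S" by (metis E_cubeE)

lemma E_subset: "S \<in> E \<Longrightarrow> S \<subseteq> \<Omega>" using E_Union by blast
lemma E_cover: "x \<in> \<Omega> \<Longrightarrow> \<exists>S\<in>E. x \<in> S" using E_Union by blast
lemma E_nonempty: "S \<in> E \<Longrightarrow> S \<noteq> {}"
  by (erule E_cubeE) (simp add: cube_nonempty)
lemma E_compact: "S \<in> E \<Longrightarrow> compact S"
  by (erule E_cubeE) (simp add: compact_cube)
lemma E_lmeasurable: "S \<in> E \<Longrightarrow> S \<in> lmeasurable"
  by (erule E_cubeE) (simp add: lmeasurable_cube)
lemma E_measure: "S \<in> E \<Longrightarrow> measure lebesgue S = side S ^ CARD('n)"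
  by (erule E_cubeE) (simp only: measure_cube less_imp_le)
lemma E_dist: "S \<in> E \<Longrightarrow> x \<in> S \<Longrightarrow> y \<in> S \<Longrightarrow> dist x y \<le> rn * side S"
  by (erule E_cubeE) (simp add: dist_cube_le rn_def)

lemma compl_ne: "- \<Omega> \<noteq> {}"
  using bdd not_bounded_UNIV by (metis Compl_empty_eq double_complement)
lemma closed_compl: "closed (- \<Omega>)" using op by (simp add: closed_Compl)

lemma bd_pos: "x \<in> \<Omega> \<Longrightarrow> 0 < bd x"
  unfolding bd_def using infdist_pos_not_in_closed[OF closed_compl compl_ne] by auto
lemma bd_nonneg: "0 \<le> bd x" by (simp add: bd_def infdist_nonneg)
lemma bd_outside: "x \<notin> \<Omega> \<Longrightarrow> bd x = 0" by (simp add: bd_def)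
lemma bd_lipschitz: "\<bar>bd x - bd y\<bar> \<le> dist x y"
  unfolding bd_def by (rule infdist_triangle_abs)
lemma bd_le_dist: "z \<notin> \<Omega> \<Longrightarrow> bd x \<le> dist x z"
  unfolding bd_def by (simp add: infdist_le)
lemma ball_subset: "dist x y < bd x \<Longrightarrow> y \<in> \<Omega>"
  using bd_le_dist by (metis not_le)

lemma side_le_bd: "S \<in> E \<Longrightarrow> x \<in> S \<Longrightarrow> side S \<le> bd x"
proof -
  assume S: "S \<in> E" "x \<in> S"
  have "setdist S (- \<Omega>) \<le> setdist {x} (- \<Omega>)"
    by (rule setdist_subset_left) (use S in auto)
  then show ?thesis using E_setdist(1)[OF S(1)] by (simp add: bd_def infdist_eq_setdist)
qed

text \<open>The factor \<open>5 * rn\<close> is \<open>4 * rn\<close> from the decomposition plus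
  \<open>rn\<close> for the diameter of \<open>S\<close>.\<close>

lemma bd_le_side: "S \<in> E \<Longrightarrow> x \<in> S \<Longrightarrow> bd x \<le> 5 * rn * side S"
proof -
  assume S: "S \<in> E" "x \<in> S"
  obtain y z where yz: "y \<in> S" "z \<in> - \<Omega>" "dist y z = setdist S (- \<Omega>)"
    using setdist_compact_closed[OF E_compact[OF S(1)] closed_compl] E_nonempty[OF S(1)] compl_ne by metis
  have "bd x \<le> dist x z" using yz by (simp add: bd_le_dist)
  also have "\<dots> \<le> dist x y + dist y z" by (rule dist_triangle)
  also have "\<dots> \<le> rn * side S + 4 * rn * side S"
    using E_dist[OF S yz(1)] E_setdist(2)[OF S(1)] yz(3) unfolding rn_def by linarith
  finally show ?thesis by linarith
qed

text \<open>Both sides exceed \<open>bd x / (10 * rn)\<close>: that of \<open>S\<close> is at least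
  \<open>bd x / (5 * rn)\<close>, and moving from \<open>x\<close> to \<open>y\<close> loses at most
  a tenth of \<open>bd x\<close>.\<close>

lemma near_meet:
  assumes "S \<in> E" "S' \<in> E" "x \<in> S" "y \<in> S'" "dist x y \<le> bd x / (10 * rn)"
  shows "S \<inter> S' \<noteq> {}"
proof (rule dyadic_cubes_meet[OF E_dyadic E_dyadic])
  have xO: "x \<in> \<Omega>" using assms E_subset by blast
  have p: "0 < bd x" using bd_pos xO by auto
  have 1: "bd x / (10 * rn) < side S"
    using bd_le_side[OF assms(1,3)] p rn_pos side_pos[OF assms(1)] by (simp add: field_simps)
  have "bd x / (10 * rn) \<le> bd x / 10" using rn_ge_1 p by (simp add: field_simps)
  then have "9/10 * bd x \<le> bd y" using bd_lipschitz[of x y] assms(5) by linarith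
  also have "\<dots> \<le> 5 * rn * side S'" by (rule bd_le_side[OF assms(2,4)])
  finally have 2: "bd x / (10 * rn) < side S'"
    using p rn_pos by (simp add: field_simps)
  fix i
  have "\<bar>x$i - y$i\<bar> \<le> dist x y"
    by (metis component_le_norm_cart dist_norm vector_minus_component)
  then show "\<bar>x$i - y$i\<bar> < min (side S) (side S')" using 1 2 assms(5) by linarith
qed (use assms in auto)

lemma sum_measure_le:
  assumes "finite T" "T \<subseteq> E" "\<Union>T \<subseteq> Q" "Q \<in> lmeasurable"
  shows "(\<Sum>S\<in>T. measure lebesgue S) \<le> measure lebesgue Q"
proof -
  have int: "interior S \<in> lmeasurable" "measure lebesgue (interior S) = measure lebesgue S" if "S \<in> T" for S
  proof -
    have "S \<in> E" using that assms(2) by blast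
    then obtain a l where a: "S = cube a l" by (rule E_cubeE)
    show "interior S \<in> lmeasurable" unfolding a by (simp add: cube_def interior_cbox)
    show "measure lebesgue (interior S) = measure lebesgue S"
      unfolding a by (rule measure_interior[OF bounded_cube negligible_convex_frontier[OF convex_cube]])
  qed
  have dj: "pairwise (\<lambda>S S'. disjnt (interior S) (interior S')) T"
    using E_disjoint assms(2) unfolding pairwise_def disjnt_def by blast
  have "(\<Sum>S\<in>T. measure lebesgue S) = (\<Sum>S\<in>T. measure lebesgue (interior S))"
    using int by simp
  also have "\<dots> = measure lebesgue (\<Union>S\<in>T. interior S)"
    by (rule measure_UNION'[symmetric, OF assms(1)]) (use int dj in auto)
  also have "\<dots> \<le> measure lebesgue Q"
  proof (rule measure_mono_fmeasurable)
    show "(\<Union>S\<in>T. interior S) \<subseteq> Q" using assms(3) interior_subset by blast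
    show "(\<Union>S\<in>T. interior S) \<in> sets lebesgue" using int assms(1) by (auto intro: fmeasurableD)
  qed (rule assms)
  finally show ?thesis .
qed

text \<open>A count of volumes: the interiors are disjoint. Finiteness follows from the same bound
  applied to finite subsets.\<close>

lemma card_packing:
  assumes "T \<subseteq> E" "\<And>S. S \<in> T \<Longrightarrow> S \<subseteq> cube a L" "\<And>S. S \<in> T \<Longrightarrow> s \<le> side S" "0 < s" "0 \<le> L"
  shows "finite T" "real (card T) \<le> (L / s) ^ CARD('n)"
proof -
  have fin: "real (card T') \<le> (L / s) ^ CARD('n)" if "finite T'" "T' \<subseteq> T" for T'
  proof -
    have "real (card T') * s ^ CARD('n) = (\<Sum>S\<in>T'. s ^ CARD('n))" by simp
    also have "\<dots> \<le> (\<Sum>S\<in>T'. measure lebesgue S)"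
      using assms that by (intro sum_mono) (force simp: E_measure intro!: power_mono)
    also have "\<dots> \<le> measure lebesgue (cube a L)"
      by (rule sum_measure_le) (use that assms lmeasurable_cube in auto)
    also have "\<dots> = L ^ CARD('n)" using assms(5) by (rule measure_cube)
    finally show ?thesis using assms(4) by (simp add: power_divide field_simps)
  qed
  show f: "finite T"
  proof (rule ccontr)
    assume "infinite T"
    obtain m :: nat where m: "(L / s) ^ CARD('n) < real m" using reals_Archimedean2 by blast
    obtain T' where "finite T'" "T' \<subseteq> T" "card T' = m"
      using infinite_arbitrarily_large[OF \<open>infinite T\<close>, of m] by metis
    then show False using fin[of T'] m by simp
  qed
  show "real (card T) \<le> (L / s) ^ CARD('n)" using fin[OF f] by simp
qed

lemma side_le_diameter: "S \<in> E \<Longrightarrow> side S \<le> diameter \<Omega>"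
proof -
  assume S: "S \<in> E"
  obtain a l where a: "0 < l" "S = cube a l" "side S = l" using S by (rule E_cubeE)
  have p: "0 < side S" using side_pos S by auto
  have "a \<in> S" "a + vec (side S) \<in> S" using a by (auto simp: mem_cube)
  then have "dist (a + vec (side S)) a \<le> diameter \<Omega>"
    using diameter_bounded_bound[OF bdd] E_subset[OF S] by blast
  moreover have "side S \<le> norm (vec (side S) :: real^'n)"
    using component_le_norm_cart[of "vec (side S) :: real^'n" undefined] p by simp
  ultimately show ?thesis by (simp add: dist_norm)
qed

lemma setdist_le_diameter: "S \<in> E \<Longrightarrow> S' \<in> E \<Longrightarrow> setdist S S' \<le> diameter \<Omega>"
proof -
  assume S: "S \<in> E" "S' \<in> E"
  obtain x y where "x \<in> S" "y \<in> S'" using E_nonempty[OF S(1)] E_nonempty[OF S(2)] by blast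
  then show ?thesis
    using setdist_le_dist[of x S y S'] diameter_bounded_bound[OF bdd, of x y] E_subset[OF S(1)] E_subset[OF S(2)] by force
qed

lemma diameter_pos: "0 < diameter \<Omega>"
  using ne E_cover side_pos side_le_diameter by (metis all_not_in_conv order_less_le_trans)

section \<open>The chain distance\<close>

definition adj :: "((real^'n) set \<times> (real^'n) set) set" where
  "adj = {(S, S'). S \<in> E \<and> S' \<in> E \<and> touches S S'}"

abbreviation wd :: "(real^'n) set \<Rightarrow> (real^'n) set \<Rightarrow> nat" where "wd \<equiv> whitney_dist E"

lemma adj_sym: "(S, S') \<in> adj \<Longrightarrow> (S', S) \<in> adj"
  by (auto simp: adj_def touches_def)

text \<open>With chains as powers of a relation, concatenation, reversal and reachability become
  facts about \<open>relpow\<close> and \<open>rtrancl\<close>.\<close>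

lemma whitney_chain_adj:
  assumes "S \<in> E"
  shows "(\<exists>Q. whitney_chain E S S' m Q) \<longleftrightarrow> (S, S') \<in> adj ^^ m"
  unfolding relpow_fun_conv
proof (intro iffI)
  assume "\<exists>Q. whitney_chain E S S' m Q"
  then obtain Q where "whitney_chain E S S' m Q" ..
  then show "\<exists>f. f 0 = S \<and> f m = S' \<and> (\<forall>i<m. (f i, f (Suc i)) \<in> adj)"
    by (intro exI[of _ Q]) (auto simp: whitney_chain_def adj_def)
next
  assume "\<exists>f. f 0 = S \<and> f m = S' \<and> (\<forall>i<m. (f i, f (Suc i)) \<in> adj)"
  then obtain f where f: "f 0 = S" "f m = S'" "\<And>i. i < m \<Longrightarrow> (f i, f (Suc i)) \<in> adj" by blast
  have "f i \<in> E" if "i \<le> m" for i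
  proof (cases i)
    case 0 then show ?thesis using f assms by simp
  next
    case (Suc k) then show ?thesis using f(3)[of k] that by (auto simp: adj_def)
  qed
  then show "\<exists>Q. whitney_chain E S S' m Q" using f
    by (intro exI[of _ f]) (auto simp: whitney_chain_def adj_def)
qed

lemma wd_alt: "S \<in> E \<Longrightarrow> wd S S' = (LEAST m. (S, S') \<in> adj ^^ m)"
  by (simp add: whitney_dist_def whitney_chain_adj)

lemma wd_le: "S \<in> E \<Longrightarrow> (S, S') \<in> adj ^^ m \<Longrightarrow> wd S S' \<le> m"
  by (simp add: wd_alt Least_le)

lemma meet_adj: "S \<in> E \<Longrightarrow> S' \<in> E \<Longrightarrow> S \<inter> S' \<noteq> {} \<Longrightarrow> S = S' \<or> (S, S') \<in> adj"
  by (auto simp: adj_def touches_def)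

text \<open>Small balls around the points of reachable cubes and around those of unreachable cubes
  form two open sets that cover the domain. A cube through a common point would meet cubes of both
  kinds by \<open>near_meet\<close>, so connectedness leaves no unreachable cube. Hence the
  \<open>LEAST\<close> in \<open>whitney_dist\<close> is attained.\<close>

lemma E_connected:
  assumes "S0 \<in> E" "S1 \<in> E" shows "(S0, S1) \<in> adj\<^sup>*"
proof -
  define R where "R = {S \<in> E. (S0, S) \<in> adj\<^sup>*}"
  have step: "S' \<in> R" if "S \<in> R" "S' \<in> E" "S \<inter> S' \<noteq> {}" for S S'
    using that meet_adj[of S S'] unfolding R_def by (auto intro: rtrancl_into_rtrancl)
  define U where "U = (\<Union>x\<in>\<Union>R. ball x (bd x / (10 * rn)))"
  define V where "V = (\<Union>x\<in>\<Union>(E - R). ball x (bd x / (10 * rn)))"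
  have cen: "x \<in> ball x (bd x / (10 * rn))" if "x \<in> \<Omega>" for x
    using bd_pos[OF that] rn_pos by simp
  have "U \<inter> \<Omega> = {} \<or> V \<inter> \<Omega> = {}"
  proof (rule connectedD[OF conn])
    show "open U" "open V" by (auto simp: U_def V_def)
    show "\<Omega> \<subseteq> U \<union> V"
    proof
      fix x assume "x \<in> \<Omega>"
      then obtain S where "S \<in> E" "x \<in> S" using E_cover by blast
      then show "x \<in> U \<union> V" using cen[OF \<open>x \<in> \<Omega>\<close>] unfolding U_def V_def
        by (cases "S \<in> R") blast+
    qed
    show "U \<inter> V \<inter> \<Omega> = {}"
    proof (rule ccontr)
      assume "U \<inter> V \<inter> \<Omega> \<noteq> {}"
      then obtain y where y: "y \<in> U" "y \<in> V" "y \<in> \<Omega>" by blast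
      obtain T where T: "T \<in> E" "y \<in> T" using E_cover y by blast
      obtain x S where x: "S \<in> R" "x \<in> S" "dist x y < bd x / (10 * rn)" using y unfolding U_def by auto
      obtain x' S' where x': "S' \<in> E" "S' \<notin> R" "x' \<in> S'" "dist x' y < bd x' / (10 * rn)"
        using y unfolding V_def by auto
      have "S \<inter> T \<noteq> {}" by (rule near_meet[of _ _ x y]) (use x T R_def in auto)
      then have "T \<in> R" using step x T by blast
      have "S' \<inter> T \<noteq> {}" by (rule near_meet[of _ _ x' y]) (use x' T in auto)
      then have "S' \<in> R" using step[OF \<open>T \<in> R\<close> x'(1)] by blast
      with x' show False by blast
    qed
  qed
  moreover have "S0 \<in> R" using assms by (simp add: R_def)
  then have "U \<inter> \<Omega> \<noteq> {}"
    using E_nonempty[OF assms(1)] E_subset[OF assms(1)] cen unfolding U_def by blast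
  ultimately have V: "V \<inter> \<Omega> = {}" by blast
  show ?thesis
  proof (rule ccontr)
    assume "(S0, S1) \<notin> adj\<^sup>*"
    then have "S1 \<in> E - R" using assms by (simp add: R_def)
    then have "V \<inter> \<Omega> \<noteq> {}"
      using E_nonempty[OF assms(2)] E_subset[OF assms(2)] cen unfolding V_def by blast
    with V show False by blast
  qed
qed

lemma wd_adj: "S \<in> E \<Longrightarrow> S' \<in> E \<Longrightarrow> (S, S') \<in> adj ^^ wd S S'"
  using rtrancl_imp_relpow[OF E_connected] by (metis LeastI_ex wd_alt)

lemma wd_triangle: "S \<in> E \<Longrightarrow> S' \<in> E \<Longrightarrow> S'' \<in> E \<Longrightarrow> wd S S'' \<le> wd S S' + wd S' S''"
  by (intro wd_le) (auto simp: relpow_add intro: wd_adj)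

lemma adj_relpow_sym: "(S, S') \<in> adj ^^ m \<Longrightarrow> (S', S) \<in> adj ^^ m"
proof (induction m arbitrary: S S')
  case (Suc m)
  then obtain T where "(S, T) \<in> adj ^^ m" "(T, S') \<in> adj" by auto
  then show ?case using Suc.IH adj_sym relpow_Suc_I2 by metis
qed simp

lemma wd_sym: "S \<in> E \<Longrightarrow> S' \<in> E \<Longrightarrow> wd S S' = wd S' S"
  by (simp add: antisym wd_le adj_relpow_sym wd_adj)

lemma wd_refl: "S \<in> E \<Longrightarrow> wd S S = 0"
  using wd_le[of S S 0] by simp

lemma wd_meet: "S \<in> E \<Longrightarrow> S' \<in> E \<Longrightarrow> S \<inter> S' \<noteq> {} \<Longrightarrow> wd S S' \<le> 1"
  using meet_adj[of S S'] wd_le[of S S' 1] wd_refl by auto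

text \<open>Subchains of a shortest chain are shortest, since a shortcut would shorten the whole.
  The last property lets the Jones condition be applied to any two members of the chain.\<close>

lemma wd_geodesic:
  assumes "S \<in> E" "S' \<in> E"
  obtains Q where "Q 0 = S" "Q (wd S S') = S'" "\<And>i. i \<le> wd S S' \<Longrightarrow> Q i \<in> E"
    "\<And>i. i < wd S S' \<Longrightarrow> touches (Q i) (Q (Suc i))"
    "\<And>i j. i \<le> j \<Longrightarrow> j \<le> wd S S' \<Longrightarrow> wd (Q i) (Q j) = j - i"
proof -
  let ?m = "wd S S'"
  obtain Q where Q: "whitney_chain E S S' ?m Q"
    using wd_adj[OF assms] whitney_chain_adj[OF assms(1)] by blast
  note q = Q[unfolded whitney_chain_def]
  have le: "wd (Q i) (Q j) \<le> j - i" if "i \<le> j" "j \<le> ?m" for i j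
  proof -
    have "wd (Q i) (Q (i + k)) \<le> k" if "i + k \<le> ?m" for k
      using that
    proof (induction k)
      case 0 then show ?case using q wd_refl by auto
    next
      case (Suc k)
      have "wd (Q (i+k)) (Q (Suc (i+k))) \<le> 1"
        by (rule wd_meet) (use q Suc.prems in \<open>auto simp: touches_def\<close>)
      then show ?case using Suc wd_triangle[of "Q i" "Q (i+k)" "Q (Suc (i+k))"] q by auto
    qed
    from this[of "j - i"] that show ?thesis by simp
  qed
  have "wd (Q i) (Q j) = j - i" if "i \<le> j" "j \<le> ?m" for i j
  proof -
    have E: "Q 0 \<in> E" "Q i \<in> E" "Q j \<in> E" "Q ?m \<in> E" using q that by auto
    have "?m \<le> wd (Q 0) (Q i) + wd (Q i) (Q j) + wd (Q j) (Q ?m)"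
      using wd_triangle[of "Q 0" "Q i" "Q ?m"] wd_triangle[of "Q i" "Q j" "Q ?m"] E q by auto
    then show ?thesis using le[of 0 i] le[of i j] le[of j ?m] that by auto
  qed
  then show ?thesis using that[of Q] q by auto
qed

text \<open>The segment is cut into \<open>k\<close> pieces of length at most
  \<open>\<delta> / (10 * rn)\<close>; cubes containing consecutive division points meet by
  \<open>near_meet\<close>. The extra 1 is for the endpoint \<open>y\<close>, which may lie in
  several cubes.\<close>

lemma wd_segment:
  assumes "0 < \<delta>"
  shows "S \<in> E \<Longrightarrow> S' \<in> E \<Longrightarrow> x \<in> S \<Longrightarrow> y \<in> S' \<Longrightarrow> (\<And>z. z \<in> closed_segment x y \<Longrightarrow> \<delta> \<le> bd z) \<Longrightarrow>
    dist x y \<le> real k * (\<delta> / (10 * rn)) \<Longrightarrow> wd S S' \<le> k + 1"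
proof (induction k arbitrary: S x)
  case 0
  then show ?case using wd_meet[of S S'] by force
next
  case (Suc k)
  \<comment> \<open>The first of \<open>Suc k\<close> equal pieces; the induction hypothesis handles
    the remaining \<open>k\<close>.\<close>
  define z where "z = x + (1 / real (Suc k)) *\<^sub>R (y - x)"
  have zs: "z \<in> closed_segment x y"
    unfolding closed_segment_def z_def
    by (rule CollectI, rule exI[of _ "1 / real (Suc k)"]) (simp add: algebra_simps)
  then have bz: "\<delta> \<le> bd z" using Suc by auto
  then have "z \<in> \<Omega>" using bd_outside assms by force
  then obtain T where T: "T \<in> E" "z \<in> T" using E_cover by blast
  have "dist x z = dist x y / real (Suc k)"
    by (simp add: z_def dist_norm norm_minus_commute)
  also have "\<dots> \<le> \<delta> / (10 * rn)"
    using Suc.prems(6) by (simp add: divide_le_eq mult.commute)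
  finally have dxz: "dist x z \<le> \<delta> / (10 * rn)" .
  also have "\<dots> \<le> bd x / (10 * rn)" using Suc.prems(5)[of x] rn_pos by (simp add: divide_right_mono)
  finally have 1: "wd S T \<le> 1"
    by (intro wd_meet near_meet[of S T x z]) (use Suc T in auto)
  have "z - y = (1 - 1 / real (Suc k)) *\<^sub>R (x - y)" by (simp add: z_def algebra_simps)
  then have "dist z y = (1 - 1 / real (Suc k)) * dist x y"
    by (simp add: dist_norm)
  also have "\<dots> \<le> (1 - 1 / real (Suc k)) * (real (Suc k) * (\<delta> / (10 * rn)))"
    using Suc.prems(6) by (intro mult_left_mono) auto
  also have "\<dots> = real k * (\<delta> / (10 * rn))"
  proof -
    have "(1 - 1 / real (Suc k)) * real (Suc k) = real k" by (simp add: field_simps)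
    then show ?thesis by (metis mult.assoc)
  qed
  finally have 2: "wd T S' \<le> k + 1"
    by (intro Suc.IH[OF T(1) Suc.prems(2) T(2) Suc.prems(4)])
      (use Suc.prems(5) zs subset_closed_segment[of z y x y] in auto)
  show ?case using 1 2 wd_triangle[of S T S'] Suc T by auto
qed

end

subsection \<open>Necessity of the Jones condition\<close>

lemma locally_integrable_cube:
  "f locally_integrable_on \<Omega> \<Longrightarrow> cube a l \<subseteq> \<Omega> \<Longrightarrow> f absolutely_integrable_on cube a l"
  by (simp add: locally_integrable_on_def compact_cube)

lemma continuous_locally_integrable:
  fixes f :: "real^'n \<Rightarrow> real"
  assumes "continuous_on UNIV f" shows "f locally_integrable_on \<Omega>"
  unfolding locally_integrable_on_def
proof (intro allI impI)
  fix K :: "(real^'n) set" assume K: "compact K \<and> K \<subseteq> \<Omega>"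
  obtain a b where ab: "K \<subseteq> cbox a b" using bounded_subset_cbox_symmetric compact_imp_bounded K by metis
  have "f absolutely_integrable_on cbox a b"
    by (rule absolutely_integrable_continuous) (use assms continuous_on_subset in blast)
  then show "f absolutely_integrable_on K"
    by (rule set_integrable_subset) (use K ab lmeasurable_compact in auto)
qed

lemma mean_le_nn_integral:
  fixes a :: "real^'n"
  assumes "0 < l" "g absolutely_integrable_on cube a l" "0 \<le> M"
    "(\<integral>\<^sup>+x. ennreal \<bar>g x\<bar> * indicator (cube a l) x \<partial>lebesgue) \<le> ennreal (M * measure lebesgue (cube a l))"
  shows "mean (cube a l) (\<lambda>x. \<bar>g x\<bar>) \<le> M"
proof -
  let ?Q = "cube a l"
  have i: "integrable lebesgue (\<lambda>x. indicator ?Q x *\<^sub>R \<bar>g x\<bar>)"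
    using set_integrable_abs[OF assms(2)] by (simp add: set_integrable_def)
  have "ennreal (LINT x:?Q|lebesgue. \<bar>g x\<bar>) = (\<integral>\<^sup>+x. ennreal (indicator ?Q x *\<^sub>R \<bar>g x\<bar>) \<partial>lebesgue)"
    unfolding set_lebesgue_integral_def by (rule nn_integral_eq_integral[OF i, symmetric]) simp
  also have "\<dots> = (\<integral>\<^sup>+x. ennreal \<bar>g x\<bar> * indicator ?Q x \<partial>lebesgue)"
    by (intro nn_integral_cong) (auto simp: indicator_def)
  also note assms(4)
  finally have "(LINT x:?Q|lebesgue. \<bar>g x\<bar>) \<le> M * measure lebesgue ?Q"
    using assms(3) by (subst (asm) ennreal_le_iff) auto
  then show ?thesis using measure_cube_pos[OF assms(1), of a] unfolding mean_def
    by (simp add: field_simps)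
qed

lemma bmo_norm_leD:
  assumes "bmo_norm \<Omega> f \<le> ennreal B" "0 \<le> B" "0 < l" "cube a l \<subseteq> \<Omega>"
  shows "mean_osc (cube a l) f \<le> B"
proof -
  have "ennreal (mean_osc (cube a l) f) \<le> bmo_norm \<Omega> f"
    unfolding bmo_norm_def by (rule SUP_upper) (use assms is_cube_cube in auto)
  then show ?thesis using assms by (meson ennreal_le_iff order_trans)
qed

lemma bmo_norm_leI:
  assumes "\<And>a l. 0 < l \<Longrightarrow> cube a l \<subseteq> \<Omega> \<Longrightarrow> mean_osc (cube a l) f \<le> B"
  shows "bmo_norm \<Omega> f \<le> ennreal B"
  unfolding bmo_norm_def using assms by (intro SUP_least) (auto simp: is_cube_def intro!: ennreal_leI)

lemma osc_modulus_leI: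
  assumes "\<And>a l. 0 < l \<Longrightarrow> l < t \<Longrightarrow> cube a l \<subseteq> \<Omega> \<Longrightarrow> mean_osc (cube a l) f \<le> B"
  shows "osc_modulus \<Omega> f t \<le> ennreal B"
  unfolding osc_modulus_def using assms
  by (intro SUP_least) (auto simp: is_cube_def sidelength_cube intro!: ennreal_leI)

lemma log_dist_ge_1: "0 \<le> sidelength Q1 \<Longrightarrow> 0 \<le> sidelength Q2 \<Longrightarrow> 1 \<le> log_dist Q1 Q2"
proof -
  assume "0 \<le> sidelength Q1" "0 \<le> sidelength Q2"
  then have "2 \<le> 2 + setdist Q1 Q2 / (sidelength Q1 + sidelength Q2)" by simp
  then have "log 2 2 \<le> log 2 (2 + setdist Q1 Q2 / (sidelength Q1 + sidelength Q2))"
    by (subst log_le_cancel_iff) auto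
  then show ?thesis unfolding log_dist_def by simp
qed

text \<open>Both cubes are compared with a cube containing them whose side is comparable to the sum of
  their distance and their sides.\<close>

lemma mean_diff_log_dist:
  fixes f :: "real^'n \<Rightarrow> real"
  assumes B: "\<And>b m. 0 < m \<Longrightarrow> mean_osc (cube b m) f \<le> B"
    and f: "f locally_integrable_on UNIV" and l: "0 < l1" "0 < l2"
  shows "\<bar>mean (cube a1 l1) f - mean (cube a2 l2) f\<bar> \<le>
     8 * 2 ^ CARD('n) * B * log_dist (cube a1 l1) (cube a2 l2)"
proof -
  define d where "d = setdist (cube a1 l1) (cube a2 l2)"
  define R where "R = d + l1 + l2"
  define L where "L = log_dist (cube a1 l1) (cube a2 l2)"
  have d0: "0 \<le> d" by (simp add: d_def)
  have L1: "1 \<le> L" unfolding L_def using l by (intro log_dist_ge_1) (auto simp: sidelength_cube)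
  have B0: "0 \<le> B" using B[of 1] mean_osc_nonneg order_trans zero_less_one by blast
  obtain x y where xy: "x \<in> cube a1 l1" "y \<in> cube a2 l2" "dist x y = d"
    using setdist_compact_closed[OF compact_cube closed_cube] cube_nonempty[of l1 a1] cube_nonempty[of l2 a2] l
    unfolding d_def by (metis less_imp_le)
  have xyi: "\<bar>x$i - y$i\<bar> \<le> d" for i
    using xy(3) by (metis component_le_norm_cart dist_norm vector_minus_component)
  \<comment> \<open>Lower corner of a common cube. Its side \<open>R\<close> suffices because
    \<open>x\<close> and \<open>y\<close> differ by at most \<open>d\<close> in each
    coordinate.\<close>
  define b :: "real^'n" where "b = (\<chi> i. min (a1$i) (a2$i))"
  have R0: "0 < R" using l d0 by (simp add: R_def)
  have s1: "cube a1 l1 \<subseteq> cube b R"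
  proof (subst cube_subset_iff, use l in simp, intro allI conjI)
    fix i show "b$i \<le> a1$i" by (simp add: b_def)
    show "a1$i + l1 \<le> b$i + R"
      using xy(1)[unfolded mem_cube, rule_format, of i] xy(2)[unfolded mem_cube, rule_format, of i] xyi[of i] l d0
      by (auto simp: b_def R_def min_def)
  qed
  have s2: "cube a2 l2 \<subseteq> cube b R"
  proof (subst cube_subset_iff, use l in simp, intro allI conjI)
    fix i show "b$i \<le> a2$i" by (simp add: b_def)
    show "a2$i + l2 \<le> b$i + R"
      using xy(1)[unfolded mem_cube, rule_format, of i] xy(2)[unfolded mem_cube, rule_format, of i] xyi[of i] l d0
      by (auto simp: b_def R_def min_def)
  qed
  have fi: "f absolutely_integrable_on cube b R"
    using f by (rule locally_integrable_cube) simp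
  have key: "\<bar>mean (cube a l) f - mean (cube b R) f\<bar> \<le> 4 * L * (2 ^ CARD('n) * B)"
    if ll: "0 < l" "0 < l'" and sub: "cube a l \<subseteq> cube b R" and Re: "R = d + l + l'"
      and Le: "L = \<bar>log 2 (l' / l)\<bar> + log 2 (2 + d / (l + l'))" for a l l'
  proof -
    \<comment> \<open>The number of doublings that take the side \<open>l\<close> to at least
      \<open>R\<close>.\<close>
    define k where "k = nat \<lceil>log 2 (R / l)\<rceil>"
    have Rl: "1 \<le> R / l" using ll d0 Re by simp
    have lg0: "0 \<le> log 2 (R / l)" using Rl by (simp add: zero_le_log_cancel_iff)
    have k1: "log 2 (R / l) \<le> real k" unfolding k_def using lg0 by linarith
    have k2: "real k \<le> log 2 (R / l) + 1" unfolding k_def using lg0 by linarith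
    have "R / l \<le> 2 powr real k" using k1 Rl by (subst (asm) log_le_iff) auto
    then have Rk: "R \<le> 2 ^ k * l" using ll by (simp add: powr_realpow field_simps)
    \<comment> \<open>The two factors correspond to the two terms of \<open>log_dist\<close>:
      relative distance and ratio of sides.\<close>
    have eq: "R / l = (1 + d / (l + l')) * (1 + l' / l)"
    proof -
      have "(1 + d / (l + l')) * (1 + l' / l) = ((l + l' + d) / (l + l')) * ((l + l') / l)"
        using ll by (simp add: add_divide_distrib)
      also have "\<dots> = R / l" using ll by (simp add: Re add_ac)
      finally show ?thesis by simp
    qed
    have pos: "0 < 1 + d / (l + l')" "0 < 1 + l' / l" using ll d0 by (auto intro: add_pos_nonneg)
    have "log 2 (R / l) = log 2 (1 + d / (l + l')) + log 2 (1 + l' / l)"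
      unfolding eq using pos by (simp add: log_mult_pos)
    also have "log 2 (1 + d / (l + l')) \<le> log 2 (2 + d / (l + l'))"
      using pos by (subst log_le_cancel_iff) auto
    also have "log 2 (1 + l' / l) \<le> 1 + \<bar>log 2 (l' / l)\<bar>"
    proof (cases "l' / l \<le> 1")
      case True
      have "log 2 (1 + l' / l) \<le> log 2 2" using True pos by (subst log_le_cancel_iff) auto
      then show ?thesis by simp
    next
      case False
      have "log 2 (1 + l' / l) \<le> log 2 (2 * (l' / l))" using False pos by (subst log_le_cancel_iff) auto
      also have "\<dots> = log 2 2 + log 2 (l' / l)" using ll by (subst log_mult) auto
      finally show ?thesis by simp
    qed
    finally have "log 2 (R / l) \<le> L + 1" using Le by simp
    \<comment> \<open>From \<open>k \<le> L + 2\<close> and \<open>1 \<le> L\<close>.\<close>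
    then have k3: "real k + 1 \<le> 4 * L" using k2 L1 by linarith
    have "\<bar>mean (cube a l) f - mean (cube b R) f\<bar> \<le> (real k + 1) * 2 ^ CARD('n) * B"
      by (rule mean_diff_nested) (use B fi R0 ll sub Rk in auto)
    also have "\<dots> = (real k + 1) * (2 ^ CARD('n) * B)" by simp
    also have "\<dots> \<le> 4 * L * (2 ^ CARD('n) * B)" using k3 B0 by (intro mult_right_mono) auto
    finally show ?thesis .
  qed
  have sl: "sidelength (cube a1 l1) = l1" "sidelength (cube a2 l2) = l2" using l by (auto simp: sidelength_cube)
  have sym: "\<bar>log 2 (l1 / l2)\<bar> = \<bar>log 2 (l2 / l1)\<bar>" using l by (simp add: log_divide)
  have "\<bar>mean (cube a1 l1) f - mean (cube b R) f\<bar> \<le> 4 * L * (2 ^ CARD('n) * B)"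
    by (rule key[OF l s1]) (auto simp: R_def L_def log_dist_def sl sym d_def)
  moreover have "\<bar>mean (cube a2 l2) f - mean (cube b R) f\<bar> \<le> 4 * L * (2 ^ CARD('n) * B)"
    by (rule key[OF l(2,1) s2]) (auto simp: R_def L_def log_dist_def sl d_def add_ac)
  ultimately have "\<bar>mean (cube a1 l1) f - mean (cube a2 l2) f\<bar> \<le> 2 * (4 * L * (2 ^ CARD('n) * B))" by linarith
  also have "\<dots> = 8 * 2 ^ CARD('n) * B * L" by simp
  finally show ?thesis by (simp only: L_def)
qed

text \<open>By Bernoulli's inequality the relative volume of a shell is at most the dimension times
  its relative width.\<close>

lemma ccube_shell_measure:
  fixes c :: "real^'n"
  assumes "0 < r"
  shows "measure lebesgue (ccube c r - ccube c ((1 - (1/2)^i) * r)) \<le>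
     real CARD('n) * (1/2)^i * measure lebesgue (ccube c r)"
proof -
  let ?s = "1 - (1/2::real)^i"
  have s: "0 \<le> ?s" "?s \<le> 1" by (auto simp: power_le_one)
  have sr: "?s * r \<le> r" using s assms by (intro mult_left_le_one_le) auto
  have sub: "ccube c (?s * r) \<subseteq> ccube c r"
    using sr unfolding subset_iff mem_ccube by (meson order_trans)
  have m: "measure lebesgue (ccube c \<rho>) = (2 * \<rho>) ^ CARD('n)" if "0 \<le> \<rho>" for \<rho>
    unfolding ccube_def by (rule measure_cube) (use that in simp)
  have "measure lebesgue (ccube c r - ccube c (?s * r)) = measure lebesgue (ccube c r) - measure lebesgue (ccube c (?s * r))"
    using sub lmeasurable_cube unfolding ccube_def
    by (intro measure_Diff fmeasurableD fmeasurableD2[OF lmeasurable_cube, unfolded infinity_ennreal_def[symmetric]])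
  also have "\<dots> = (2 * r) ^ CARD('n) - (2 * (?s * r)) ^ CARD('n)"
    using assms s by (simp only: m less_imp_le mult_nonneg_nonneg)
  also have "\<dots> = (2 * r) ^ CARD('n) * (1 - ?s ^ CARD('n))"
  proof -
    have "2 * (?s * r) = (2 * r) * ?s" by simp
    then have "(2 * (?s * r)) ^ CARD('n) = (2 * r) ^ CARD('n) * ?s ^ CARD('n)"
      by (metis power_mult_distrib)
    then show ?thesis by (simp only: right_diff_distrib mult_1_right)
  qed
  also have "\<dots> \<le> (2 * r) ^ CARD('n) * (real CARD('n) * (1/2)^i)"
  proof (intro mult_left_mono)
    have "1 + real CARD('n) * (- ((1/2)^i)) \<le> (1 + (- ((1/2::real)^i))) ^ CARD('n)"
      by (rule Bernoulli_inequality) (simp add: power_le_one)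
    then show "1 - ?s ^ CARD('n) \<le> real CARD('n) * (1/2)^i" by simp
  qed (use assms in simp)
  finally show ?thesis using assms by (simp add: m mult_ac)
qed

context whitney
begin

section \<open>Chains inside a cube contained in the domain\<close>

lemma side_wd: 
  assumes "S \<in> E" "S' \<in> E" shows "side S' \<le> 4 ^ wd S S' * side S"
proof -
  have "(S, S') \<in> adj ^^ m \<Longrightarrow> side S' \<le> 4 ^ m * side S" for m
  proof (induction m arbitrary: S')
    case (Suc m)
    then obtain T where T: "(S, T) \<in> adj ^^ m" "(T, S') \<in> adj" by auto
    then have "side S' \<le> 4 * side T" using E_touch unfolding adj_def by blast
    also have "\<dots> \<le> 4 * (4 ^ m * side S)" using Suc.IH[OF T(1)] by simp
    finally show ?case by simp
  qed simp
  then show ?thesis using wd_adj[OF assms] by blast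
qed

text \<open>Halving the distance to the faces of the cube costs a bounded number of chain steps. A
  point \<open>x\<close> of the concentric cube of index \<open>i + 1\<close> is pulled back to
  \<open>y\<close> in that of index \<open>i\<close>. The segment between them has length at most
  \<open>rn * \<delta>\<close> and stays at distance \<open>\<delta>\<close> from the complement; as
  \<open>rn * rn\<close> is the dimension, this amounts to \<open>10 * CARD('n)\<close> pieces in
  \<open>wd_segment\<close>.\<close>

lemma wd_concentric:
  assumes "ccube c r \<subseteq> \<Omega>" "0 < r" "S \<in> E" "c \<in> S"
  shows "S' \<in> E \<Longrightarrow> x \<in> S' \<Longrightarrow> x \<in> ccube c ((1 - (1/2)^i) * r) \<Longrightarrow> wd S S' \<le> i * (10 * CARD('n) + 1) + 1"
proof (induction i arbitrary: S' x)
  case 0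
  have "x = c" using 0(3) by (simp add: mem_ccube vec_eq_iff)
  then show ?case using wd_meet[of S S'] 0 assms by auto
next
  case (Suc i)
  define p :: real where "p = (1/2)^i"
  have p: "0 < p" "p \<le> 1" by (auto simp: p_def power_le_one)
  have e: "(1/2::real) ^ Suc i = p/2" by (simp add: p_def)
  define \<delta> where "\<delta> = p/2 * r"
  have del: "0 < \<delta>" using p assms by (simp add: \<delta>_def)
  \<comment> \<open>The contraction towards \<open>c\<close> that takes the cube of index
    \<open>i + 1\<close> to the one of index \<open>i\<close>.\<close>
  define \<rho> where "\<rho> = (1 - p) / (1 - p/2)"
  have rho: "0 \<le> \<rho>" "\<rho> \<le> 1" "\<rho> * (1 - p/2) = 1 - p" using p by (auto simp: \<rho>_def field_simps)
  define y where "y = c + \<rho> *\<^sub>R (x - c)"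
  have x: "\<bar>x$k - c$k\<bar> \<le> (1 - p/2) * r" for k
    using Suc.prems(3) unfolding mem_ccube e by blast
  have y: "\<bar>y$k - c$k\<bar> \<le> (1 - p) * r" for k
  proof -
    have "\<bar>y$k - c$k\<bar> = \<rho> * \<bar>x$k - c$k\<bar>" using rho by (simp add: y_def abs_mult)
    also have "\<dots> \<le> \<rho> * ((1 - p/2) * r)" using x rho by (intro mult_left_mono) auto
    finally show ?thesis using rho(3) by (simp add: mult.assoc[symmetric])
  qed
  have bdz: "\<delta> \<le> bd z" if "z \<in> ccube c ((1 - p/2) * r)" for z
  proof (rule ccontr)
    assume "\<not> \<delta> \<le> bd z"
    then have "infdist z (- \<Omega>) < \<delta>" by (simp add: bd_def)
    obtain w where w: "w \<in> - \<Omega>" "infdist z (- \<Omega>) = dist z w"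
      using infdist_attains_inf[OF closed_compl compl_ne] by metis
    have "\<bar>w$k - c$k\<bar> \<le> r" for k
    proof -
      have "\<bar>w$k - z$k\<bar> \<le> dist z w"
        by (metis component_le_norm_cart dist_norm dist_commute vector_minus_component)
      moreover have "\<bar>z$k - c$k\<bar> \<le> (1 - p/2) * r" using that by (auto simp: mem_ccube)
      ultimately have "\<bar>w$k - c$k\<bar> \<le> \<delta> + (1 - p/2) * r"
        using \<open>infdist z (- \<Omega>) < \<delta>\<close> w by linarith
      then show ?thesis by (simp add: \<delta>_def algebra_simps)
    qed
    then have "w \<in> ccube c r" by (simp add: mem_ccube)
    with w assms(1) show False by blast
  qed
  have conv: "convex (ccube c ((1 - p/2) * r))" by (simp add: ccube_def convex_cube)
  have ppr: "(1 - p) * r \<le> (1 - p/2) * r" using p assms by (intro mult_right_mono) auto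
  have yin: "y \<in> ccube c ((1 - p) * r)" using y by (simp add: mem_ccube)
  then have yin2: "y \<in> ccube c ((1 - p/2) * r)" using ppr by (auto simp: mem_ccube intro: order_trans)
  have xin: "x \<in> ccube c ((1 - p/2) * r)" using x by (simp add: mem_ccube)
  have seg: "closed_segment y x \<subseteq> ccube c ((1 - p/2) * r)"
    using closed_segment_subset[OF yin2 xin conv] .
  have "y \<in> \<Omega>" using bdz[OF yin2] del bd_outside by force
  then obtain T where T: "T \<in> E" "y \<in> T" using E_cover by blast
  have "wd T S' \<le> 10 * CARD('n) + 1"
  proof (rule wd_segment[OF del T(1) Suc.prems(1) T(2) Suc.prems(2)])
    show "\<delta> \<le> bd z" if "z \<in> closed_segment y x" for z using that seg bdz by blast
    have "y - x = (1 - \<rho>) *\<^sub>R (c - x)" by (simp add: y_def algebra_simps)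
    then have "dist y x = (1 - \<rho>) * norm (x - c)" using rho by (simp add: dist_norm norm_minus_commute)
    also have "\<dots> \<le> (1 - \<rho>) * (rn * ((1 - p/2) * r))"
      using norm_le_sqrt_card[of "x - c" "(1 - p/2) * r"] x rho unfolding rn_def
      by (intro mult_left_mono) auto
    also have "\<dots> = rn * \<delta>"
    proof -
      have "(1 - \<rho>) * (1 - p/2) = p/2" using rho(3) by (simp add: left_diff_distrib)
      then have "rn * r * ((1 - \<rho>) * (1 - p/2)) = rn * r * (p/2)" by (rule arg_cong)
      then show ?thesis unfolding \<delta>_def by (simp only: mult_ac)
    qed
    also have "\<dots> = real (10 * CARD('n)) * (\<delta> / (10 * rn))"
    proof -
      have "rn * rn = real CARD('n)" by (simp add: rn_def)
      then show ?thesis using rn_pos by (simp add: field_simps)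
    qed
    finally show "dist y x \<le> real (10 * CARD('n)) * (\<delta> / (10 * rn))" .
  qed
  moreover have "wd S T \<le> i * (10 * CARD('n) + 1) + 1"
    by (rule Suc.IH[OF T]) (use yin in \<open>simp add: p_def\<close>)
  ultimately show ?case using wd_triangle[of S T S'] assms T Suc.prems by auto
qed

text \<open>The slope \<open>K\<close> is taken so large that cubes not meeting the one containing \<open>x\<close> are irrelevant
  for the minimum up to level \<open>N\<close>.\<close>

definition wd_fun :: "real \<Rightarrow> (real^'n) set \<Rightarrow> nat \<Rightarrow> real^'n \<Rightarrow> real" where
  "wd_fun K S1 N x = min (real N) (INF S\<in>E. real (wd S1 S) + K * infdist x S)"

lemma E_ne: "E \<noteq> {}" using ne E_Union by blast

lemma wd_fun_bdd_below: "0 \<le> K \<Longrightarrow> bdd_below ((\<lambda>S. real (wd S1 S) + K * infdist x S) ` E)"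
  by (rule bdd_belowI2[of _ 0]) (simp add: infdist_nonneg)

text \<open>An infimum of \<open>K\<close>-Lipschitz functions is \<open>K\<close>-Lipschitz, and
  truncation preserves this.\<close>

lemma wd_fun_lipschitz:
  assumes "0 \<le> K" shows "\<bar>wd_fun K S1 N x - wd_fun K S1 N y\<bar> \<le> K * dist x y"
proof -
  let ?g = "\<lambda>x. INF S\<in>E. real (wd S1 S) + K * infdist x S"
  have *: "?g x \<le> ?g y + K * dist x y" for x y
  proof -
    have "?g x - K * dist x y \<le> ?g y"
    proof (rule cINF_greatest[OF E_ne])
      fix S assume S: "S \<in> E"
      have "?g x \<le> real (wd S1 S) + K * infdist x S"
        by (rule cINF_lower[OF wd_fun_bdd_below[OF assms] S])
      also have "K * infdist x S \<le> K * (infdist y S + dist x y)"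
        using infdist_triangle assms by (intro mult_left_mono) auto
      finally show "?g x - K * dist x y \<le> real (wd S1 S) + K * infdist y S" by (simp add: algebra_simps)
    qed
    then show ?thesis by simp
  qed
  have "0 \<le> K * dist x y" using assms by simp
  then show ?thesis using *[of x y] *[of y x] unfolding wd_fun_def by (simp add: dist_commute min_def abs_le_iff)
qed

lemma wd_fun_nonneg: "0 \<le> K \<Longrightarrow> 0 \<le> wd_fun K S1 N x"
  unfolding wd_fun_def by (auto intro!: cINF_greatest[OF E_ne] simp: infdist_nonneg)

lemma wd_fun_le:
  assumes "0 \<le> K" "S \<in> E" "x \<in> S"
  shows "wd_fun K S1 N x \<le> min (real N) (real (wd S1 S))"
proof -
  have "(INF S\<in>E. real (wd S1 S) + K * infdist x S) \<le> real (wd S1 S) + K * infdist x S"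
    by (rule cINF_lower[OF wd_fun_bdd_below[OF assms(1)] assms(2)])
  then show ?thesis using assms by (simp add: wd_fun_def min_def)
qed

text \<open>A competitor \<open>T\<close> in the infimum has level at least \<open>N\<close>, or
  meets \<open>S\<close> and gains at most 1, or is disjoint from \<open>S\<close>. In the last case
  with level below \<open>N\<close>, it is at distance at least \<open>h\<close> from
  \<open>x\<close>, so that the penalty alone reaches \<open>N\<close>.\<close>

lemma wd_fun_ge:
  assumes K: "0 \<le> K" "real N \<le> K * h"
    and h: "\<And>T y. T \<in> E \<Longrightarrow> wd S1 T < N \<Longrightarrow> y \<in> T \<Longrightarrow> h \<le> bd y / (10 * rn)"
    and S: "S1 \<in> E" "S \<in> E" "x \<in> S"
  shows "min (real N) (real (wd S1 S)) - 1 \<le> wd_fun K S1 N x"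
proof -
  have "min (real N) (real (wd S1 S)) - 1 \<le> real (wd S1 T) + K * infdist x T" if T: "T \<in> E" for T
  proof -
    have p: "0 \<le> K * infdist x T" using K by (simp add: infdist_nonneg)
    consider "N \<le> wd S1 T" | "S \<inter> T \<noteq> {}" | "wd S1 T < N" "S \<inter> T = {}" by linarith
    then show ?thesis
    proof cases
      case 1
      then have "real N \<le> real (wd S1 T)" by simp
      then show ?thesis using p by linarith
    next
      case 2
      then have "wd S1 S \<le> wd S1 T + 1"
        using wd_triangle[of S1 T S] wd_meet[of T S] S T by (auto simp: Int_commute)
      then have "real (wd S1 S) \<le> real (wd S1 T) + 1" by linarith
      then show ?thesis using p by linarith
    next
      case 3
      have "h \<le> infdist x T"
        unfolding infdist_notempty[OF E_nonempty[OF T]]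
      proof (rule cINF_greatest[OF E_nonempty[OF T]])
        fix y assume y: "y \<in> T"
        have "\<not> dist y x \<le> bd y / (10 * rn)" using near_meet[OF T S(2) y S(3)] 3(2) by blast
        then show "h \<le> dist x y" using h[OF T 3(1) y] by (simp add: dist_commute)
      qed
      then have "K * h \<le> K * infdist x T" using K by (intro mult_left_mono) auto
      then show ?thesis using K(2) by linarith
    qed
  qed
  then have "min (real N) (real (wd S1 S)) - 1 \<le> (INF S\<in>E. real (wd S1 S) + K * infdist x S)"
    by (intro cINF_greatest[OF E_ne]) auto
  then show ?thesis unfolding wd_fun_def by linarith
qed

text \<open>Up to layer \<open>i\<close> the deviation from the central value is at most
  \<open>(10 * CARD('n) + 2) * (i + 1)^2\<close>, the relative measure of the shells is
  \<open>CARD('n) * 2^-i\<close>, and the factor 2 passes to the deviation from the mean. Only the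
  dimension enters.\<close>

definition wd_fun_bmo :: real where
  "wd_fun_bmo = 2 * (layer_const (real CARD('n)) (1/2) * (10 * real CARD('n) + 2))"

text \<open>Along the segment from the centre of a cube to one of its points the distance to the
  complement decays at most geometrically, so the oscillation on the \<open>i\<close>-th concentric
  shell is linear in \<open>i\<close>.\<close>

lemma mean_osc_wd_fun_le:
  assumes f: "\<And>S S' x y. S \<in> E \<Longrightarrow> S' \<in> E \<Longrightarrow> x \<in> S \<Longrightarrow> y \<in> S' \<Longrightarrow> \<bar>f x - f y\<bar> \<le> real (wd S S') + 1"
    and fi: "f absolutely_integrable_on cube a l" and "0 < l" "cube a l \<subseteq> \<Omega>"
  shows "mean_osc (cube a l) f \<le> wd_fun_bmo"
proof -
  define c where "c = a + vec (l/2)" define r where "r = l/2"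
  have Q: "cube a l = ccube c r" unfolding c_def r_def by (rule cube_eq_ccube)
  have r: "0 < r" using assms by (simp add: r_def)
  have cQ: "c \<in> cube a l" unfolding Q mem_ccube using r by simp
  then obtain S where S: "S \<in> E" "c \<in> S" using assms E_cover by blast
  let ?M = "layer_const (real CARD('n)) (1/2) * (10 * real CARD('n) + 2)"
  have M0: "0 \<le> ?M" using layer_const_ge_1[of "1/2" "real CARD('n)"] by (intro mult_nonneg_nonneg) auto
  have "(\<integral>\<^sup>+x. ennreal \<bar>f x - f c\<bar> * indicator (cube a l) x \<partial>lebesgue) \<le> ennreal (?M * measure lebesgue (cube a l))"
  proof (rule layer_nn_integral[where A = "\<lambda>i. ccube c r - ccube c ((1 - (1/2)^i) * r)"])
    fix i
    show "ccube c r - ccube c ((1 - (1/2)^i) * r) \<in> lmeasurable"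
      unfolding ccube_def by (intro fmeasurable.Diff lmeasurable_cube)
    show "measure lebesgue (ccube c r - ccube c ((1 - (1/2)^i) * r)) \<le> real CARD('n) * (1/2)^i * measure lebesgue (cube a l)"
      unfolding Q by (rule ccube_shell_measure[OF r])
    fix x assume x: "x \<in> cube a l" "x \<notin> ccube c r - ccube c ((1 - (1/2)^i) * r)"
    then obtain S' where S': "S' \<in> E" "x \<in> S'" using assms E_cover by blast
    have "wd S S' \<le> i * (10 * CARD('n) + 1) + 1"
      by (rule wd_concentric[OF _ r S S']) (use assms(4) x in \<open>auto simp: Q\<close>)
    then have "real (wd S S') \<le> real (i * (10 * CARD('n) + 1) + 1)" by (rule of_nat_mono)
    then have "real (wd S S') + 1 \<le> real i * (10 * real CARD('n) + 1) + 2" by (simp add: algebra_simps)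
    also have "\<dots> \<le> (10 * real CARD('n) + 2) * (real i + 1)" by (simp add: algebra_simps)
    also have "\<dots> \<le> (10 * real CARD('n) + 2) * (real i + 1)\<^sup>2"
      by (intro mult_left_mono) (auto simp: power2_eq_square)
    finally show "\<bar>f x - f c\<bar> \<le> (10 * real CARD('n) + 2) * (real i + 1)\<^sup>2"
      using f[OF S' (1) S(1) S'(2) S(2)] wd_sym[OF S(1) S'(1)] by linarith
  qed (auto intro: lmeasurable_cube)
  then have "mean (cube a l) (\<lambda>x. \<bar>f x - f c\<bar>) \<le> ?M"
    using assms M0 by (intro mean_le_nn_integral) auto
  then show ?thesis using mean_osc_le[OF assms(3) fi, of "f c"] unfolding wd_fun_bmo_def by linarith
qed

theorem jones_of_extension:
  assumes "0 \<le> C" and T: "linear_extension_map \<Omega> (VMO \<Omega>) (BMO UNIV) T"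
    and bound: "\<And>f. f \<in> VMO \<Omega> \<Longrightarrow> bmo_norm UNIV (T f) \<le> ennreal C * bmo_norm \<Omega> f"
  shows "jones_condition E"
proof -
  define B where "B = C * wd_fun_bmo"
  have b0: "0 \<le> wd_fun_bmo" unfolding wd_fun_bmo_def
    using layer_const_ge_1[of "1/2" "real CARD('n)"] by (intro mult_nonneg_nonneg) auto
  have B0: "0 \<le> B" using assms b0 by (simp add: B_def)
  have main: "real (wd S1 S2) \<le> (8 * 2 ^ CARD('n) * B + 1) * log_dist S1 S2"
    if S: "S1 \<in> E" "S2 \<in> E" for S1 S2
  proof -
    define N where "N = wd S1 S2"
    \<comment> \<open>Sides shrink at most by 4 per chain step, so below level \<open>N\<close> they
      are at least \<open>side S1 / 4 ^ N\<close>. Division by \<open>10 * rn\<close> gives a radius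
      within which \<open>near_meet\<close> applies.\<close>
    define h where "h = side S1 / 4 ^ N / (10 * rn)"
    have h0: "0 < h" using side_pos[OF S(1)] rn_pos by (simp add: h_def)
    define K where "K = real N / h"
    have K: "0 \<le> K" "real N \<le> K * h" using h0 by (auto simp: K_def)
    have h: "h \<le> bd y / (10 * rn)" if "T \<in> E" "wd S1 T < N" "y \<in> T" for T y
    proof -
      have "side S1 \<le> 4 ^ wd T S1 * side T" by (rule side_wd) (use that S in auto)
      also have "\<dots> \<le> 4 ^ N * side T"
        using that S wd_sym[of S1 T] side_pos[of T] by (intro mult_right_mono power_increasing) auto
      finally have "side S1 / 4 ^ N \<le> side T" by (simp add: field_simps)
      also have "\<dots> \<le> bd y" using side_le_bd that by blast
      finally show ?thesis unfolding h_def using rn_pos by (intro divide_right_mono) auto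
    qed
    define f where "f = wd_fun K S1 N"
    have fle: "f x \<le> min (real N) (real (wd S1 S))" if "S \<in> E" "x \<in> S" for S x
      unfolding f_def by (rule wd_fun_le[OF K(1) that])
    have fge: "min (real N) (real (wd S1 S)) - 1 \<le> f x" if "S \<in> E" "x \<in> S" for S x
      unfolding f_def by (rule wd_fun_ge[OF K h S(1) that])
    have fd: "\<bar>f x - f y\<bar> \<le> real (wd S S') + 1" if "S \<in> E" "S' \<in> E" "x \<in> S" "y \<in> S'" for S S' x y
    proof -
      have "wd S1 S \<le> wd S1 S' + wd S S'" "wd S1 S' \<le> wd S1 S + wd S S'"
        using wd_triangle[of S1 S' S] wd_triangle[of S1 S S'] wd_sym[of S S'] that S by auto
      then show ?thesis
        using fle[OF that(1,3)] fle[OF that(2,4)] fge[OF that(1,3)] fge[OF that(2,4)]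
        by (simp add: min_def abs_le_iff split: if_splits)
    qed
    have lip: "\<bar>f x - f y\<bar> \<le> K * dist x y" for x y unfolding f_def by (rule wd_fun_lipschitz[OF K(1)])
    have cont: "continuous_on UNIV f"
      by (rule lipschitz_on_continuous_on[of K]) (use lip K in \<open>auto simp: lipschitz_on_def dist_real_def\<close>)
    have fli: "f locally_integrable_on X" for X using cont by (rule continuous_locally_integrable)
    have fi: "f absolutely_integrable_on cube a l" for a l
      using locally_integrable_cube[OF fli[of UNIV]] by simp
    have osc: "mean_osc (cube a l) f \<le> 2 * (K * rn) * l" if "0 < l" for a l
    proof -
      have "mean (cube a l) (\<lambda>x. \<bar>f x - f a\<bar>) \<le> mean (cube a l) (\<lambda>x. K * (rn * l))"
      proof (rule mean_mono[OF abs_integrable_diff_const[OF fi]])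
        fix x assume x: "x \<in> cube a l"
        have "a \<in> cube a l" using that by (simp add: mem_cube)
        then have "K * dist x a \<le> K * (rn * l)"
          using dist_cube_le[OF x] K unfolding rn_def by (intro mult_left_mono) auto
        then show "\<bar>f x - f a\<bar> \<le> K * (rn * l)" using lip[of x a] by linarith
      qed simp
      then show ?thesis using mean_osc_le[OF that fi, of a "f a"] that by (simp add: mean_const)
    qed
    \<comment> \<open>The rate depends on \<open>K\<close>, hence on the pair of cubes; only
      membership in VMO is drawn from it.\<close>
    have "(osc_modulus \<Omega> f \<longlongrightarrow> 0) (at_right 0)"
    proof (rule tendsto_sandwich[where f = "\<lambda>_. 0" and h = "\<lambda>t. ennreal (2 * (K * rn) * t)"])
      show "\<forall>\<^sub>F t in at_right 0. osc_modulus \<Omega> f t \<le> ennreal (2 * (K * rn) * t)"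
      proof (intro always_eventually allI osc_modulus_leI)
        fix t a l assume "0 < l" "l < (t::real)"
        then have "2 * (K * rn) * l \<le> 2 * (K * rn) * t" using K rn_pos by (intro mult_left_mono) auto
        then show "mean_osc (cube a l) f \<le> 2 * (K * rn) * t" using osc[OF \<open>0 < l\<close>, of a] by linarith
      qed
      have "((\<lambda>t. 2 * (K * rn) * t) \<longlongrightarrow> 2 * (K * rn) * 0) (at_right 0)" by (intro tendsto_intros)
      then show "((\<lambda>t. ennreal (2 * (K * rn) * t)) \<longlongrightarrow> 0) (at_right 0)"
        using tendsto_ennrealI[of "\<lambda>t. 2 * (K * rn) * t" 0 "at_right 0"] by simp
    qed auto
    then have vmo: "f \<in> VMO \<Omega>" using fli by (simp add: VMO_def)
    have "bmo_norm \<Omega> f \<le> ennreal wd_fun_bmo"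
      by (intro bmo_norm_leI mean_osc_wd_fun_le fd fi)
    then have "ennreal C * bmo_norm \<Omega> f \<le> ennreal C * ennreal wd_fun_bmo" by (rule mult_left_mono) simp
    then have nF: "bmo_norm UNIV (T f) \<le> ennreal B"
      using bound[OF vmo] assms(1) b0 by (simp add: B_def ennreal_mult)
    have F: "T f locally_integrable_on UNIV" and FAE: "AE x in lebesgue_on \<Omega>. T f x = f x"
      using T vmo unfolding linear_extension_map_def BMO_def by auto
    have FAE': "AE x in lebesgue. x \<in> \<Omega> \<longrightarrow> T f x = f x"
      using FAE op by (subst (asm) AE_restrict_space_iff) auto
    have mF: "mean S (T f) = mean S f" if "S \<in> E" for S
    proof -
      obtain a l where al: "0 < l" "S = cube a l" "side S = l" using \<open>S \<in> E\<close> by (rule E_cubeE)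
      show ?thesis unfolding al(2)
      proof (rule mean_cong_AE)
        show "AE x\<in>cube a l in lebesgue. T f x = f x"
          using FAE' by (rule AE_mp) (use E_subset[OF that] al in auto)
      qed (use fi locally_integrable_cube[OF F] in auto)
    qed
    obtain a1 l1 where al1: "0 < l1" "S1 = cube a1 l1" "side S1 = l1" using S(1) by (rule E_cubeE)
    obtain a2 l2 where al2: "0 < l2" "S2 = cube a2 l2" "side S2 = l2" using S(2) by (rule E_cubeE)
    have "mean S1 f = mean S1 (\<lambda>x. 0)"
    proof (rule mean_cong)
      fix x assume "x \<in> S1"
      then have "f x \<le> 0" using fle[OF S(1)] wd_refl[OF S(1)] by force
      then show "f x = 0" using wd_fun_nonneg[OF K(1), of S1 N x] by (simp add: f_def)
    qed
    then have m1: "mean S1 (T f) = 0" using mF[OF S(1)] mean_const[OF al1(1), of a1 0] al1(2) by simp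
    have "mean S2 (\<lambda>x. real N - 1) \<le> mean S2 f"
    proof (unfold al2(2), rule mean_mono)
      fix x assume "x \<in> cube a2 l2"
      then show "real N - 1 \<le> f x" using fge[OF S(2), of x] al2 by (simp add: N_def)
    qed (use fi in auto)
    then have "real N - 1 \<le> mean S2 (T f)" using mF[OF S(2)] al2 by (simp add: mean_const)
    then have "real N - 1 \<le> \<bar>mean S1 (T f) - mean S2 (T f)\<bar>" using m1 by linarith
    also have "\<dots> \<le> 8 * 2 ^ CARD('n) * B * log_dist S1 S2"
      unfolding al1(2) al2(2)
      by (rule mean_diff_log_dist[OF bmo_norm_leD[OF nF B0] F]) (use al1 al2 in auto)
    finally have "real N \<le> 8 * 2 ^ CARD('n) * B * log_dist S1 S2 + 1" by simp
    \<comment> \<open>The unit lost in the regularisation is absorbed, since \<open>log_dist\<close>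
      is at least 1.\<close>
    also have "\<dots> \<le> 8 * 2 ^ CARD('n) * B * log_dist S1 S2 + log_dist S1 S2"
      using log_dist_ge_1[of S1 S2] side_pos S by (simp add: less_imp_le)
    finally show ?thesis by (simp add: N_def algebra_simps)
  qed
  show ?thesis unfolding jones_condition_def
    by (intro exI[of _ "8 * 2 ^ CARD('n) * B + 1"] conjI ballI main) (use B0 in \<open>auto intro: add_nonneg_pos\<close>)
qed

end

subsection \<open>Domains satisfying the Jones condition\<close>

lemma sum_geometric_le:
  fixes q :: real assumes "0 \<le> q" "q < 1"
  shows "(\<Sum>k<m. q ^ k) \<le> 1 / (1 - q)"
proof -
  have "(\<Sum>k<m. q ^ k) = (1 - q ^ m) / (1 - q)"
    using assms by (simp add: sum_gp_strict)
  also have "\<dots> \<le> 1 / (1 - q)" using assms by (intro divide_right_mono) auto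
  finally show ?thesis .
qed

text \<open>The exponent is the distance from \<open>i\<close> to \<open>M\<close>; each side is
  bounded by a full geometric series.\<close>

lemma sum_two_sided_geometric_le:
  fixes q :: real assumes "0 \<le> q" "q < 1" "M < p"
  shows "(\<Sum>i<p. q ^ (if i \<le> M then M - i else i - M)) \<le> 2 / (1 - q)"
proof -
  let ?g = "\<lambda>i. q ^ (if i \<le> M then M - i else i - M)"
  have "(\<Sum>i<p. ?g i) = (\<Sum>i<M. ?g i) + (\<Sum>i=M..<p. ?g i)"
    using assms(3) by (subst sum.union_disjoint[symmetric]) (auto simp: ivl_disj_un)
  also have "(\<Sum>i<M. ?g i) \<le> (\<Sum>i<M. q ^ (M - Suc i))"
    using assms by (intro sum_mono) (auto intro: power_decreasing)
  also have "\<dots> = (\<Sum>k<M. q ^ k)" by (rule sum.nat_diff_reindex)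
  also have "\<dots> \<le> 1 / (1 - q)" by (rule sum_geometric_le) (use assms in auto)
  also have "(\<Sum>i=M..<p. ?g i) = (\<Sum>i=M..<p. q ^ (i - M))" by (intro sum.cong) auto
  also have "\<dots> = (\<Sum>k=0..<p - M. q ^ k)"
    using sum.shift_bounds_nat_ivl[of "\<lambda>i. q ^ (i - M)" 0 M "p - M"] assms(3) by simp
  also have "\<dots> = (\<Sum>k<p - M. q ^ k)" by (simp add: atLeast0LessThan)
  also have "\<dots> \<le> 1 / (1 - q)" by (rule sum_geometric_le) (use assms in auto)
  finally show ?thesis by simp
qed

lemma frontier_between:
  fixes \<Omega> :: "'a::real_normed_vector set"
  assumes "open \<Omega>" "x \<in> \<Omega>" "y \<notin> \<Omega>"
  obtains z where "z \<in> closure \<Omega>" "z \<notin> \<Omega>" "dist x z \<le> dist x y" "dist y z \<le> dist x y"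
proof -
  have "closed_segment x y \<inter> frontier \<Omega> \<noteq> {}"
    by (rule connected_Int_frontier) (use assms in auto)
  then obtain z where z: "z \<in> closed_segment x y" "z \<in> frontier \<Omega>" by blast
  have "z \<in> closure \<Omega>" "z \<notin> \<Omega>" using z(2) assms(1) by (auto simp: frontier_def interior_open)
  moreover have "dist x z \<le> dist x y" "dist y z \<le> dist x y"
    using segment_bound[OF z(1)] by (auto simp: dist_norm norm_minus_commute)
  ultimately show ?thesis using that by blast
qed

lemma interval_grid_cover:
  fixes x a u :: real
  assumes "0 < u" "0 < N" "a \<le> x" "x \<le> a + real N * u"
  shows "\<exists>k<N. a + real k * u \<le> x \<and> x \<le> a + real k * u + u"
proof -
  define k where "k = min (N - 1) (nat \<lfloor>(x - a) / u\<rfloor>)"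
  have y: "0 \<le> (x - a) / u" "(x - a) / u \<le> real N" using assms by (auto simp: field_simps)
  have "real k \<le> (x - a) / u" unfolding k_def using y by linarith
  then have 1: "a + real k * u \<le> x" using assms by (simp add: field_simps)
  have "(x - a) / u \<le> real k + 1" unfolding k_def using y assms(2) by linarith
  then have "x \<le> a + real k * u + u" using assms by (simp add: field_simps)
  with 1 show ?thesis using assms(2) by (intro exI[of _ k]) (auto simp: k_def)
qed

text \<open>The first grid point to the right of \<open>b\<close> is less than one mesh away, so an
  interval of two meshes still contains the grid interval that starts there.\<close>

lemma interval_grid_inside:
  fixes a b u s :: real
  assumes "0 < u" "a \<le> b" "b + s \<le> a + real N * u" "2 * u \<le> s"
  shows "\<exists>k<N. b \<le> a + real k * u \<and> a + real k * u + u \<le> b + s"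
proof -
  define k where "k = nat \<lceil>(b - a) / u\<rceil>"
  have y: "0 \<le> (b - a) / u" using assms by simp
  have "(b - a) / u \<le> real k" unfolding k_def using y by linarith
  then have 1: "b \<le> a + real k * u" using assms by (simp add: field_simps)
  have "real k \<le> (b - a) / u + 1" unfolding k_def using y by linarith
  then have "real k * u \<le> b - a + u" using assms by (simp add: field_simps)
  then have 2: "a + real k * u + u \<le> b + s" using assms by linarith
  then have "(real k + 1) * u \<le> real N * u" using assms by (simp add: algebra_simps)
  then have "k < N" using assms(1) by simp
  with 1 2 show ?thesis by blast
qed

text \<open>The cube is cut into \<open>N ^ CARD('n)\<close> equal subcubes. Since
  \<open>2 / c \<le> real N\<close>, one of them lies in the hole, where \<open>\<beta>\<close> is
  too large to count; the others are treated by induction at side \<open>t / N\<close>. Each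
  generation thus loses the fraction \<open>(1 / N) ^ CARD('n)\<close>.\<close>

lemma grid_porous_measure:
  fixes \<beta> :: "real^'n \<Rightarrow> real"
  assumes c: "0 < c" and N: "2 / c \<le> real N" and meas: "\<beta> \<in> borel_measurable borel"
    and por: "\<And>a t. 0 < t \<Longrightarrow> \<exists>b. cube b (c * t) \<subseteq> cube a t \<and> (\<forall>x\<in>cube b (c * t). c * t \<le> \<beta> x)"
  shows "0 < t \<Longrightarrow> measure lebesgue {x \<in> cube a t. \<beta> x < c * (1 / real N) ^ i * t} \<le>
    (1 - (1 / real N) ^ CARD('n)) ^ i * t ^ CARD('n)"
proof (induction i arbitrary: a t)
  case 0
  have "measure lebesgue {x \<in> cube a t. \<beta> x < c * (1 / real N) ^ 0 * t} \<le> measure lebesgue (cube a t)"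
    using meas by (intro measure_mono_fmeasurable lmeasurable_cube) (auto intro!: sets_completionI_sets)
  then show ?case using measure_cube[of t a] 0 by simp
next
  case (Suc i)
  have N0: "0 < real N" using N c by (metis divide_pos_pos less_le_trans zero_less_numeral)
  define u where "u = t / real N"
  have u: "0 < u" using N0 Suc by (simp add: u_def)
  have Nu: "real N * u = t" using N0 by (simp add: u_def)
  let ?Q = "\<lambda>k. cube (a + u *\<^sub>R (\<chi> j. real (k j))) u"
  let ?A = "\<lambda>k. {x \<in> ?Q k. \<beta> x < c * (1 / real N) ^ i * u}"
  let ?I = "PiE (UNIV :: 'n set) (\<lambda>_. {..<N})"
  have fin: "finite ?I" by (intro finite_PiE) auto
  have cI: "card ?I = N ^ CARD('n)" by (simp add: card_funcsetE)
  have Am: "?A k \<in> lmeasurable" for k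
    using meas by (intro fmeasurableI2[OF lmeasurable_cube[of "a + u *\<^sub>R (\<chi> j. real (k j))" u]])
      (auto intro!: sets_completionI_sets)
  obtain b where b: "cube b (c * t) \<subseteq> cube a t" "\<And>x. x \<in> cube b (c * t) \<Longrightarrow> c * t \<le> \<beta> x"
    using por[OF Suc.prems] by blast
  have "\<exists>k<N. b$j \<le> a$j + real k * u \<and> a$j + real k * u + u \<le> b$j + c * t" for j
  proof (rule interval_grid_inside[OF u])
    show "a$j \<le> b$j" "b$j + c * t \<le> a$j + real N * u"
      using b(1) Nu c Suc.prems by (auto simp: cube_subset_iff)
    show "2 * u \<le> c * t" using N Suc.prems c N0 by (simp add: u_def field_simps)
  qed
  then obtain k0 where k0: "\<And>j. k0 j < N" "\<And>j. b$j \<le> a$j + real (k0 j) * u"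
    "\<And>j. a$j + real (k0 j) * u + u \<le> b$j + c * t" by metis
  have k0I: "k0 \<in> ?I" using k0 by auto
  have Qk0: "?Q k0 \<subseteq> cube b (c * t)"
    using u k0 by (subst cube_subset_iff) (auto simp: mult.commute)
  have pow: "c * (1 / real N) ^ Suc i * t = c * (1 / real N) ^ i * u" by (simp add: u_def)
  have le1: "(1 / real N) ^ Suc i \<le> 1" using N0 by (intro power_le_one) auto
  have "{x \<in> cube a t. \<beta> x < c * (1 / real N) ^ Suc i * t} \<subseteq> (\<Union>k\<in>?I - {k0}. ?A k)"
  proof
    fix x assume x: "x \<in> {x \<in> cube a t. \<beta> x < c * (1 / real N) ^ Suc i * t}"
    have "\<exists>k<N. a$j + real k * u \<le> x$j \<and> x$j \<le> a$j + real k * u + u" for j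
      by (rule interval_grid_cover[OF u]) (use x N0 Nu in \<open>auto simp: mem_cube\<close>)
    then obtain k where k: "\<And>j. k j < N" "\<And>j. a$j + real (k j) * u \<le> x$j"
      "\<And>j. x$j \<le> a$j + real (k j) * u + u" by metis
    have xk: "x \<in> ?Q k" using k by (simp add: mem_cube mult.commute)
    have "k \<noteq> k0"
    proof
      assume "k = k0"
      then have "c * t \<le> \<beta> x" using xk Qk0 b by blast
      moreover have "c * (1 / real N) ^ Suc i * t \<le> c * 1 * t"
        using le1 c Suc.prems by (intro mult_right_mono mult_left_mono) auto
      ultimately show False using x by simp
    qed
    then show "x \<in> (\<Union>k\<in>?I - {k0}. ?A k)" using xk k x pow by auto
  qed
  then have "measure lebesgue {x \<in> cube a t. \<beta> x < c * (1 / real N) ^ Suc i * t}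
      \<le> measure lebesgue (\<Union>k\<in>?I - {k0}. ?A k)"
    using meas fin Am
    by (intro measure_mono_fmeasurable fmeasurable.finite_UN) (auto intro!: sets_completionI_sets)
  also have "\<dots> \<le> (\<Sum>k\<in>?I - {k0}. measure lebesgue (?A k))"
    using fin Am by (intro measure_UNION_le) (auto intro: fmeasurableD)
  also have "\<dots> \<le> (\<Sum>k\<in>?I - {k0}. (1 - (1 / real N) ^ CARD('n)) ^ i * u ^ CARD('n))"
    by (intro sum_mono Suc.IH u)
  also have "\<dots> = (real N ^ CARD('n) - 1) * ((1 - (1 / real N) ^ CARD('n)) ^ i * u ^ CARD('n))"
  proof -
    have "card (?I - {k0}) = N ^ CARD('n) - 1" using fin k0I cI by simp
    moreover have "1 \<le> N ^ CARD('n)" using N0 by simp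
    ultimately show ?thesis by (simp add: of_nat_diff)
  qed
  also have "\<dots> = (1 - (1 / real N) ^ CARD('n)) ^ i * ((real N ^ CARD('n) - 1) * u ^ CARD('n))" by (simp only: mult_ac)
  also have "(real N ^ CARD('n) - 1) * u ^ CARD('n) = (1 - (1 / real N) ^ CARD('n)) * t ^ CARD('n)"
    using N0 by (simp add: u_def power_divide field_simps)
  finally show ?case by (simp only: power_Suc mult_ac)
qed

section \<open>Corkscrew cubes\<close>

locale whitney_jones = whitney \<Omega> E for \<Omega> :: "(real^'n) set" and E +
  fixes \<kappa> :: real
  assumes kappa: "0 < \<kappa>" and jones: "S \<in> E \<Longrightarrow> S' \<in> E \<Longrightarrow> real (wd S S') \<le> \<kappa> * log_dist S S'"
begin

definition S0 :: "(real^'n) set" where "S0 = (SOME S. S \<in> E)"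
text \<open>Points of \<open>S0\<close> are at distance at least \<open>2 * D\<close> from the
  complement. A ball of radius at most \<open>D\<close> about a point outside the domain therefore
  cannot contain \<open>S0\<close>, and every chain ending in \<open>S0\<close> leaves it.\<close>

definition D :: real where "D = side S0 / 2"

lemma S0: "S0 \<in> E" unfolding S0_def using E_ne by (simp add: some_in_eq)
lemma D_pos: "0 < D" using side_pos[OF S0] by (simp add: D_def)

lemma chain_dist_le:
  assumes "\<And>i. i \<le> m \<Longrightarrow> Q i \<in> E" "\<And>i. i < m \<Longrightarrow> touches (Q i) (Q (Suc i))" "x \<in> Q 0"
  shows "j \<le> m \<Longrightarrow> y \<in> Q j \<Longrightarrow> dist x y \<le> rn * (\<Sum>i<Suc j. side (Q i))"
proof (induction j arbitrary: y)
  case 0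
  then show ?case using E_dist[of "Q 0" x y] assms by simp
next
  case (Suc j)
  obtain w where w: "w \<in> Q j" "w \<in> Q (Suc j)" using assms(2)[of j] Suc.prems by (auto simp: touches_def)
  have "dist x y \<le> dist x w + dist w y" by (rule dist_triangle)
  also have "\<dots> \<le> rn * (\<Sum>i<Suc j. side (Q i)) + rn * side (Q (Suc j))"
    using Suc.IH[OF _ w(1)] E_dist[OF assms(1)[OF Suc.prems(1)] w(2) Suc.prems(2)] Suc.prems(1) by linarith
  finally show ?case by (simp add: algebra_simps)
qed

text \<open>The part inside the ball of a geodesic from a tiny cube near \<open>z\<close> to \<open>S0\<close> has sides decaying
  geometrically away from its largest cube, while their sum is at least comparable to \<open>r\<close>.\<close>

lemma corkscrew:
  "\<exists>c>0. \<forall>z r. z \<in> closure \<Omega> \<longrightarrow> z \<notin> \<Omega> \<longrightarrow> 0 < r \<longrightarrow> r \<le> D \<longrightarrow> (\<exists>S\<in>E. S \<subseteq> cball z r \<and> c * r \<le> side S)"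
proof -
  \<comment> \<open>Chosen so that \<open>q ^ (2 * k)\<close> is the decay of sides that the Jones
    condition gives at chain distance \<open>k\<close>; half of the exponent is given up
    below.\<close>
  define q where "q = 2 powr (- 1 / (2 * \<kappa>))"
  have q: "0 < q" "q < 1" using kappa by (auto simp: q_def powr_less_one)
  have q2: "q ^ (2 * k) = 2 powr (- real k / \<kappa>)" for k
  proof -
    have "q ^ (2 * k) = q powr (real (2 * k))" using q(1) by (rule powr_realpow[symmetric])
    then show ?thesis using kappa by (simp add: q_def powr_powr)
  qed
  define G where "G = 10 * rn / (1 - q)"
  have G: "0 < G" using q rn_pos by (simp add: G_def)
  have "\<exists>S\<in>E. S \<subseteq> cball z r \<and> 1 / (1 + 8 * G\<^sup>2) * r \<le> side S"
    if z: "z \<in> closure \<Omega>" "z \<notin> \<Omega>" and r: "0 < r" "r \<le> D" for z r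
  proof -
    \<comment> \<open>So small that a cube of side at most \<open>e\<close> through a point within
      \<open>e\<close> of \<open>z\<close> stays in the ball of radius \<open>r / 4\<close>.\<close>
    define e where "e = r / (4 * (1 + rn))"
    have e: "0 < e" using r rn_pos by (simp add: e_def)
    have e4: "e * (1 + rn) = r / 4" using rn_pos by (simp add: e_def field_simps)
    obtain x where x: "x \<in> \<Omega>" "dist x z < e" using z(1) e unfolding closure_approachable by blast
    obtain S1 where S1: "S1 \<in> E" "x \<in> S1" using E_cover x by blast
    have sS1: "side S1 \<le> e" using side_le_bd[OF S1] bd_le_dist[OF z(2), of x] x(2) by linarith
    have S1c: "S1 \<subseteq> cball z r"
    proof
      fix y assume "y \<in> S1"
      then have "dist z y \<le> dist x z + rn * side S1"
        using E_dist[OF S1, of y] dist_triangle[of z y x] by (simp add: dist_commute)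
      also have "\<dots> \<le> e + rn * e" using x(2) sS1 rn_pos by (intro add_mono mult_left_mono) auto
      also have "\<dots> = r / 4" using e4 by (simp add: algebra_simps)
      finally show "y \<in> cball z r" using r by simp
    qed
    have S0c: "\<not> S0 \<subseteq> cball z r"
    proof
      assume s: "S0 \<subseteq> cball z r"
      obtain y where y: "y \<in> S0" using E_nonempty[OF S0] by blast
      then have "2 * D \<le> dist y z" using side_le_bd[OF S0 y] bd_le_dist[OF z(2), of y] by (simp add: D_def)
      then show False using s y r by (auto simp: dist_commute)
    qed
    define m where "m = wd S1 S0"
    obtain Q where Q: "Q 0 = S1" "Q m = S0" "\<And>i. i \<le> m \<Longrightarrow> Q i \<in> E"
      "\<And>i. i < m \<Longrightarrow> touches (Q i) (Q (Suc i))"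
      "\<And>i j. i \<le> j \<Longrightarrow> j \<le> m \<Longrightarrow> wd (Q i) (Q j) = j - i"
      using wd_geodesic[OF S1(1) S0] unfolding m_def by metis
    \<comment> \<open>The index of the first cube that is not contained in the ball; the cubes
      before it carry the estimate.\<close>
    define p where "p = (LEAST i. \<not> Q i \<subseteq> cball z r)"
    have pn: "\<not> Q p \<subseteq> cball z r" unfolding p_def by (rule LeastI[of _ m]) (simp add: Q S0c)
    have pm: "p \<le> m" unfolding p_def by (rule Least_le) (simp add: Q S0c)
    have pin: "Q i \<subseteq> cball z r" if "i < p" for i using not_less_Least that unfolding p_def by blast
    have p0: "0 < p" using pn Q(1) S1c by (cases p) auto
    have QE: "Q i \<in> E" if "i \<le> p" for i using Q(3) that pm by simp
    define s where "s = Max ((\<lambda>i. side (Q i)) ` {..<p})"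
    have "s \<in> (\<lambda>i. side (Q i)) ` {..<p}" unfolding s_def using p0 by (intro Max_in) auto
    then obtain M where M: "M < p" "side (Q M) = s" by auto
    have smax: "side (Q i) \<le> s" if "i < p" for i unfolding s_def using that by (intro Max_ge) auto
    have s0: "0 < s" using M side_pos[OF QE, of M] by simp
    define X where "X = 2 + 2 * r / s"
    have X: "2 \<le> X" using r s0 by (simp add: X_def)
    have li: "side (Q i) \<le> s * sqrt X * q ^ (if i \<le> M then M - i else i - M)" if i: "i < p" for i
    proof -
      define k where "k = (if i \<le> M then M - i else i - M)"
      let ?l = "side (Q i)"
      have l0: "0 < ?l" using side_pos[OF QE] i by simp
      have wdk: "wd (Q i) (Q M) = k"
      proof (cases "i \<le> M")
        case True then show ?thesis using Q(5)[of i M] M pm by (simp add: k_def)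
      next
        case False
        have "wd (Q i) (Q M) = wd (Q M) (Q i)" by (rule wd_sym) (use QE i M in auto)
        then show ?thesis using False Q(5)[of M i] i pm by (simp add: k_def)
      qed
      have sd: "setdist (Q i) (Q M) \<le> 2 * r"
      proof -
        obtain y w where yw: "y \<in> Q i" "w \<in> Q M"
          using E_nonempty[OF QE, of i] E_nonempty[OF QE, of M] i M by fastforce
        then have "dist z y \<le> r" "dist z w \<le> r" using pin[OF i] pin[OF M(1)] by auto
        then have "dist y w \<le> 2 * r" using dist_triangle[of y w z] by (simp add: dist_commute)
        then show ?thesis using setdist_le_dist[OF yw] by linarith
      qed
      have "log_dist (Q i) (Q M) \<le> log 2 (s / ?l) + log 2 X"
      proof -
        have "\<bar>log 2 (?l / s)\<bar> = log 2 (s / ?l)"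
        proof -
          have "log 2 (?l / s) = - log 2 (s / ?l)" using l0 s0 by (simp add: log_divide)
          moreover have "0 \<le> log 2 (s / ?l)" using l0 smax[OF i] by (simp add: zero_le_log_cancel_iff)
          ultimately show ?thesis by simp
        qed
        moreover have "setdist (Q i) (Q M) / (?l + s) \<le> 2 * r / s"
          using sd l0 s0 r by (intro frac_le) auto
        then have "log 2 (2 + setdist (Q i) (Q M) / (?l + s)) \<le> log 2 X"
          using l0 s0 X by (subst log_le_cancel_iff) (auto simp: X_def intro: add_pos_nonneg)
        ultimately show ?thesis unfolding log_dist_def M(2) by simp
      qed
      then have "real k \<le> \<kappa> * (log 2 (s / ?l) + log 2 X)"
        using jones[OF QE QE, of i M] i M kappa unfolding wdk
        by (meson less_imp_le mult_left_mono order_trans)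
      also have "log 2 (s / ?l) + log 2 X = log 2 (s * X / ?l)"
        using l0 s0 X by (subst log_mult_pos[symmetric]) auto
      finally have "real k / \<kappa> \<le> log 2 (s * X / ?l)" using kappa by (simp add: field_simps)
      then have "2 powr (real k / \<kappa>) \<le> s * X / ?l" using l0 s0 X by (simp add: le_log_iff)
      then have "?l \<le> s * X * 2 powr (- (real k / \<kappa>))"
        using l0 by (simp add: powr_minus field_simps)
      also have "2 powr (- (real k / \<kappa>)) = q ^ (2 * k)" by (simp add: q2)
      finally have l1: "?l \<le> s * X * q ^ (2 * k)" .
      \<comment> \<open>The geometric mean of the trivial bound \<open>s\<close> and the Jones
        bound. Summing the Jones bound alone would give nothing, as \<open>s * X\<close> contains
        the term \<open>2 * r\<close>; with the square root of \<open>X\<close> the inequality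
        forces \<open>s\<close> to be comparable to \<open>r\<close>.\<close>
      have "?l * ?l \<le> s * (s * X * q ^ (2 * k))" using l0 s0 smax[OF i] l1 by (intro mult_mono) auto
      also have "\<dots> = (s * sqrt X * q ^ k)\<^sup>2"
        using X by (simp add: power_mult_distrib power_mult[symmetric] power2_eq_square[of s] mult.commute)
      finally have "?l\<^sup>2 \<le> (s * sqrt X * q ^ k)\<^sup>2" by (simp add: power2_eq_square)
      then have "?l \<le> s * sqrt X * q ^ k" by (rule power2_le_imp_le) (use s0 X q in auto)
      then show ?thesis by (simp only: k_def)
    qed
    define Sm where "Sm = (\<Sum>i<p. side (Q i))"
    have "Sm \<le> (\<Sum>i<p. s * sqrt X * q ^ (if i \<le> M then M - i else i - M))"
      unfolding Sm_def using li by (intro sum_mono) auto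
    also have "\<dots> = s * sqrt X * (\<Sum>i<p. q ^ (if i \<le> M then M - i else i - M))"
      by (simp only: sum_distrib_left)
    also have "\<dots> \<le> s * sqrt X * (2 / (1 - q))"
      using sum_two_sided_geometric_le[of q M p] q M s0 X by (intro mult_left_mono) auto
    finally have Sm: "Sm \<le> s * sqrt X * (2 / (1 - q))" .
    obtain y where y: "y \<in> Q p" "r < dist z y" using pn unfolding subset_iff mem_cball not_all not_imp not_le by blast
    have "dist x y \<le> rn * (\<Sum>i<Suc p. side (Q i))"
      by (rule chain_dist_le[of m Q]) (use Q S1 pm y in auto)
    also have "(\<Sum>i<Suc p. side (Q i)) = Sm + side (Q p)" by (simp add: Sm_def)
    \<comment> \<open>The exit cube is at most four times as large as its predecessor, which is a
      summand of \<open>Sm\<close>.\<close>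
    also have "side (Q p) \<le> 4 * Sm"
    proof -
      have pp: "Suc (p - 1) = p" using p0 by simp
      have "side (Q p) \<le> 4 * side (Q (p - 1))"
        using E_touch[OF QE QE, of "p - 1" p] Q(4)[of "p - 1"] pp pm p0 by auto
      also have "side (Q (p - 1)) \<le> Sm" unfolding Sm_def
        by (rule member_le_sum) (use p0 side_pos QE in \<open>auto intro: less_imp_le\<close>)
      finally show ?thesis by simp
    qed
    finally have "dist x y \<le> rn * (5 * Sm)" using rn_pos by simp
    also have "\<dots> \<le> rn * (5 * (s * sqrt X * (2 / (1 - q))))" using Sm rn_pos by (intro mult_left_mono) auto
    also have "\<dots> = G * (s * sqrt X)" by (simp add: G_def)
    finally have dxy: "dist x y \<le> G * (s * sqrt X)" .
    have "e \<le> r / 4" using e4 rn_pos e by (metis add.commute le_add_same_cancel2 less_imp_le mult.right_neutral mult_left_mono)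
    then have "3/4 * r \<le> G * (s * sqrt X)"
      using dxy y(2) dist_triangle[of z y x] x(2) by (simp add: dist_commute)
    then have "(3/4 * r)\<^sup>2 \<le> (G * (s * sqrt X))\<^sup>2" using r by (intro power_mono) auto
    also have "\<dots> = G\<^sup>2 * s * (s * X)" using X by (simp add: power_mult_distrib power2_eq_square)
    also have "s * X = 2 * s + 2 * r" using s0 by (simp add: X_def algebra_simps)
    finally have ineq: "(3/4 * r)\<^sup>2 \<le> G\<^sup>2 * s * (2 * s + 2 * r)" .
    have "r \<le> (1 + 8 * G\<^sup>2) * s"
    proof (cases "r \<le> s")
      case True
      have "0 \<le> 8 * G\<^sup>2 * s" using s0 by simp
      then show ?thesis using True unfolding distrib_right by linarith
    next
      case False
      have "G\<^sup>2 * s * (2 * s + 2 * r) \<le> G\<^sup>2 * s * (4 * r)"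
        using False s0 by (intro mult_left_mono) auto
      then have "9/16 * r * r \<le> 4 * (G\<^sup>2 * s) * r" using ineq by (simp add: power2_eq_square)
      then have "9/16 * r \<le> 4 * (G\<^sup>2 * s)" using r by (simp only: mult_le_cancel_right_pos)
      moreover have "0 \<le> G\<^sup>2 * s" using s0 by simp
      ultimately have "r \<le> 8 * (G\<^sup>2 * s)" by linarith
      then show ?thesis using s0 by (simp add: algebra_simps)
    qed
    moreover have "0 < 1 + 8 * G\<^sup>2" by (simp add: add_pos_nonneg)
    ultimately have "1 / (1 + 8 * G\<^sup>2) * r \<le> s" by (simp add: field_simps)
    then show ?thesis using M pin[OF M(1)] QE[of M] by (intro bexI[of _ "Q M"]) auto
  qed
  then show ?thesis by (intro exI[of _ "1 / (1 + 8 * G\<^sup>2)"] conjI) (auto intro!: divide_pos_pos add_pos_nonneg)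
qed

section \<open>Distance to the frontier and porosity\<close>

definition fr :: "real^'n \<Rightarrow> real" where "fr x = bd x + infdist x \<Omega>"

text \<open>\<open>fr\<close> is the distance to the frontier: of its two summands one always
  vanishes. Each summand is 1-Lipschitz, whence the factor 2 without a case distinction.\<close>

lemma fr_lipschitz: "fr x \<le> fr y + 2 * dist x y"
  using bd_lipschitz[of x y] infdist_triangle[of x \<Omega> y] by (simp add: fr_def abs_le_iff)

lemma fr_measurable: "fr \<in> borel_measurable borel"
proof -
  have "fr = (\<lambda>x. infdist x (- \<Omega>) + infdist x \<Omega>)" by (auto simp: fr_def bd_def fun_eq_iff)
  moreover have "continuous_on UNIV (\<lambda>x. infdist x (- \<Omega>) + infdist x \<Omega>)" by (intro continuous_intros)
  ultimately show ?thesis by (simp add: borel_measurable_continuous_onI)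
qed

lemma fr_inside: "x \<in> \<Omega> \<Longrightarrow> fr x = bd x" by (simp add: fr_def)
lemma fr_outside: "x \<notin> \<Omega> \<Longrightarrow> fr x = infdist x \<Omega>" by (simp add: fr_def bd_outside)

lemma frontier_near:
  assumes "fr p < s"
  obtains z where "z \<in> closure \<Omega>" "z \<notin> \<Omega>" "dist p z < s"
proof (cases "p \<in> \<Omega>")
  case True
  obtain w where w: "w \<in> - \<Omega>" "infdist p (- \<Omega>) = dist p w"
    using infdist_attains_inf[OF closed_compl compl_ne] by metis
  obtain z where z: "z \<in> closure \<Omega>" "z \<notin> \<Omega>" "dist p z \<le> dist p w"
    using frontier_between[OF op True] w(1) by blast
  show ?thesis by (rule that[OF z(1,2)]) (use z w assms True in \<open>simp add: fr_inside bd_def\<close>)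
next
  case False
  then have "infdist p \<Omega> < s" using assms by (simp add: fr_outside)
  then obtain w where w: "w \<in> \<Omega>" "dist p w < s"
    unfolding infdist_notempty[OF ne] by (subst (asm) cINF_less_iff) (auto simp: ne)
  obtain z where z: "z \<in> closure \<Omega>" "z \<notin> \<Omega>" "dist p z \<le> dist w p"
    using frontier_between[OF op w(1) False] by blast
  show ?thesis by (rule that[OF z(1,2)]) (use z w in \<open>simp add: dist_commute\<close>)
qed

text \<open>A very large cube has a corner away from the whole domain. Otherwise, if the centre is
  far from the frontier, a small cube about the centre is a hole, and if it is close, a corkscrew
  cube at a nearby frontier point contains one.\<close>

lemma porosity:
  "\<exists>c>0. \<forall>a t. 0 < t \<longrightarrow> (\<exists>b. cube b (c * t) \<subseteq> cube a t \<and> (\<forall>x\<in>cube b (c * t). c * t \<le> fr x))"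
proof -
  obtain c where c: "0 < c" and cs: "\<And>z r. z \<in> closure \<Omega> \<Longrightarrow> z \<notin> \<Omega> \<Longrightarrow> 0 < r \<Longrightarrow> r \<le> D \<Longrightarrow>
      \<exists>S\<in>E. S \<subseteq> cball z r \<and> c * r \<le> side S"
    using corkscrew by blast
  define T0 where "T0 = 8 * diameter \<Omega>"
  have T0: "0 < T0" using diameter_pos by (simp add: T0_def)
  \<comment> \<open>The first entry keeps the central hole away from the frontier. The second makes
    the hole fit into a corkscrew cube, where \<open>D / T0\<close> compensates for radii capped at
    \<open>D\<close>.\<close>
  define c2 where "c2 = min (1 / (8 * rn)) (c * min (1/4) (D / T0))"
  have c2: "0 < c2" using c D_pos T0 rn_pos by (simp add: c2_def)
  have "1 / (8 * rn) \<le> 1/8" using rn_ge_1 by (simp add: field_simps)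
  then have c28: "c2 \<le> 1/8" "c2 \<le> 1 / (8 * rn)" unfolding c2_def by linarith+
  have "\<exists>b. cube b (c2 * t) \<subseteq> cube a t \<and> (\<forall>x\<in>cube b (c2 * t). c2 * t \<le> fr x)" if t: "0 < t" for a t
  proof -
    have c2t: "0 \<le> c2 * t" "c2 * t \<le> t / 8" using c2 t c28 by auto
    consider "T0 < t" | "t \<le> T0" "t / 4 \<le> fr (a + vec (t/2))" | "t \<le> T0" "fr (a + vec (t/2)) < t / 4"
      by linarith
    then show ?thesis
    proof cases
      case 1
      from ne obtain w where w: "w \<in> \<Omega>" by auto
      \<comment> \<open>A single coordinate decides which of two opposite corners of the cube is far
        from \<open>w\<close>.\<close>
      obtain b where b: "cube b (t/8) \<subseteq> cube a t" "\<And>x. x \<in> cube b (t/8) \<Longrightarrow> 3/8 * t \<le> dist x w"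
      proof (cases "w$undefined \<le> a$undefined + t/2")
        case True
        show ?thesis
        proof (rule that[of "a + vec (7/8 * t)"])
          fix x assume "x \<in> cube (a + vec (7/8 * t)) (t/8)"
          then have "a$undefined + 7/8 * t \<le> x$undefined" by (auto simp: mem_cube)
          then have "3/8 * t \<le> \<bar>(x - w)$undefined\<bar>" using True t by simp
          also have "\<dots> \<le> dist x w" unfolding dist_norm by (rule component_le_norm_cart)
          finally show "3/8 * t \<le> dist x w" .
        qed (use t in \<open>subst cube_subset_iff, auto\<close>)
      next
        case False
        show ?thesis
        proof (rule that[of a])
          fix x assume "x \<in> cube a (t/8)"
          then have "x$undefined \<le> a$undefined + t/8" by (auto simp: mem_cube)
          then have "3/8 * t \<le> \<bar>(x - w)$undefined\<bar>" using False t by simp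
          also have "\<dots> \<le> dist x w" unfolding dist_norm by (rule component_le_norm_cart)
          finally show "3/8 * t \<le> dist x w" .
        qed (use t in \<open>subst cube_subset_iff, auto\<close>)
      qed
      have sub: "cube b (c2 * t) \<subseteq> cube b (t/8)" using c2t by (subst cube_subset_iff) auto
      have "c2 * t \<le> fr x" if x: "x \<in> cube b (c2 * t)" for x
      proof -
        have "t/4 \<le> infdist x \<Omega>" unfolding infdist_notempty[OF ne]
        proof (rule cINF_greatest[OF ne])
          fix y assume "y \<in> \<Omega>"
          then have "dist y w \<le> t/8" using diameter_bounded_bound[OF bdd _ w, of y] 1 by (simp add: T0_def)
          then show "t/4 \<le> dist x y" using b(2)[of x] sub x dist_triangle[of x w y] by auto
        qed
        then show ?thesis using c2t bd_nonneg[of x] t unfolding fr_def by linarith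
      qed
      then show ?thesis using sub b(1) by blast
    next
      case 2
      define \<rho> where "\<rho> = c2 * t / 2"
      let ?p = "a + vec (t/2)"
      have rho: "0 \<le> \<rho>" "\<rho> \<le> t/2" "rn * \<rho> \<le> t / 16"
      proof -
        show "0 \<le> \<rho>" "\<rho> \<le> t/2" using c2t t by (auto simp: \<rho>_def)
        have "rn * c2 \<le> 1/8" using c28(2) rn_pos by (simp add: field_simps)
        then have "rn * c2 * t \<le> 1/8 * t" using t by (intro mult_right_mono) auto
        then show "rn * \<rho> \<le> t / 16" by (simp add: \<rho>_def mult_ac)
      qed
      have e: "cube (?p - vec \<rho>) (c2 * t) = ccube ?p \<rho>" by (simp add: ccube_def \<rho>_def)
      have "cube (?p - vec \<rho>) (c2 * t) \<subseteq> cube a t"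
        using rho c2t by (subst cube_subset_iff) (auto simp: \<rho>_def)
      moreover have "c2 * t \<le> fr x" if "x \<in> cube (?p - vec \<rho>) (c2 * t)" for x
      proof -
        have "dist ?p x \<le> rn * \<rho>" using that ccube_subset_cball[of ?p \<rho>] unfolding e rn_def by auto
        then show ?thesis using fr_lipschitz[of ?p x] 2 rho c2t by linarith
      qed
      ultimately show ?thesis by blast
    next
      case 3
      let ?p = "a + vec (t/2)"
      obtain z where z: "z \<in> closure \<Omega>" "z \<notin> \<Omega>" "dist ?p z < t / 4" using frontier_near[OF 3(2)] by blast
      define r where "r = min (t/4) D"
      have r: "0 < r" "r \<le> D" "r \<le> t/4" using t D_pos by (auto simp: r_def)
      obtain S where S: "S \<in> E" "S \<subseteq> cball z r" "c * r \<le> side S" using cs[OF z(1,2) r(1,2)] by blast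
      obtain b l where bl: "0 < l" "S = cube b l" "side S = l" using S(1) by (rule E_cubeE)
      have "c2 * t \<le> c * r"
      proof -
        have "c2 * t \<le> c * min (1/4) (D / T0) * t" using t by (intro mult_right_mono) (auto simp: c2_def)
        also have "\<dots> = c * (min (1/4) (D / T0) * t)" by simp
        also have "min (1/4) (D / T0) * t \<le> r"
        proof -
          have "min (1/4) (D / T0) * t \<le> 1/4 * t" using t by (intro mult_right_mono min.cobounded1) simp
          moreover have "min (1/4) (D / T0) * t \<le> D / T0 * T0" using t 3 D_pos T0 by (intro mult_mono min.cobounded2) auto
          ultimately show ?thesis using T0 by (simp add: r_def)
        qed
        finally show ?thesis using c by simp
      qed
      then have le: "c2 * t \<le> l" using S bl by simp
      then have sub: "cube b (c2 * t) \<subseteq> S" unfolding bl(2) using c2t by (subst cube_subset_iff) auto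
      have "S \<subseteq> cube a t"
      proof
        fix y assume "y \<in> S"
        then have "dist z y \<le> t/4" using S(2) r by force
        then have "y \<in> cball ?p (t/2)" using z(3) dist_triangle[of ?p y z] by simp
        then show "y \<in> cube a t" using cball_subset_ccube[of ?p "t/2"] unfolding cube_eq_ccube by blast
      qed
      moreover have "c2 * t \<le> fr x" if "x \<in> cube b (c2 * t)" for x
        using that sub side_le_bd[OF S(1), of x] le bl infdist_nonneg[of x \<Omega>] unfolding fr_def by force
      ultimately show ?thesis using sub by blast
    qed
  qed
  then show ?thesis using c2 by blast
qed

lemma frontier_layers:
  obtains c \<theta> q where "0 < c" "0 < \<theta>" "\<theta> \<le> 1" "0 \<le> q" "q < 1"
    "\<And>a t i. 0 < t \<Longrightarrow> measure lebesgue {x \<in> cube a t. fr x < c * \<theta> ^ i * t} \<le> q ^ i * t ^ CARD('n)"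
proof -
  obtain c where c: "0 < c" and por: "\<And>a t. 0 < t \<Longrightarrow>
      \<exists>b. cube b (c * t) \<subseteq> cube a t \<and> (\<forall>x\<in>cube b (c * t). c * t \<le> fr x)"
    using porosity by blast
  obtain N :: nat where N: "2 / c \<le> real N" using real_arch_simple by blast
  have N0: "0 < real N" using N c by (metis divide_pos_pos less_le_trans zero_less_numeral)
  show ?thesis
  proof (rule that[of c "1 / real N" "1 - (1 / real N) ^ CARD('n)"])
    show "0 \<le> 1 - (1 / real N) ^ CARD('n)" using N0 by (simp add: power_le_one)
    show "measure lebesgue {x \<in> cube a t. fr x < c * (1 / real N) ^ i * t} \<le>
        (1 - (1 / real N) ^ CARD('n)) ^ i * t ^ CARD('n)" if "0 < t" for a t i
      by (rule grid_porous_measure[OF c N fr_measurable por that])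
  qed (use c N0 in auto)
qed

end

subsection \<open>Oscillation along Whitney chains\<close>

lemma set_integral_cover_le:
  fixes g :: "real^'n \<Rightarrow> real"
  assumes "finite I" "Q \<subseteq> (\<Union>k\<in>I. P k)" "\<And>x. 0 \<le> g x" "g absolutely_integrable_on Q"
    "\<And>k. k \<in> I \<Longrightarrow> g absolutely_integrable_on P k"
  shows "(LINT x:Q|lebesgue. g x) \<le> (\<Sum>k\<in>I. LINT x:P k|lebesgue. g x)"
proof -
  have "(LINT x:Q|lebesgue. g x) \<le> (LINT x|lebesgue. (\<Sum>k\<in>I. indicator (P k) x *\<^sub>R g x))"
    unfolding set_lebesgue_integral_def
  proof (rule integral_mono)
    show "integrable lebesgue (\<lambda>x. indicator Q x *\<^sub>R g x)" using assms(4) by (simp add: set_integrable_def)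
    show "integrable lebesgue (\<lambda>x. \<Sum>k\<in>I. indicator (P k) x *\<^sub>R g x)"
      using assms(5) unfolding set_integrable_def by (intro Bochner_Integration.integrable_sum) auto
    fix x
    show "indicator Q x *\<^sub>R g x \<le> (\<Sum>k\<in>I. indicator (P k) x *\<^sub>R g x)"
    proof (cases "x \<in> Q")
      case True
      then obtain k where k: "k \<in> I" "x \<in> P k" using assms(2) by blast
      have "indicator (P k) x *\<^sub>R g x \<le> (\<Sum>k\<in>I. indicator (P k) x *\<^sub>R g x)"
        using assms(1,3) k by (intro member_le_sum) auto
      then show ?thesis using True k by simp
    qed (use assms in \<open>auto intro!: sum_nonneg\<close>)
  qed
  also have "\<dots> = (\<Sum>k\<in>I. LINT x:P k|lebesgue. g x)"
    unfolding set_lebesgue_integral_def using assms(5) unfolding set_integrable_def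
    by (intro Bochner_Integration.integral_sum) auto
  finally show ?thesis .
qed

text \<open>Each of the \<open>2 ^ CARD('n)\<close> subcubes of half the side shares a cube of side
  \<open>h / 2\<close> with the central cube \<open>?P\<close>, so its mean is within
  \<open>2 * 2 ^ CARD('n) * B\<close> of the mean over \<open>?P\<close>.\<close>

lemma mean_osc_double:
  fixes f :: "real^'n \<Rightarrow> real"
  assumes f: "f absolutely_integrable_on cube a (2 * h)" and h: "0 < h"
    and B: "\<And>b. cube b h \<subseteq> cube a (2 * h) \<Longrightarrow> mean_osc (cube b h) f \<le> B"
  shows "mean_osc (cube a (2 * h)) f \<le> 2 * ((1 + 2 * 2 ^ CARD('n)) * B)"
proof -
  let ?I = "PiE (UNIV :: 'n set) (\<lambda>_. {..<2::nat})"
  let ?Q = "\<lambda>k. cube (a + h *\<^sub>R (\<chi> j. real (k j))) h"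
  let ?P = "cube (a + vec (h/2)) h"
  have fin: "finite ?I" by (intro finite_PiE) auto
  have cI: "card ?I = 2 ^ CARD('n)" by (simp add: card_funcsetE)
  have fi: "f absolutely_integrable_on cube b m" if "cube b m \<subseteq> cube a (2 * h)" for b m
    using f that by (meson set_integrable_subset lmeasurable_cube fmeasurableD)
  have k2: "real (k j) \<le> 1" if "k \<in> ?I" for k j
  proof -
    have "k j < 2" using that by (auto simp: PiE_iff)
    then show ?thesis by simp
  qed
  have Qs: "?Q k \<subseteq> cube a (2 * h)" if "k \<in> ?I" for k
    using h k2[OF that] by (subst cube_subset_iff) (auto intro: mult_left_le)
  have Ps: "?P \<subseteq> cube a (2 * h)" using h by (subst cube_subset_iff) auto
  define c where "c = mean ?P f"
  have meanQ: "mean (?Q k) (\<lambda>x. \<bar>f x - c\<bar>) \<le> (1 + 2 * 2 ^ CARD('n)) * B" if k: "k \<in> ?I" for k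
  proof -
    \<comment> \<open>The part of the subcube next to the centre of the big cube.\<close>
    let ?R = "cube (a + (h/2) *\<^sub>R (\<chi> j. 1 + real (k j))) (h/2)"
    have hk: "0 \<le> h * real (k j)" "h * real (k j) \<le> h" for j
      using h k2[OF k, of j] by (auto intro: mult_left_le)
    have h2: "0 \<le> h/2" using h by simp
    have r1: "?R \<subseteq> ?Q k" unfolding cube_subset_iff[OF h2]
    proof
      fix i show "(a + h *\<^sub>R (\<chi> j. real (k j)))$i \<le> (a + (h/2) *\<^sub>R (\<chi> j. 1 + real (k j)))$i \<and>
        (a + (h/2) *\<^sub>R (\<chi> j. 1 + real (k j)))$i + h/2 \<le> (a + h *\<^sub>R (\<chi> j. real (k j)))$i + h"
        using hk[of i] by (simp add: field_simps)
    qed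
    have r2: "?R \<subseteq> ?P" unfolding cube_subset_iff[OF h2]
    proof
      fix i show "(a + vec (h/2))$i \<le> (a + (h/2) *\<^sub>R (\<chi> j. 1 + real (k j)))$i \<and>
        (a + (h/2) *\<^sub>R (\<chi> j. 1 + real (k j)))$i + h/2 \<le> (a + vec (h/2))$i + h"
        using hk[of i] by (simp add: field_simps)
    qed
    have "\<bar>mean ?R f - mean (?Q k) f\<bar> \<le> (h / (h/2)) ^ CARD('n) * mean_osc (?Q k) f"
      by (rule mean_diff_subcube) (use h r1 fi[OF Qs[OF k]] in auto)
    also have "\<dots> \<le> 2 ^ CARD('n) * B" using h B[OF Qs[OF k]] by (auto intro!: mult_left_mono)
    finally have 1: "\<bar>mean ?R f - mean (?Q k) f\<bar> \<le> 2 ^ CARD('n) * B" .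
    have "\<bar>mean ?R f - mean ?P f\<bar> \<le> (h / (h/2)) ^ CARD('n) * mean_osc ?P f"
      by (rule mean_diff_subcube) (use h r2 fi[OF Ps] in auto)
    also have "\<dots> \<le> 2 ^ CARD('n) * B" using h B[OF Ps] by (auto intro!: mult_left_mono)
    finally have 2: "\<bar>mean (?Q k) f - c\<bar> \<le> 2 * 2 ^ CARD('n) * B" using 1 by (simp add: c_def)
    have "mean (?Q k) (\<lambda>x. \<bar>f x - c\<bar>) \<le> mean (?Q k) (\<lambda>x. \<bar>f x - mean (?Q k) f\<bar> + 2 * 2 ^ CARD('n) * B)"
      using fi[OF Qs[OF k]] 2
      by (intro mean_mono abs_integrable_diff_const set_integral_add) auto
    also have "\<dots> = mean_osc (?Q k) f + 2 * 2 ^ CARD('n) * B"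
      using fi[OF Qs[OF k]] h by (subst mean_add) (auto intro: abs_integrable_diff_const simp: mean_const mean_osc_def)
    also have "\<dots> \<le> (1 + 2 * 2 ^ CARD('n)) * B" using B[OF Qs[OF k]] by (simp add: algebra_simps)
    finally show ?thesis .
  qed
  have "(LINT x:cube a (2 * h)|lebesgue. \<bar>f x - c\<bar>) \<le> (\<Sum>k\<in>?I. LINT x:?Q k|lebesgue. \<bar>f x - c\<bar>)"
  proof (rule set_integral_cover_le[OF fin])
    show "cube a (2 * h) \<subseteq> (\<Union>k\<in>?I. ?Q k)"
    proof
      fix x assume x: "x \<in> cube a (2 * h)"
      have "\<exists>k<2. a$j + real k * h \<le> x$j \<and> x$j \<le> a$j + real k * h + h" for j
        by (rule interval_grid_cover[OF h]) (use x in \<open>auto simp: mem_cube\<close>)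
      then obtain k where k: "\<And>j. k j < (2::nat)" "\<And>j. a$j + real (k j) * h \<le> x$j"
        "\<And>j. x$j \<le> a$j + real (k j) * h + h" by metis
      then have "k \<in> ?I" "x \<in> ?Q k" by (auto simp: mem_cube mult.commute)
      then show "x \<in> (\<Union>k\<in>?I. ?Q k)" by blast
    qed
  qed (use abs_integrable_diff_const[OF f] abs_integrable_diff_const[OF fi[OF Qs]] in auto)
  also have "\<dots> \<le> (\<Sum>k\<in>?I. (1 + 2 * 2 ^ CARD('n)) * B * h ^ CARD('n))"
  proof (rule sum_mono)
    fix k assume "k \<in> ?I"
    then show "(LINT x:?Q k|lebesgue. \<bar>f x - c\<bar>) \<le> (1 + 2 * 2 ^ CARD('n)) * B * h ^ CARD('n)"
      using meanQ[of k] h by (simp add: mean_def content_cube field_simps)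
  qed
  also have "\<dots> = (1 + 2 * 2 ^ CARD('n)) * B * (2 * h) ^ CARD('n)" by (simp add: cI power_mult_distrib)
  finally have "mean (cube a (2 * h)) (\<lambda>x. \<bar>f x - c\<bar>) \<le> (1 + 2 * 2 ^ CARD('n)) * B"
    using h by (simp add: mean_def content_cube field_simps)
  then show ?thesis using mean_osc_le[OF _ f, of c] h by simp
qed

section \<open>Comparison of means along chains\<close>

context whitney
begin

text \<open>A real-valued form of the suprema in \<open>ennreal\<close>: validity for all
  \<open>s\<close> is a bound for the BMO norm, and VMO supplies for each positive bound some
  positive \<open>s\<close>.\<close>

definition osc_bd :: "(real^'n \<Rightarrow> real) \<Rightarrow> real \<Rightarrow> real \<Rightarrow> bool" where
  "osc_bd f s B \<longleftrightarrow> f locally_integrable_on \<Omega> \<and>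
     (\<forall>a l. 0 < l \<longrightarrow> l \<le> s \<longrightarrow> cube a l \<subseteq> \<Omega> \<longrightarrow> mean_osc (cube a l) f \<le> B)"

lemma osc_bdD: "osc_bd f s B \<Longrightarrow> 0 < l \<Longrightarrow> l \<le> s \<Longrightarrow> cube a l \<subseteq> \<Omega> \<Longrightarrow> mean_osc (cube a l) f \<le> B"
  by (simp add: osc_bd_def)

lemma osc_bd_integrable: "osc_bd f s B \<Longrightarrow> cube a l \<subseteq> \<Omega> \<Longrightarrow> f absolutely_integrable_on cube a l"
  unfolding osc_bd_def using locally_integrable_cube by blast

lemma osc_bd_double:
  assumes "osc_bd f s B" "0 \<le> B"
  shows "osc_bd f (2 * s) (2 * ((1 + 2 * 2 ^ CARD('n)) * B))"
  unfolding osc_bd_def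
proof (intro conjI allI impI)
  show "f locally_integrable_on \<Omega>" using assms by (simp add: osc_bd_def)
  fix a l assume l: "0 < l" "l \<le> 2 * s" "cube a l \<subseteq> \<Omega>"
  have l2: "l = 2 * (l/2)" by simp
  show "mean_osc (cube a l) f \<le> 2 * ((1 + 2 * 2 ^ CARD('n)) * B)"
    by (subst l2, rule mean_osc_double)
      (use l osc_bd_integrable[OF assms(1) l(3)] in \<open>auto intro!: osc_bdD[OF assms(1)]\<close>)
qed

lemma cube_subset_diameter: "0 < l \<Longrightarrow> cube a l \<subseteq> \<Omega> \<Longrightarrow> l \<le> diameter \<Omega>"
proof -
  assume l: "0 < l" "cube a l \<subseteq> \<Omega>"
  have "a \<in> cube a l" "a + vec l \<in> cube a l" using l by (auto simp: mem_cube)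
  then have "dist (a + vec l) a \<le> diameter \<Omega>"
    using diameter_bounded_bound[OF bdd] l(2) by blast
  moreover have "l \<le> norm (vec l :: real^'n)"
    using component_le_norm_cart[of "vec l :: real^'n" undefined] l by simp
  ultimately show ?thesis by (simp add: dist_norm)
qed

text \<open>Finitely many doublings reach the diameter, and the domain contains no larger cubes. As
  VMO of a bounded domain is defined by small cubes alone, this is what makes its BMO norms
  finite.\<close>

lemma osc_bd_extend:
  assumes "osc_bd f s B" "0 < s" "0 \<le> B"
  shows "\<exists>B'\<ge>0. \<forall>t. osc_bd f t B'"
proof -
  have ex: "\<exists>B'\<ge>0. osc_bd f (2 ^ k * s) B'" for k
  proof (induction k)
    case 0 then show ?case using assms by auto
  next
    case (Suc k)
    then obtain B' where B': "0 \<le> B'" "osc_bd f (2 ^ k * s) B'" by blast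
    show ?case using osc_bd_double[OF B'(2,1)] B'(1)
      by (intro exI[of _ "2 * ((1 + 2 * 2 ^ CARD('n)) * B')"]) (auto simp: mult.assoc)
  qed
  obtain k :: nat where k: "diameter \<Omega> / s < 2 ^ k" using real_arch_pow[of 2 "diameter \<Omega> / s"] by auto
  obtain B' where B': "0 \<le> B'" "osc_bd f (2 ^ k * s) B'" using ex by blast
  have "osc_bd f t B'" for t unfolding osc_bd_def
  proof (intro conjI allI impI)
    show "f locally_integrable_on \<Omega>" using assms by (simp add: osc_bd_def)
    fix a l assume l: "0 < l" "l \<le> t" "cube a l \<subseteq> \<Omega>"
    show "mean_osc (cube a l) f \<le> B'"
      by (rule osc_bdD[OF B'(2) l(1) _ l(3)])
        (use cube_subset_diameter[OF l(1,3)] k assms(2) in \<open>simp add: field_simps\<close>)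
  qed
  then show ?thesis using B'(1) by blast
qed

text \<open>Two means are compared with that of a third cube, each in two steps that cost
  \<open>(8 * rn) ^ CARD('n) * B\<close>.\<close>

definition CJ :: real where "CJ = 4 * (8 * rn) ^ CARD('n)"

lemma CJ_pos: "0 < CJ" using rn_pos by (simp add: CJ_def)

text \<open>Touching cubes need not lie in a common cube inside the domain. They are compared
  through a small cube \<open>?W\<close> about a common point, which stays inside because that point
  is at distance at least \<open>lm\<close> from the complement.\<close>

lemma osc_touching:
  assumes osc: "osc_bd f s B" "0 \<le> B" and S: "S \<in> E" "S' \<in> E" "S \<inter> S' \<noteq> {}" and s: "4 * side S \<le> s"
  shows "\<bar>mean S f - mean S' f\<bar> \<le> CJ * B"
proof -
  define lm where "lm = min (side S) (side S')"
  have lm: "0 < lm" using side_pos S by (simp add: lm_def)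
  define \<rho> where "\<rho> = lm / (2 * rn)"
  have rho: "0 < \<rho>" using lm rn_pos by (simp add: \<rho>_def)
  have rho2: "2 * \<rho> \<le> lm" using lm rn_ge_1 by (simp add: \<rho>_def field_simps)
  obtain x where x: "x \<in> S" "x \<in> S'" using S(3) by blast
  let ?W = "ccube x \<rho>"
  have bdx: "lm \<le> bd x" using side_le_bd[OF S(1) x(1)] by (simp add: lm_def)
  have W: "?W \<subseteq> \<Omega>"
  proof
    fix y assume "y \<in> ?W"
    then have "dist x y \<le> rn * \<rho>" using ccube_subset_cball[of x \<rho>] by (auto simp: rn_def)
    also have "rn * \<rho> = lm / 2" using rn_pos by (simp add: \<rho>_def)
    finally show "y \<in> \<Omega>" using ball_subset[of x y] bdx lm by linarith
  qed
  have Wosc: "mean_osc ?W f \<le> B" unfolding ccube_def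
    by (rule osc_bdD[OF osc(1)]) (use W rho rho2 s lm in \<open>auto simp: ccube_def lm_def\<close>)
  have Wint: "f absolutely_integrable_on ?W" using osc_bd_integrable[OF osc(1)] W by (simp add: ccube_def)
  have key: "\<bar>mean T f - mean ?W f\<bar> \<le> 2 * ((8 * rn) ^ CARD('n) * B)"
    if T: "T \<in> E" "x \<in> T" "lm \<le> side T" "side T \<le> 4 * lm" "side T \<le> s" for T
  proof -
    obtain a l where al: "0 < l" "T = cube a l" "side T = l" using T(1) by (rule E_cubeE)
    have xT: "a$i \<le> x$i" "x$i \<le> a$i + l" for i using T(2) unfolding al(2) mem_cube by auto
    \<comment> \<open>In each coordinate the half of \<open>?W\<close> that stays in
      \<open>T\<close> is taken, which gives a cube of side \<open>\<rho>\<close> contained in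
      both.\<close>
    define e :: "real^'n" where "e = (\<chi> i. if x$i + \<rho> \<le> a$i + l then x$i else x$i - \<rho>)"
    have l2: "2 * \<rho> \<le> l" using rho2 T(3) al by simp
    have e1: "cube e \<rho> \<subseteq> cube a l"
      unfolding cube_subset_iff[OF less_imp_le[OF rho]]
    proof
      fix i show "a$i \<le> e$i \<and> e$i + \<rho> \<le> a$i + l" using xT[of i] rho l2 by (auto simp: e_def)
    qed
    have e2: "cube e \<rho> \<subseteq> ?W"
      unfolding ccube_def cube_subset_iff[OF less_imp_le[OF rho]]
    proof
      fix i show "(x - vec \<rho>)$i \<le> e$i \<and> e$i + \<rho> \<le> (x - vec \<rho>)$i + 2 * \<rho>" using rho by (auto simp: e_def)
    qed
    have Tsub: "cube a l \<subseteq> \<Omega>" using E_subset[OF T(1)] al by simp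
    have "\<bar>mean (cube e \<rho>) f - mean (cube a l) f\<bar> \<le> (l / \<rho>) ^ CARD('n) * mean_osc (cube a l) f"
      by (rule mean_diff_subcube[OF rho e1 osc_bd_integrable[OF osc(1) Tsub] al(1)])
    also have "\<dots> \<le> (8 * rn) ^ CARD('n) * B"
    proof (intro mult_mono power_mono)
      have "l \<le> 4 * lm" using T al by simp
      then show "l / \<rho> \<le> 8 * rn" using rn_pos lm by (simp add: \<rho>_def field_simps)
      show "mean_osc (cube a l) f \<le> B" by (rule osc_bdD[OF osc(1) al(1) _ Tsub]) (use T al in simp)
    qed (use al rho rn_pos osc mean_osc_nonneg in auto)
    finally have 1: "\<bar>mean (cube e \<rho>) f - mean (cube a l) f\<bar> \<le> (8 * rn) ^ CARD('n) * B" .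
    have "\<bar>mean (cube e \<rho>) f - mean ?W f\<bar> \<le> (2 * \<rho> / \<rho>) ^ CARD('n) * mean_osc ?W f"
      unfolding ccube_def
      by (rule mean_diff_subcube) (use rho e2 Wint in \<open>auto simp: ccube_def\<close>)
    also have "\<dots> \<le> (8 * rn) ^ CARD('n) * B"
      using rho rn_ge_1 osc Wosc mean_osc_nonneg by (intro mult_mono power_mono) auto
    finally show ?thesis using 1 al(2) by simp
  qed
  have r: "side S' \<le> 4 * side S" "side S \<le> 4 * side S'"
    using E_touch[OF S(1,2)] E_touch[OF S(2,1)] S(3) side_pos[OF S(1)]
    by (cases "S = S'"; force simp: touches_def)+
  have "\<bar>mean S f - mean ?W f\<bar> \<le> 2 * ((8 * rn) ^ CARD('n) * B)"
    by (rule key[OF S(1) x(1)]) (use r s side_pos[OF S(1)] in \<open>auto simp: lm_def\<close>)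
  moreover have "\<bar>mean S' f - mean ?W f\<bar> \<le> 2 * ((8 * rn) ^ CARD('n) * B)"
    by (rule key[OF S(2) x(2)]) (use r s side_pos[OF S(2)] in \<open>auto simp: lm_def\<close>)
  moreover have "CJ * B = 4 * ((8 * rn) ^ CARD('n) * B)" by (simp add: CJ_def)
  ultimately show ?thesis by linarith
qed

text \<open>Sides grow at most by 4 per step, and the extra 4 is the margin required by
  \<open>osc_touching\<close>. So a short chain that starts from a small cube sees only the
  oscillation at small scales.\<close>

lemma osc_chain:
  assumes osc: "osc_bd f s B" "0 \<le> B" and S: "S \<in> E" "S' \<in> E" and s: "4 ^ (wd S S' + 1) * side S \<le> s"
  shows "\<bar>mean S f - mean S' f\<bar> \<le> real (wd S S') * (CJ * B)"
proof -
  have "(S, S') \<in> adj ^^ m \<Longrightarrow> S' \<in> E \<Longrightarrow> 4 ^ (m + 1) * side S \<le> s \<Longrightarrow> \<bar>mean S f - mean S' f\<bar> \<le> real m * (CJ * B)" for m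
  proof (induction m arbitrary: S')
    case (Suc m)
    obtain T where T: "(S, T) \<in> adj ^^ m" "(T, S') \<in> adj" using Suc.prems(1) by auto
    have TE: "T \<in> E" "T \<inter> S' \<noteq> {}" using T(2) by (auto simp: adj_def touches_def)
    have p: "0 < side S" by (rule side_pos[OF S(1)])
    have "4 ^ (m + 1) * side S \<le> 4 ^ (Suc m + 1) * side S"
      using p by (intro mult_right_mono power_increasing) auto
    then have s1: "4 ^ (m + 1) * side S \<le> s" using Suc.prems(3) by linarith
    have "side T \<le> 4 ^ wd S T * side S" by (rule side_wd[OF S(1) TE(1)])
    also have "\<dots> \<le> 4 ^ m * side S"
      using p wd_le[OF S(1) T(1)] by (intro mult_right_mono power_increasing) auto
    finally have "4 * side T \<le> s" using s1 by simp
    then have "\<bar>mean T f - mean S' f\<bar> \<le> CJ * B"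
      by (intro osc_touching[OF osc TE(1) Suc.prems(2) TE(2)])
    then have "\<bar>mean S f - mean S' f\<bar> \<le> real m * (CJ * B) + CJ * B"
      using Suc.IH[OF T(1) TE(1) s1] by linarith
    then show ?case by (simp add: algebra_simps)
  qed simp
  then show ?thesis using wd_adj[OF S] s S by blast
qed

end

section \<open>Cubes seen from a point at a given scale\<close>

context whitney_jones
begin

text \<open>The corkscrew constant is fixed by choice, because the weights of the extension operator
  are defined with it.\<close>

definition ck :: real where
  "ck = (SOME c. 0 < c \<and> c \<le> 1 \<and> (\<forall>z r. z \<in> closure \<Omega> \<longrightarrow> z \<notin> \<Omega> \<longrightarrow> 0 < r \<longrightarrow> r \<le> D \<longrightarrow>
     (\<exists>S\<in>E. S \<subseteq> cball z r \<and> c * r \<le> side S)))"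

lemma ck: "0 < ck" "ck \<le> 1"
  and corkscrew_ck: "z \<in> closure \<Omega> \<Longrightarrow> z \<notin> \<Omega> \<Longrightarrow> 0 < r \<Longrightarrow> r \<le> D \<Longrightarrow> \<exists>S\<in>E. S \<subseteq> cball z r \<and> ck * r \<le> side S"
proof -
  let ?P = "\<lambda>c. 0 < c \<and> c \<le> 1 \<and> (\<forall>z r. z \<in> closure \<Omega> \<longrightarrow> z \<notin> \<Omega> \<longrightarrow> 0 < r \<longrightarrow> r \<le> D \<longrightarrow>
     (\<exists>S\<in>E. S \<subseteq> cball z r \<and> c * r \<le> side S))"
  obtain c where c: "0 < c" and cs: "\<And>z r. z \<in> closure \<Omega> \<Longrightarrow> z \<notin> \<Omega> \<Longrightarrow> 0 < r \<Longrightarrow> r \<le> D \<Longrightarrow>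
      \<exists>S\<in>E. S \<subseteq> cball z r \<and> c * r \<le> side S"
    using corkscrew by blast
  have "?P (min c 1)"
  proof (intro conjI allI impI)
    fix z and r :: real assume zr: "z \<in> closure \<Omega>" "z \<notin> \<Omega>" "0 < r" "r \<le> D"
    obtain S where "S \<in> E" "S \<subseteq> cball z r" "c * r \<le> side S" using cs[OF zr] by blast
    moreover have "min c 1 * r \<le> c * r" using zr by (intro mult_right_mono) auto
    ultimately show "\<exists>S\<in>E. S \<subseteq> cball z r \<and> min c 1 * r \<le> side S" by (intro bexI[of _ S]) auto
  qed (use c in auto)
  then have "?P ck" unfolding ck_def by (rule someI)
  then show "0 < ck" "ck \<le> 1"
    "z \<in> closure \<Omega> \<Longrightarrow> z \<notin> \<Omega> \<Longrightarrow> 0 < r \<Longrightarrow> r \<le> D \<Longrightarrow> \<exists>S\<in>E. S \<subseteq> cball z r \<and> ck * r \<le> side S"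
    by blast+
qed

definition K0 :: real where "K0 = 10 * rn"
text \<open>Lower bounds for two kinds of cubes: \<open>ck / 2\<close> is the size threshold in the
  weights, and \<open>1 / (5 * rn)\<close> comes from \<open>bd_le_side\<close>.\<close>

definition a0 :: real where "a0 = min (ck / 2) (1 / (5 * rn))"

lemma K0_pos: "0 < K0" and a0_pos: "0 < a0" using rn_pos ck by (auto simp: K0_def a0_def)

text \<open>Cubes that are seen from \<open>x\<close> at scale \<open>u\<close>: scales beyond \<open>D\<close> are not distinguished, since all
  cubes of the decomposition are small compared with them.\<close>

definition located :: "real^'n \<Rightarrow> real \<Rightarrow> (real^'n) set \<Rightarrow> bool" where
  "located x u S \<longleftrightarrow> S \<in> E \<and> infdist x S \<le> K0 * u \<and> side S \<le> K0 * u \<and> a0 * min u D \<le> side S"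

text \<open>Beyond \<open>D\<close> the bound by the diameter takes over. This converts estimates at
  the scale \<open>w\<close> into estimates at the capped scale.\<close>

lemma min_scale_le:
  assumes "v \<le> A * w" "v \<le> diameter \<Omega>" "0 < w"
  shows "v \<le> max A (diameter \<Omega> / D) * min w D"
proof (cases "w \<le> D")
  case True
  have "A * w \<le> max A (diameter \<Omega> / D) * w" using assms by (intro mult_right_mono) auto
  then have "v \<le> max A (diameter \<Omega> / D) * w" using assms(1) by linarith
  then show ?thesis using True by (simp only: min.absorb1)
next
  case False
  have "diameter \<Omega> = diameter \<Omega> / D * D" using D_pos by simp
  also have "\<dots> \<le> max A (diameter \<Omega> / D) * D" using D_pos by (intro mult_right_mono) auto
  finally have "v \<le> max A (diameter \<Omega> / D) * D" using assms(2) by linarith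
  then show ?thesis using False by (simp only: min.absorb2 linear not_le less_imp_le)
qed

text \<open>The Jones condition in the form used by the extension. The ratio of the sides is that of
  the scales up to constants, and the distance of the cubes is at most a multiple of the sum of
  their sides, so the second term of \<open>log_dist\<close> is bounded.\<close>

lemma located_wd:
  obtains C where "0 \<le> C" "\<And>x u x' u' S S'. located x u S \<Longrightarrow> located x' u' S' \<Longrightarrow> 0 < u \<Longrightarrow> 0 < u' \<Longrightarrow>
    dist x x' \<le> K0 * max u u' \<Longrightarrow> real (wd S S') \<le> C * (1 + \<bar>log 2 (u / u')\<bar>)"
proof -
  define K where "K = max (3 * K0) (diameter \<Omega> / D)"
  have K: "0 < K" using K0_pos by (simp add: K_def)
  have Ka: "0 < K / a0" using K a0_pos by simp
  define C where "C = \<kappa> * (1 + \<bar>log 2 (K / a0)\<bar> + log 2 (2 + K / a0))"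
  have lg2: "0 \<le> log 2 (2 + K / a0)" using Ka by (simp add: zero_le_log_cancel_iff)
  have C: "0 \<le> C" using kappa lg2 by (simp add: C_def)
  have le: "side S / side S' \<le> K / a0 * 2 powr L"
    if "located x u S" "located x' u' S'" "0 < u" "0 < u'" "u \<le> 2 powr L * u'" "0 \<le> L"
    for x x' S S' and u u' L :: real
  proof -
    have S: "S \<in> E" "S' \<in> E" using that by (auto simp: located_def)
    have L1: "1 \<le> 2 powr L" using that(6) by (simp add: ge_one_powr_ge_zero)
    have "side S \<le> K0 * u" using that by (simp add: located_def)
    also have "\<dots> \<le> 3 * K0 * u" using that K0_pos by simp
    finally have "side S \<le> K * min u D"
      unfolding K_def by (rule min_scale_le) (use side_le_diameter S that in auto)
    also have "min u D \<le> 2 powr L * min u' D"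
    proof (cases "u' \<le> D")
      case True then show ?thesis using that by (auto simp: min_le_iff_disj)
    next
      case False
      have "1 * D \<le> 2 powr L * D" using D_pos L1 by (intro mult_right_mono) auto
      then show ?thesis using False by (simp add: min_le_iff_disj)
    qed
    also have "min u' D \<le> side S' / a0" using that a0_pos by (simp add: located_def field_simps)
    finally have "side S \<le> K * (2 powr L * (side S' / a0))" using K by simp
    then show ?thesis using side_pos[OF S(2)] by (simp add: field_simps)
  qed
  have "real (wd S S') \<le> C * (1 + \<bar>log 2 (u / u')\<bar>)"
    if l: "located x u S" "located x' u' S'" and u: "0 < u" "0 < u'" and d: "dist x x' \<le> K0 * max u u'"
    for x u x' u' S S'
  proof -
    define L where "L = \<bar>log 2 (u / u')\<bar>"
    have S: "S \<in> E" "S' \<in> E" using l by (auto simp: located_def)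
    note p = side_pos[OF S(1)] side_pos[OF S(2)]
    have "log 2 (u / u') \<le> L" by (simp add: L_def)
    then have u1: "u \<le> 2 powr L * u'" using u by (subst (asm) log_le_iff) (auto simp: field_simps)
    have "log 2 (u' / u) \<le> L" using u by (simp add: L_def log_divide)
    then have u2: "u' \<le> 2 powr L * u" using u by (subst (asm) log_le_iff) (auto simp: field_simps)
    have L0: "0 \<le> L" by (simp add: L_def)
    have r1: "log 2 (side S / side S') \<le> log 2 (K / a0) + L"
    proof -
      have "log 2 (side S / side S') \<le> log 2 (K / a0 * 2 powr L)"
        using le[OF l(1) l(2) u u1 L0] p K a0_pos by (subst log_le_cancel_iff) auto
      then show ?thesis using Ka by (subst (asm) log_mult_pos) auto
    qed
    have r2: "- log 2 (side S / side S') \<le> log 2 (K / a0) + L"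
    proof -
      have "log 2 (side S' / side S) \<le> log 2 (K / a0 * 2 powr L)"
        using le[OF l(2) l(1) u(2,1) u2 L0] p K a0_pos by (subst log_le_cancel_iff) auto
      then show ?thesis using Ka p by (subst (asm) log_mult_pos) (auto simp: log_divide)
    qed
    have sd: "setdist S S' \<le> K / a0 * (side S + side S')"
    proof -
      obtain y where y: "y \<in> S" "infdist x S = dist x y"
        using infdist_attains_inf[OF compact_imp_closed[OF E_compact[OF S(1)]] E_nonempty[OF S(1)]] by metis
      obtain y' where y': "y' \<in> S'" "infdist x' S' = dist x' y'"
        using infdist_attains_inf[OF compact_imp_closed[OF E_compact[OF S(2)]] E_nonempty[OF S(2)]] by metis
      have m: "K0 * u \<le> K0 * max u u'" "K0 * u' \<le> K0 * max u u'"
        using K0_pos by (auto intro!: mult_left_mono)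
      have "setdist S S' \<le> dist y y'" using setdist_le_dist y y' by blast
      also have "\<dots> \<le> dist x y + dist x x' + dist x' y'"
        using dist_triangle[of y y' x] dist_triangle[of x y' x'] by (simp add: dist_commute)
      also have "\<dots> \<le> 3 * K0 * max u u'" using m y y' d l by (simp add: located_def)
      finally have "setdist S S' \<le> K * min (max u u') D"
        unfolding K_def by (rule min_scale_le) (use setdist_le_diameter[OF S] u in auto)
      \<comment> \<open>The larger of the two scales belongs to one of the two cubes, whose side
        controls it.\<close>
      also have "min (max u u') D \<le> min u D + min u' D" using u D_pos by (auto simp: min_def max_def)
      also have "\<dots> \<le> side S / a0 + side S' / a0"
        using l a0_pos by (intro add_mono) (auto simp: located_def field_simps)
      finally have "setdist S S' \<le> K * (side S / a0 + side S' / a0)" using K by simp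
      also have "\<dots> = K / a0 * (side S + side S')" by (simp add: distrib_left add_divide_distrib)
      finally show ?thesis .
    qed
    have "log 2 (2 + setdist S S' / (side S + side S')) \<le> log 2 (2 + K / a0)"
      using sd p Ka by (subst log_le_cancel_iff) (auto simp: divide_le_eq add_pos_nonneg)
    then have "log_dist S S' \<le> \<bar>log 2 (K / a0)\<bar> + L + log 2 (2 + K / a0)"
      using r1 r2 unfolding log_dist_def by linarith
    also have "\<dots> \<le> (1 + \<bar>log 2 (K / a0)\<bar> + log 2 (2 + K / a0)) * (1 + L)"
      using L0 lg2 by (simp add: algebra_simps)
    finally have "\<kappa> * log_dist S S' \<le> C * (1 + L)"
      using kappa unfolding C_def by (simp only: mult.assoc mult_le_cancel_left_pos)
    then show ?thesis using jones[OF S] unfolding L_def by linarith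
  qed
  then show ?thesis using that C by blast
qed

lemma located_inside:
  assumes "S \<in> E" "x \<in> S" shows "located x (fr x) S"
proof -
  have x: "x \<in> \<Omega>" using E_subset assms by blast
  have b: "0 < bd x" by (rule bd_pos[OF x])
  have "1 * bd x \<le> K0 * bd x" using b rn_ge_1 by (intro mult_right_mono) (auto simp: K0_def)
  then have "side S \<le> K0 * bd x" using side_le_bd[OF assms] by linarith
  moreover have "a0 * min (bd x) D \<le> (1 / (5 * rn)) * bd x"
    using b D_pos rn_pos a0_pos by (intro mult_mono) (auto simp: a0_def)
  moreover have "(1 / (5 * rn)) * bd x \<le> side S" using bd_le_side[OF assms] rn_pos by (simp add: field_simps)
  ultimately show ?thesis
    using assms b K0_pos unfolding located_def fr_inside[OF x] by (intro conjI) auto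
qed

text \<open>A frontier point within \<open>5 * rn * t\<close> of \<open>p\<close> carries a
  corkscrew cube in the ball of radius \<open>min t D\<close>. It provides the reference value on a
  cube of side \<open>t\<close> near the frontier.\<close>

lemma located_corkscrew:
  assumes t: "0 < t" and p: "fr p \<le> 4 * rn * t"
  obtains S where "located p t S" "side S \<le> t"
proof -
  have "fr p < 5 * rn * t" using p t rn_pos by (simp add: mult_less_cancel_right_pos order_le_less_trans)
  then obtain z where z: "z \<in> closure \<Omega>" "z \<notin> \<Omega>" "dist p z < 5 * rn * t" using frontier_near by blast
  define r where "r = min t D"
  have r: "0 < r" "r \<le> D" "r \<le> t" using t D_pos by (auto simp: r_def)
  obtain S where S: "S \<in> E" "S \<subseteq> cball z r" "ck * r \<le> side S" using corkscrew_ck[OF z(1,2) r(1,2)] by blast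
  obtain y where y: "y \<in> S" using E_nonempty[OF S(1)] by blast
  have yz: "dist z y \<le> r" using S(2) y by auto
  have s: "side S \<le> r" using side_le_bd[OF S(1) y] bd_le_dist[OF z(2), of y] yz by (simp add: dist_commute)
  have t1: "t \<le> rn * t" using mult_right_mono[OF rn_ge_1, of t] t by simp
  have "infdist p S \<le> dist p y" by (rule infdist_le[OF y])
  also have "\<dots> \<le> K0 * t" using dist_triangle[of p y z] z(3) yz r(3) t1 t unfolding K0_def by linarith
  finally have 1: "infdist p S \<le> K0 * t" .
  have 2: "side S \<le> K0 * t" using s r(3) t1 t unfolding K0_def by linarith
  have "a0 * min t D \<le> ck * r" using r(1) ck unfolding r_def[symmetric] by (intro mult_right_mono) (auto simp: a0_def)
  then have "located p t S" using 1 2 S by (simp add: located_def)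
  then show ?thesis using that s r by simp
qed

subsection \<open>The extension operator\<close>

text \<open>Positive exactly when \<open>S\<close> is at distance less than
  \<open>3 * infdist x \<Omega>\<close> from \<open>x\<close> and its side exceeds the threshold.
  Clipping a minimum of Lipschitz functions makes the weight Lipschitz in \<open>x\<close>.\<close>

definition ext_wt :: "real^'n \<Rightarrow> (real^'n) set \<Rightarrow> real" where
  "ext_wt x S = max 0 (min (3 * infdist x \<Omega> - infdist x S) (side S - ck / 2 * min (infdist x \<Omega>) D))"

definition active :: "real^'n \<Rightarrow> (real^'n) set set" where
  "active x = {S \<in> E. 0 < ext_wt x S}"

text \<open>The value on the frontier, a null set, is chosen so that \<open>ext\<close> commutes exactly with adding constants.\<close>

definition ext :: "(real^'n \<Rightarrow> real) \<Rightarrow> real^'n \<Rightarrow> real" where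
  "ext f x = (if x \<in> \<Omega> then f x else if x \<in> closure \<Omega> then mean S0 f
     else (\<Sum>S\<in>active x. ext_wt x S * mean S f) / (\<Sum>S\<in>active x. ext_wt x S))"

lemma ext_wt_nonneg: "0 \<le> ext_wt x S" by (simp add: ext_wt_def)

lemma ext_wt_lipschitz: "\<bar>ext_wt x S - ext_wt y S\<bar> \<le> 4 * dist x y"
proof -
  have 1: "\<bar>infdist x \<Omega> - infdist y \<Omega>\<bar> \<le> dist x y" "\<bar>infdist x S - infdist y S\<bar> \<le> dist x y"
    by (rule infdist_triangle_abs)+
  have "\<bar>min (infdist x \<Omega>) D - min (infdist y \<Omega>) D\<bar> \<le> dist x y" using 1(1) by (auto simp: min_def)
  then have "ck / 2 * \<bar>min (infdist x \<Omega>) D - min (infdist y \<Omega>) D\<bar> \<le> 1 * dist x y"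
    using ck by (intro mult_mono) auto
  then have 2: "\<bar>ck / 2 * min (infdist x \<Omega>) D - ck / 2 * min (infdist y \<Omega>) D\<bar> \<le> dist x y"
    using ck(1) unfolding right_diff_distrib[symmetric] abs_mult by simp
  have clip: "\<bar>max 0 (min a b) - max 0 (min a' b')\<bar> \<le> e" if "\<bar>a - a'\<bar> \<le> e" "\<bar>b - b'\<bar> \<le> e" for a b a' b' e :: real
    using that by (auto simp: min_def max_def)
  have "\<bar>(3 * infdist x \<Omega> - infdist x S) - (3 * infdist y \<Omega> - infdist y S)\<bar> \<le> 4 * dist x y"
    using 1 by (simp add: abs_le_iff)
  moreover have "\<bar>(side S - ck / 2 * min (infdist x \<Omega>) D) - (side S - ck / 2 * min (infdist y \<Omega>) D)\<bar> \<le> 4 * dist x y"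
    using 2 zero_le_dist[of x y] unfolding abs_le_iff by (intro conjI; linarith)
  ultimately show ?thesis unfolding ext_wt_def by (rule clip)
qed

lemma outside_pos: "x \<notin> closure \<Omega> \<Longrightarrow> 0 < infdist x \<Omega>"
  using in_closure_iff_infdist_zero[OF ne, of x] infdist_nonneg[of x \<Omega>] by force

lemma active_located:
  assumes "x \<notin> closure \<Omega>" "S \<in> active x"
  shows "located x (infdist x \<Omega>) S" "side S \<le> 3 * infdist x \<Omega>" "infdist x S < 3 * infdist x \<Omega>"
    "ck / 2 * min (infdist x \<Omega>) D < side S"
proof -
  let ?d = "infdist x \<Omega>"
  have d: "0 < ?d" by (rule outside_pos[OF assms(1)])
  have S: "S \<in> E" "0 < 3 * ?d - infdist x S" "0 < side S - ck / 2 * min ?d D"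
    using assms(2) by (auto simp: active_def ext_wt_def)
  show 3: "infdist x S < 3 * ?d" "ck / 2 * min ?d D < side S" using S by auto
  have xO: "x \<notin> \<Omega>" using assms(1) closure_subset by blast
  \<comment> \<open>As \<open>x\<close> lies outside the domain, a Whitney cube is at least its own
    side away from it.\<close>
  have "side S \<le> infdist x S" unfolding infdist_notempty[OF E_nonempty[OF S(1)]]
  proof (rule cINF_greatest[OF E_nonempty[OF S(1)]])
    fix y assume "y \<in> S"
    then show "side S \<le> dist x y" using side_le_bd[OF S(1), of y] bd_le_dist[OF xO, of y] by (simp add: dist_commute)
  qed
  then show 2: "side S \<le> 3 * ?d" using 3 by simp
  have "3 * ?d \<le> K0 * ?d" using d rn_ge_1 by (intro mult_right_mono) (auto simp: K0_def)
  moreover have "a0 * min ?d D \<le> ck / 2 * min ?d D" using d D_pos by (intro mult_right_mono) (auto simp: a0_def)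
  ultimately show "located x ?d S" using 2 3 S(1) by (simp add: located_def)
qed

text \<open>A frontier point within \<open>5/4 * infdist x \<Omega>\<close> of \<open>x\<close>
  carries a corkscrew cube in a ball of radius at most \<open>infdist x \<Omega>\<close>. In the
  first entry of the weight at least \<open>3/4 * infdist x \<Omega>\<close> remains, in the second
  half of the corkscrew bound. The total weight is thus bounded below by the scale, as the Lipschitz
  bound for the quotient requires.\<close>

lemma active_weight:
  assumes "x \<notin> closure \<Omega>"
  obtains S where "S \<in> active x" "ck / 2 * min (infdist x \<Omega>) D \<le> ext_wt x S"
proof -
  let ?d = "infdist x \<Omega>"
  have d: "0 < ?d" by (rule outside_pos[OF assms(1)])
  have xO: "x \<notin> \<Omega>" using assms closure_subset by blast
  have "fr x < 5/4 * ?d" using d by (simp add: fr_outside[OF xO])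
  then obtain z where z: "z \<in> closure \<Omega>" "z \<notin> \<Omega>" "dist x z < 5/4 * ?d" using frontier_near by blast
  define r where "r = min ?d D"
  have r: "0 < r" "r \<le> D" "r \<le> ?d" using d D_pos by (auto simp: r_def)
  obtain S where S: "S \<in> E" "S \<subseteq> cball z r" "ck * r \<le> side S" using corkscrew_ck[OF z(1,2) r(1,2)] by blast
  obtain y where y: "y \<in> S" using E_nonempty[OF S(1)] by blast
  then have "infdist x S \<le> dist x z + r" using infdist_le[OF y, of x] S(2) dist_triangle[of x y z] by force
  then have 1: "3/4 * ?d \<le> 3 * ?d - infdist x S" using z(3) r(3) by linarith
  have "ck / 2 * r \<le> 1/2 * ?d" using r ck by (intro mult_mono) auto
  then have "ck / 2 * r \<le> 3 * ?d - infdist x S" using 1 d by linarith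
  moreover have "ck / 2 * r \<le> side S - ck / 2 * r" using S(3) by (simp add: field_simps)
  ultimately have w: "ck / 2 * r \<le> ext_wt x S" unfolding ext_wt_def r_def[symmetric] by linarith
  moreover have "0 < ck / 2 * r" using ck r by simp
  ultimately have "S \<in> active x" using S(1) by (simp add: active_def)
  then show ?thesis using that w by (simp add: r_def)
qed

text \<open>The entries are ratios of the side of a box containing the active cubes to their least
  side: a box about \<open>x\<close> if \<open>infdist x \<Omega> \<le> D\<close>, and otherwise a
  box about the whole domain.\<close>

definition NA :: real where "NA = max (24 * rn / ck) (4 * diameter \<Omega> / (ck * D)) ^ CARD('n)"

lemma NA_nonneg: "0 \<le> NA" using rn_pos ck(1) by (auto simp: NA_def intro!: zero_le_power max.coboundedI1)

lemma active_finite: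
  assumes "x \<notin> closure \<Omega>"
  shows "finite (active x)" "real (card (active x)) \<le> NA"
proof -
  let ?d = "infdist x \<Omega>"
  have d: "0 < ?d" by (rule outside_pos[OF assms(1)])
  let ?s = "ck / 2 * min ?d D"
  have s: "0 < ?s" using ck d D_pos by simp
  have E: "active x \<subseteq> E" by (auto simp: active_def)
  obtain a L where L: "0 \<le> L" "L / ?s \<le> max (24 * rn / ck) (4 * diameter \<Omega> / (ck * D))"
      "\<And>S. S \<in> active x \<Longrightarrow> S \<subseteq> cube a L"
  proof (cases "?d \<le> D")
    case True
    show ?thesis
    proof (rule that[of "12 * rn * ?d" "x - vec (6 * rn * ?d)"])
      show "12 * rn * ?d / ?s \<le> max (24 * rn / ck) (4 * diameter \<Omega> / (ck * D))"
        using True d ck by (intro max.coboundedI1) (simp add: field_simps)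
      fix S assume S: "S \<in> active x"
      have SE: "S \<in> E" using S E by blast
      obtain y where y: "y \<in> S" "infdist x S = dist x y"
        using infdist_attains_inf[OF compact_imp_closed[OF E_compact[OF SE]] E_nonempty[OF SE]] by metis
      have "S \<subseteq> cball x (6 * rn * ?d)"
      proof
        fix w assume "w \<in> S"
        then have "dist x w \<le> infdist x S + rn * side S"
          using E_dist[OF SE y(1)] y(2) dist_triangle[of x w y] by force
        also have "\<dots> \<le> 3 * ?d + rn * (3 * ?d)"
          using active_located(2,3)[OF assms S] rn_pos by (intro add_mono mult_left_mono) auto
        also have "\<dots> \<le> 6 * rn * ?d" using mult_right_mono[OF rn_ge_1, of ?d] d by simp
        finally show "w \<in> cball x (6 * rn * ?d)" by simp
      qed
      then show "S \<subseteq> cube (x - vec (6 * rn * ?d)) (12 * rn * ?d)"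
        using cball_subset_ccube[of x "6 * rn * ?d"] by (simp add: ccube_def mult.assoc)
    qed (use d rn_pos in auto)
  next
    case False
    obtain w where w: "w \<in> \<Omega>" using ne by auto
    show ?thesis
    proof (rule that[of "2 * diameter \<Omega>" "w - vec (diameter \<Omega>)"])
      show "2 * diameter \<Omega> / ?s \<le> max (24 * rn / ck) (4 * diameter \<Omega> / (ck * D))"
        using False D_pos ck by (intro max.coboundedI2) (simp add: field_simps)
      fix S assume "S \<in> active x"
      then have "S \<subseteq> \<Omega>" using E E_subset by blast
      also have "\<Omega> \<subseteq> cball w (diameter \<Omega>)" using diameter_bounded_bound[OF bdd w] by auto
      also have "\<dots> \<subseteq> ccube w (diameter \<Omega>)" by (rule cball_subset_ccube)
      finally show "S \<subseteq> cube (w - vec (diameter \<Omega>)) (2 * diameter \<Omega>)" by (simp add: ccube_def)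
    qed (use diameter_pos in auto)
  qed
  have pk: "finite (active x)" "real (card (active x)) \<le> (L / ?s) ^ CARD('n)"
    by (rule card_packing[OF E L(3) _ s L(1)]; use active_located(4)[OF assms] in force)+
  show "finite (active x)" by (rule pk)
  have "(L / ?s) ^ CARD('n) \<le> NA" unfolding NA_def using L(1,2) s by (intro power_mono) auto
  then show "real (card (active x)) \<le> NA" using pk(2) by linarith
qed

text \<open>Cubes of weight 0 may be added to the index set, so that the values at two points can be
  written as sums over the same set. A reference value \<open>m\<close> can be subtracted because
  the weights are normalised.\<close>

lemma ext_outside:
  assumes x: "x \<notin> closure \<Omega>" and U: "finite U" "active x \<subseteq> U" "U \<subseteq> E"
  shows "ck / 2 * min (infdist x \<Omega>) D \<le> (\<Sum>S\<in>U. ext_wt x S)" "0 < (\<Sum>S\<in>U. ext_wt x S)"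
    "ext f x - m = (\<Sum>S\<in>U. ext_wt x S * (mean S f - m)) / (\<Sum>S\<in>U. ext_wt x S)"
proof -
  have d: "0 < infdist x \<Omega>" by (rule outside_pos[OF x])
  have z: "ext_wt x S = 0" if "S \<in> U - active x" for S
    using that U(3) ext_wt_nonneg[of x S] by (auto simp: active_def not_less)
  obtain T where T: "T \<in> active x" "ck / 2 * min (infdist x \<Omega>) D \<le> ext_wt x T" using active_weight[OF x] .
  have "ext_wt x T \<le> (\<Sum>S\<in>U. ext_wt x S)"
    by (rule member_le_sum) (use T U ext_wt_nonneg in auto)
  then show 1: "ck / 2 * min (infdist x \<Omega>) D \<le> (\<Sum>S\<in>U. ext_wt x S)" using T by linarith
  have "0 < ck / 2 * min (infdist x \<Omega>) D" using ck d D_pos by simp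
  then show 2: "0 < (\<Sum>S\<in>U. ext_wt x S)" using 1 by linarith
  have e1: "(\<Sum>S\<in>active x. ext_wt x S * mean S f) = (\<Sum>S\<in>U. ext_wt x S * mean S f)"
    by (rule sum.mono_neutral_left) (use U z in auto)
  have e2: "(\<Sum>S\<in>active x. ext_wt x S) = (\<Sum>S\<in>U. ext_wt x S)"
    by (rule sum.mono_neutral_left) (use U z in auto)
  have "x \<notin> \<Omega>" using x closure_subset by blast
  then have "ext f x = (\<Sum>S\<in>U. ext_wt x S * mean S f) / (\<Sum>S\<in>U. ext_wt x S)"
    using x by (simp add: ext_def e1 e2)
  moreover have "(\<Sum>S\<in>U. ext_wt x S * (mean S f - m)) = (\<Sum>S\<in>U. ext_wt x S * mean S f) - m * (\<Sum>S\<in>U. ext_wt x S)"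
    unfolding right_diff_distrib sum_subtractf sum_distrib_left by (simp only: mult.commute[of m])
  ultimately show "ext f x - m = (\<Sum>S\<in>U. ext_wt x S * (mean S f - m)) / (\<Sum>S\<in>U. ext_wt x S)"
    using 2 by (simp add: diff_divide_distrib)
qed

lemma ext_close:
  assumes x: "x \<notin> closure \<Omega>" and b: "\<And>S. S \<in> active x \<Longrightarrow> \<bar>mean S f - m\<bar> \<le> b"
  shows "\<bar>ext f x - m\<bar> \<le> b"
proof -
  have AE: "active x \<subseteq> E" by (auto simp: active_def)
  note e = ext_outside[OF x active_finite(1)[OF x] subset_refl AE]
  have "\<bar>\<Sum>S\<in>active x. ext_wt x S * (mean S f - m)\<bar> \<le> (\<Sum>S\<in>active x. ext_wt x S * b)"
    using b ext_wt_nonneg by (intro order_trans[OF sum_abs] sum_mono) (simp add: abs_mult mult_left_mono)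
  also have "\<dots> = b * (\<Sum>S\<in>active x. ext_wt x S)" by (simp add: sum_distrib_left mult.commute)
  finally show ?thesis using e(2) unfolding e(3) by (simp add: abs_divide divide_le_eq)
qed

text \<open>With numerator \<open>?P\<close> and total weight \<open>?W\<close>, the difference of
  the values times \<open>?W x\<close> is
  \<open>(?P x - ?P y) + (ext f y - m) * (?W y - ?W x)\<close>. Both terms are Lipschitz with at
  most \<open>2 * NA\<close> summands; division by the lower bound for \<open>?W x\<close> makes the
  estimate relative to the scale.\<close>

lemma ext_lipschitz:
  assumes x: "x \<notin> closure \<Omega>" and y: "y \<notin> closure \<Omega>" 
    and b: "\<And>S. S \<in> active x \<union> active y \<Longrightarrow> \<bar>mean S f - m\<bar> \<le> b" and b0: "0 \<le> b"
  shows "\<bar>ext f x - ext f y\<bar> \<le> 32 * NA / ck * b * (dist x y / min (infdist x \<Omega>) D)"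
proof -
  define U where "U = active x \<union> active y"
  have U: "finite U" "active x \<subseteq> U" "active y \<subseteq> U" "U \<subseteq> E"
    using active_finite(1)[OF x] active_finite(1)[OF y] by (auto simp: U_def active_def)
  have cU: "real (card U) \<le> 2 * NA"
    using card_Un_le[of "active x" "active y"] active_finite(2)[OF x] active_finite(2)[OF y]
    unfolding U_def by linarith
  note ex = ext_outside[OF x U(1,2,4)]
  note ey = ext_outside[OF y U(1,3,4)]
  let ?W = "\<lambda>x. \<Sum>S\<in>U. ext_wt x S"
  let ?P = "\<lambda>x. \<Sum>S\<in>U. ext_wt x S * (mean S f - m)"
  let ?d = "dist x y"
  have dW: "\<bar>?W y - ?W x\<bar> \<le> 8 * NA * ?d"
  proof -
    have "\<bar>?W y - ?W x\<bar> \<le> (\<Sum>S\<in>U. \<bar>ext_wt y S - ext_wt x S\<bar>)"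
      by (simp add: sum_subtractf[symmetric] sum_abs)
    also have "\<dots> \<le> (\<Sum>S\<in>U. 4 * ?d)"
      using ext_wt_lipschitz[of y _ x] by (intro sum_mono) (simp add: dist_commute)
    also have "\<dots> = real (card U) * (4 * ?d)" by simp
    also have "\<dots> \<le> 2 * NA * (4 * ?d)" using cU by (intro mult_right_mono) auto
    finally show ?thesis by simp
  qed
  have dP: "\<bar>?P x - ?P y\<bar> \<le> 8 * NA * ?d * b"
  proof -
    have "\<bar>?P x - ?P y\<bar> \<le> (\<Sum>S\<in>U. \<bar>ext_wt x S - ext_wt y S\<bar> * \<bar>mean S f - m\<bar>)"
      by (simp add: sum_subtractf[symmetric] left_diff_distrib[symmetric] abs_mult[symmetric] sum_abs)
    also have "\<dots> \<le> (\<Sum>S\<in>U. 4 * ?d * b)"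
      using ext_wt_lipschitz[of x _ y] b by (intro sum_mono mult_mono) (auto simp: U_def)
    also have "\<dots> = real (card U) * (4 * ?d * b)" by simp
    also have "\<dots> \<le> 2 * NA * (4 * ?d * b)" using cU b0 by (intro mult_right_mono) auto
    finally show ?thesis by simp
  qed
  have yb: "\<bar>ext f y - m\<bar> \<le> b" by (rule ext_close[OF y]) (use b in auto)
  have Wx: "0 < ?W x" by (rule ex(2))
  have "ext f y - m = ?P y / ?W y" by (rule ey(3))
  then have Py: "?P y = (ext f y - m) * ?W y" using ey(2) by simp
  have Px: "?P x = (ext f x - m) * ?W x" using ex(3)[of f m] Wx by simp
  have eq: "(ext f x - ext f y) * ?W x = (?P x - ?P y) + (ext f y - m) * (?W y - ?W x)"
    unfolding Px Py by (simp add: algebra_simps)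
  have "\<bar>ext f x - ext f y\<bar> * ?W x = \<bar>(ext f x - ext f y) * ?W x\<bar>" using Wx by (simp add: abs_mult)
  also have "\<dots> \<le> \<bar>?P x - ?P y\<bar> + \<bar>(ext f y - m) * (?W y - ?W x)\<bar>"
    unfolding eq by (rule abs_triangle_ineq)
  also have "\<bar>(ext f y - m) * (?W y - ?W x)\<bar> = \<bar>ext f y - m\<bar> * \<bar>?W y - ?W x\<bar>" by (rule abs_mult)
  also have "\<bar>?P x - ?P y\<bar> + \<bar>ext f y - m\<bar> * \<bar>?W y - ?W x\<bar> \<le> 8 * NA * ?d * b + b * (8 * NA * ?d)"
    using dP dW yb b0 by (intro add_mono mult_mono) auto
  finally have "\<bar>ext f x - ext f y\<bar> * ?W x \<le> 16 * NA * ?d * b" by (simp add: mult_ac)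
  moreover have "\<bar>ext f x - ext f y\<bar> * (ck / 2 * min (infdist x \<Omega>) D) \<le> \<bar>ext f x - ext f y\<bar> * ?W x"
    using ex(1) by (intro mult_left_mono) auto
  ultimately have "\<bar>ext f x - ext f y\<bar> * (ck / 2 * min (infdist x \<Omega>) D) \<le> 16 * NA * ?d * b" by linarith
  moreover have "0 < min (infdist x \<Omega>) D" using outside_pos[OF x] D_pos by simp
  ultimately show ?thesis using ck(1) by (simp add: field_simps)
qed

end

subsection \<open>Oscillation of the extension\<close>

lemma abs_integrable_indicator_measurable:
  fixes f :: "real^'n \<Rightarrow> real"
  assumes "f absolutely_integrable_on S" "S \<in> sets lebesgue"
  shows "(\<lambda>x. ennreal \<bar>f x - c\<bar> * indicator S x) \<in> borel_measurable lebesgue"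
proof -
  have [measurable]: "(\<lambda>x. indicator S x *\<^sub>R f x) \<in> borel_measurable lebesgue" "S \<in> sets lebesgue"
    using assms unfolding set_integrable_def by auto
  have "(\<lambda>x. ennreal \<bar>indicator S x *\<^sub>R f x - c\<bar> * indicator S x) \<in> borel_measurable lebesgue" by measurable
  also have "(\<lambda>x. ennreal \<bar>indicator S x *\<^sub>R f x - c\<bar> * indicator S x) = (\<lambda>x. ennreal \<bar>f x - c\<bar> * indicator S x)"
    by (auto simp: fun_eq_iff indicator_def)
  finally show ?thesis .
qed

lemma nn_integral_cube_osc:
  fixes f :: "real^'n \<Rightarrow> real"
  assumes "0 < l" "f absolutely_integrable_on cube a l"
  shows "(\<integral>\<^sup>+x. ennreal \<bar>f x - mean (cube a l) f\<bar> * indicator (cube a l) x \<partial>lebesgue) =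
    ennreal (mean_osc (cube a l) f * measure lebesgue (cube a l))"
proof -
  let ?g = "\<lambda>x. \<bar>f x - mean (cube a l) f\<bar>"
  have i: "integrable lebesgue (\<lambda>x. indicator (cube a l) x *\<^sub>R ?g x)"
    using abs_integrable_diff_const[OF assms(2)] by (simp add: set_integrable_def)
  have "(\<integral>\<^sup>+x. ennreal (?g x) * indicator (cube a l) x \<partial>lebesgue) =
      (\<integral>\<^sup>+x. ennreal (indicator (cube a l) x *\<^sub>R ?g x) \<partial>lebesgue)"
    by (intro nn_integral_cong) (auto simp: indicator_def)
  also have "\<dots> = ennreal (LINT x:cube a l|lebesgue. ?g x)"
    unfolding set_lebesgue_integral_def by (rule nn_integral_eq_integral[OF i]) simp
  also have "(LINT x:cube a l|lebesgue. ?g x) = mean_osc (cube a l) f * measure lebesgue (cube a l)"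
    unfolding mean_osc_def mean_def[of _ ?g] using measure_cube_pos[OF assms(1), of a] by simp
  finally show ?thesis .
qed

lemma abs_integrable_of_nn_integral:
  fixes g :: "real^'n \<Rightarrow> real"
  assumes "g \<in> borel_measurable lebesgue"
    "(\<integral>\<^sup>+x. ennreal \<bar>g x - m\<bar> * indicator (cube a l) x \<partial>lebesgue) < \<infinity>"
  shows "g absolutely_integrable_on cube a l"
proof -
  have [measurable]: "g \<in> borel_measurable lebesgue" by fact
  have [measurable]: "cube a l \<in> sets lebesgue" using lmeasurable_cube by (rule fmeasurableD)
  have "(\<integral>\<^sup>+x. ennreal (norm (indicator (cube a l) x *\<^sub>R (g x - m))) \<partial>lebesgue) =
     (\<integral>\<^sup>+x. ennreal \<bar>g x - m\<bar> * indicator (cube a l) x \<partial>lebesgue)"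
    by (intro nn_integral_cong) (auto simp: indicator_def)
  then have "integrable lebesgue (\<lambda>x. indicator (cube a l) x *\<^sub>R (g x - m))"
    using assms(2) by (intro integrableI_bounded) auto
  then have "(\<lambda>x. g x - m) absolutely_integrable_on cube a l" by (simp add: set_integrable_def)
  then have "(\<lambda>x. (g x - m) + m) absolutely_integrable_on cube a l" by (intro set_integral_add) auto
  then show ?thesis by simp
qed

lemma mean_osc_of_nn_integral:
  fixes g :: "real^'n \<Rightarrow> real"
  assumes "0 < l" "g absolutely_integrable_on cube a l" "0 \<le> M"
    "(\<integral>\<^sup>+x. ennreal \<bar>g x - m\<bar> * indicator (cube a l) x \<partial>lebesgue) \<le> ennreal (M * measure lebesgue (cube a l))"
  shows "mean_osc (cube a l) g \<le> 2 * M"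
proof -
  have "mean (cube a l) (\<lambda>x. \<bar>g x - m\<bar>) \<le> M"
    by (rule mean_le_nn_integral) (use assms in auto)
  then show ?thesis using mean_osc_le[OF assms(1,2), of m] by linarith
qed

lemma nn_integral_bounded_cube:
  fixes g :: "real^'n \<Rightarrow> real"
  assumes "\<And>x. x \<in> cube a l \<Longrightarrow> \<bar>g x\<bar> \<le> M" "0 \<le> M"
  shows "(\<integral>\<^sup>+x. ennreal \<bar>g x\<bar> * indicator (cube a l) x \<partial>lebesgue) \<le> ennreal (M * measure lebesgue (cube a l))"
proof -
  have "(\<integral>\<^sup>+x. ennreal \<bar>g x\<bar> * indicator (cube a l) x \<partial>lebesgue) \<le> (\<integral>\<^sup>+x. ennreal M * indicator (cube a l) x \<partial>lebesgue)"
    using assms by (intro nn_integral_mono) (auto simp: indicator_def ennreal_leI)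
  also have "\<dots> = ennreal M * emeasure lebesgue (cube a l)"
    using lmeasurable_cube[of a l] by (intro nn_integral_cmult_indicator) (rule fmeasurableD)
  also have "\<dots> = ennreal (M * measure lebesgue (cube a l))"
    using lmeasurable_cube[of a l] assms(2) by (simp add: emeasure_eq_measure2 ennreal_mult)
  finally show ?thesis .
qed

context whitney
begin

text \<open>\<open>v\<close> is the sum of \<open>|f - mean S f|\<close>, restricted to
  \<open>S\<close>, over the cubes of \<open>E'\<close>. Faces belong to several cubes, hence a
  domination instead of an equality; the bound for the integral only uses disjoint
  interiors.\<close>

lemma osc_dominated:
  assumes f: "f locally_integrable_on \<Omega>" and E': "E' \<subseteq> E" "\<Union>E' \<subseteq> Q'" "Q' \<in> lmeasurable"
    and B: "0 \<le> B" "\<And>S. S \<in> E' \<Longrightarrow> mean_osc S f \<le> B"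
  obtains v :: "real^'n \<Rightarrow> ennreal" where "v \<in> borel_measurable lebesgue"
    "\<And>S x. S \<in> E' \<Longrightarrow> x \<in> S \<Longrightarrow> ennreal \<bar>f x - mean S f\<bar> \<le> v x"
    "(\<integral>\<^sup>+x. v x \<partial>lebesgue) \<le> ennreal (B * measure lebesgue Q')"
proof -
  define e where "e = from_nat_into E"
  define I where "I = to_nat_on E ` E'"
  have eI: "e (to_nat_on E S) = S" if "S \<in> E'" for S
    using that E' E_countable by (auto simp: e_def)
  have injI: "inj_on e I" by (rule inj_onI) (auto simp: I_def eI)
  have eE: "e k \<in> E'" if "k \<in> I" for k using that eI by (auto simp: I_def)
  define w where "w k x = (if k \<in> I then ennreal \<bar>f x - mean (e k) f\<bar> * indicator (e k) x else 0)" for k x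
  have wm [measurable]: "w k \<in> borel_measurable lebesgue" for k
  proof (cases "k \<in> I")
    case True
    then have S: "e k \<in> E" using eE E' by blast
    have "f absolutely_integrable_on e k"
      using f E_compact[OF S] E_subset[OF S] by (simp add: locally_integrable_on_def)
    then have "(\<lambda>x. ennreal \<bar>f x - mean (e k) f\<bar> * indicator (e k) x) \<in> borel_measurable lebesgue"
      by (rule abs_integrable_indicator_measurable) (use E_lmeasurable[OF S] in \<open>rule fmeasurableD\<close>)
    then show ?thesis using True by (simp add: w_def[abs_def])
  qed (simp add: w_def[abs_def])
  have wi: "(\<integral>\<^sup>+x. w k x \<partial>lebesgue) \<le> (if k \<in> I then ennreal (B * measure lebesgue (e k)) else 0)" for k
  proof (cases "k \<in> I")
    case True
    then have S: "e k \<in> E" "e k \<in> E'" using eE E' by auto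
    obtain a l where al: "0 < l" "e k = cube a l" using S(1) by (rule E_cubeE)
    have i: "f absolutely_integrable_on cube a l"
      using locally_integrable_cube[OF f, of a l] E_subset[OF S(1)] al by simp
    have "(\<integral>\<^sup>+x. w k x \<partial>lebesgue) = ennreal (mean_osc (e k) f * measure lebesgue (e k))"
      using nn_integral_cube_osc[OF al(1) i] True unfolding w_def[abs_def] al(2) by simp
    also have "\<dots> \<le> ennreal (B * measure lebesgue (e k))"
      using B(2)[OF S(2)] by (intro ennreal_leI mult_right_mono) auto
    finally show ?thesis using True by simp
  qed (simp add: w_def[abs_def])
  show ?thesis
  proof (rule that[of "\<lambda>x. \<Sum>k. w k x"])
    show "(\<lambda>x. \<Sum>k. w k x) \<in> borel_measurable lebesgue" by measurable
    fix S x assume S: "S \<in> E'" "x \<in> S"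
    let ?k = "to_nat_on E S"
    have "ennreal \<bar>f x - mean S f\<bar> = w ?k x" using S eI[OF S(1)] by (simp add: w_def I_def)
    also have "\<dots> = sum (\<lambda>k. w k x) {?k}" by simp
    also have "\<dots> \<le> (\<Sum>k. w k x)" by (rule sum_le_suminf[OF summableI]) auto
    finally show "ennreal \<bar>f x - mean S f\<bar> \<le> (\<Sum>k. w k x)" .
  next
    have "(\<integral>\<^sup>+x. (\<Sum>k. w k x) \<partial>lebesgue) = (\<Sum>k. \<integral>\<^sup>+x. w k x \<partial>lebesgue)"
      by (rule nn_integral_suminf) (rule wm)
    also have "\<dots> \<le> ennreal (B * measure lebesgue Q')"
      unfolding suminf_eq_SUP
    proof (rule SUP_least)
      fix n :: nat
      let ?J = "{..<n} \<inter> I"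
      have "(\<Sum>k<n. \<integral>\<^sup>+x. w k x \<partial>lebesgue) \<le> (\<Sum>k<n. if k \<in> I then ennreal (B * measure lebesgue (e k)) else 0)"
        by (rule sum_mono) (rule wi)
      also have "\<dots> = (\<Sum>k\<in>?J. ennreal (B * measure lebesgue (e k)))" by (simp add: sum.inter_restrict)
      also have "\<dots> = ennreal (\<Sum>k\<in>?J. B * measure lebesgue (e k))" using B(1) by (intro sum_ennreal) simp
      also have "(\<Sum>k\<in>?J. B * measure lebesgue (e k)) = B * (\<Sum>S\<in>e ` ?J. measure lebesgue S)"
        using injI by (simp add: sum_distrib_left sum.reindex inj_on_subset)
      also have "\<dots> \<le> B * measure lebesgue Q'"
        by (intro mult_left_mono sum_measure_le B(1)) (use eE E' in auto)
      finally show "(\<Sum>k<n. \<integral>\<^sup>+x. w k x \<partial>lebesgue) \<le> ennreal (B * measure lebesgue Q')" by (simp add: ennreal_leI)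
    qed
    finally show "(\<integral>\<^sup>+x. (\<Sum>k. w k x) \<partial>lebesgue) \<le> ennreal (B * measure lebesgue Q')" .
  qed
qed

end

section \<open>Cubes close to the frontier\<close>

context whitney_jones
begin

lemma cube_center: "cube (a :: real^'n) t \<subseteq> cball (a + vec (t/2)) (rn * (t/2))"
  using ccube_subset_cball[of "a + vec (t/2)" "t/2"] unfolding cube_eq_ccube rn_def .

text \<open>Stated as a property of the constants, for arbitrary \<open>B\<close>, because it is
  applied twice: with a multiple of the BMO bound, and with a small number in the VMO case. The
  number \<open>C1 * (i + 1)\<close> is the chain length that suffices in layer \<open>i\<close>;
  the quadratic growth leaves the room used in the VMO case.\<close>

definition near_const :: "real \<Rightarrow> nat \<Rightarrow> bool" where
  "near_const C C1 \<longleftrightarrow> 0 \<le> C \<and>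
    (\<forall>f B a t. f locally_integrable_on \<Omega> \<longrightarrow> 0 < t \<longrightarrow> fr (a + vec (t/2)) \<le> 4 * rn * t \<longrightarrow> 0 \<le> B \<longrightarrow>
      (\<forall>S\<in>E. side S \<le> 6 * rn * t \<longrightarrow> mean_osc S f \<le> B) \<longrightarrow>
      (\<forall>S\<in>E. \<forall>S'\<in>E. \<forall>i. side S' \<le> t \<longrightarrow> wd S S' \<le> C1 * (i + 1) \<longrightarrow>
         \<bar>mean S f - mean S' f\<bar> \<le> B * (real i + 1)\<^sup>2) \<longrightarrow>
      (\<exists>m. (\<integral>\<^sup>+x. ennreal \<bar>ext f x - m\<bar> * indicator (cube a t) x \<partial>lebesgue) \<le> ennreal (C * B * measure lebesgue (cube a t))))"

lemma near_constD:
  assumes "near_const C C1" "f locally_integrable_on \<Omega>" "0 < t" "fr (a + vec (t/2)) \<le> 4 * rn * t" "0 \<le> B"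
    "\<And>S. S \<in> E \<Longrightarrow> side S \<le> 6 * rn * t \<Longrightarrow> mean_osc S f \<le> B"
    "\<And>S S' i. S \<in> E \<Longrightarrow> S' \<in> E \<Longrightarrow> side S' \<le> t \<Longrightarrow> wd S S' \<le> C1 * (i + 1) \<Longrightarrow>
       \<bar>mean S f - mean S' f\<bar> \<le> B * (real i + 1)\<^sup>2"
  shows "\<exists>m. (\<integral>\<^sup>+x. ennreal \<bar>ext f x - m\<bar> * indicator (cube a t) x \<partial>lebesgue) \<le> ennreal (C * B * measure lebesgue (cube a t))"
  using assms(1)[unfolded near_const_def, THEN conjunct2, rule_format, OF assms(2-7)] .

lemma near_const_exists: "\<exists>C C1. near_const C C1"
proof -
  obtain c \<theta> q where c: "0 < c" "0 < \<theta>" "\<theta> \<le> 1" "0 \<le> q" "q < 1" and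
    layers: "\<And>a t i. 0 < t \<Longrightarrow> measure lebesgue {x \<in> cube a t. fr x < c * \<theta> ^ i * t} \<le> q ^ i * t ^ CARD('n)"
    using frontier_layers by blast
  obtain CW where CW: "0 \<le> CW" and wdb: "\<And>x u x' u' S S'. located x u S \<Longrightarrow> located x' u' S' \<Longrightarrow> 0 < u \<Longrightarrow> 0 < u' \<Longrightarrow>
    dist x x' \<le> K0 * max u u' \<Longrightarrow> real (wd S S') \<le> CW * (1 + \<bar>log 2 (u / u')\<bar>)"
    using located_wd by blast
  \<comment> \<open>Bounds \<open>|log 2 (fr x / t)|\<close> by \<open>M * (i + 1)\<close> down to
    layer \<open>i\<close>, from \<open>fr x \<le> 6 * rn * t\<close> and
    \<open>c * \<theta> ^ i * t \<le> fr x\<close>.\<close>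
  define M where "M = \<bar>log 2 (6 * rn)\<bar> + \<bar>log 2 c\<bar> + \<bar>log 2 \<theta>\<bar>"
  define C1 where "C1 = nat \<lceil>CW * (1 + M)\<rceil>"
  \<comment> \<open>The first term sums the chain estimates; the second is the relative volume of a
    box that contains all cubes of the decomposition meeting \<open>?Q\<close>.\<close>
  define C where "C = layer_const 1 q + (14 * rn) ^ CARD('n)"
  have C0: "0 \<le> C" using layer_const_ge_1[of q 1] c rn_pos by (simp add: C_def)
  have key: "\<exists>m. (\<integral>\<^sup>+x. ennreal \<bar>ext f x - m\<bar> * indicator (cube a t) x \<partial>lebesgue) \<le> ennreal (C * B * measure lebesgue (cube a t))"
    if f: "f locally_integrable_on \<Omega>" and t: "0 < t" and near: "fr (a + vec (t/2)) \<le> 4 * rn * t" and B: "0 \<le> B"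
      and H1: "\<And>S. S \<in> E \<Longrightarrow> side S \<le> 6 * rn * t \<Longrightarrow> mean_osc S f \<le> B"
      and H2: "\<And>S S' i. S \<in> E \<Longrightarrow> S' \<in> E \<Longrightarrow> side S' \<le> t \<Longrightarrow> wd S S' \<le> C1 * (i + 1) \<Longrightarrow>
         \<bar>mean S f - mean S' f\<bar> \<le> B * (real i + 1)\<^sup>2" for f B a t
  proof -
    define p where "p = a + vec (t/2)"
    let ?Q = "cube a t"
    obtain SQ where SQ: "located p t SQ" "side SQ \<le> t" using located_corkscrew[OF t near] unfolding p_def by blast
    have SQE: "SQ \<in> E" using SQ by (simp add: located_def)
    define m where "m = mean SQ f"
    have dQ: "dist p x \<le> rn * t / 2" if "x \<in> ?Q" for x using cube_center[of a t] that by (auto simp: p_def)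
    have rt: "t \<le> rn * t" using mult_right_mono[OF rn_ge_1, of t] t by simp
    have frQ: "fr x \<le> 6 * rn * t" if "x \<in> ?Q" for x
      using fr_lipschitz[of x p] dQ[OF that] near[folded p_def] rt t
      unfolding dist_commute[of x p] by linarith
    have close: "\<bar>mean S f - m\<bar> \<le> B * (real i + 1)\<^sup>2"
      if x: "x \<in> ?Q" "c * \<theta> ^ i * t \<le> fr x" and S: "located x (fr x) S" for x i S
    proof -
      have p0: "0 < c * \<theta> ^ i" using c by simp
      have f0: "0 < fr x" using x(2) p0 t by (meson mult_pos_pos order_less_le_trans)
      have "dist x p \<le> K0 * t" using dQ[OF x(1)] rt t unfolding K0_def dist_commute[of x p] by linarith
      also have "\<dots> \<le> K0 * max (fr x) t" using K0_pos by (intro mult_left_mono) auto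
      finally have w: "real (wd S SQ) \<le> CW * (1 + \<bar>log 2 (fr x / t)\<bar>)" by (rule wdb[OF S SQ(1) f0 t])
      have "log 2 (fr x / t) \<le> log 2 (6 * rn)"
        using frQ[OF x(1)] f0 t rn_pos by (subst log_le_cancel_iff) (auto simp: field_simps)
      moreover have "log 2 (c * \<theta> ^ i) \<le> log 2 (fr x / t)"
        using x(2) f0 t p0 by (subst log_le_cancel_iff) (auto simp: field_simps)
      moreover have "log 2 (c * \<theta> ^ i) = log 2 c + real i * log 2 \<theta>"
        using c by (simp add: log_mult_pos log_nat_power)
      moreover have "real i * log 2 \<theta> \<ge> - (real i * \<bar>log 2 \<theta>\<bar>)"
        using mult_left_mono[of "- \<bar>log 2 \<theta>\<bar>" "log 2 \<theta>" "real i"] by simp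
      moreover have "0 \<le> real i * \<bar>log 2 \<theta>\<bar>" by simp
      ultimately have "\<bar>log 2 (fr x / t)\<bar> \<le> \<bar>log 2 (6 * rn)\<bar> + \<bar>log 2 c\<bar> + real i * \<bar>log 2 \<theta>\<bar>" by linarith
      also have "\<dots> \<le> M * (real i + 1)" by (simp add: M_def algebra_simps)
      finally have "1 + \<bar>log 2 (fr x / t)\<bar> \<le> (1 + M) * (real i + 1)" by (simp add: algebra_simps)
      then have "real (wd S SQ) \<le> CW * ((1 + M) * (real i + 1))"
        using w CW by (meson mult_left_mono order_trans)
      also have "\<dots> = CW * (1 + M) * (real i + 1)" by simp
      also have "\<dots> \<le> real C1 * (real i + 1)" unfolding C1_def by (intro mult_right_mono) linarith+
      also have "\<dots> = real (C1 * (i + 1))" by (simp add: algebra_simps)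
      finally have "wd S SQ \<le> C1 * (i + 1)" by (simp only: of_nat_le_iff)
      then show ?thesis using H2[OF _ SQE SQ(2)] S unfolding m_def located_def by blast
    qed
    define E' where "E' = {S \<in> E. S \<inter> ?Q \<noteq> {}}"
    have sE': "side S \<le> 6 * rn * t" if "S \<in> E'" for S
    proof -
      obtain y where y: "S \<in> E" "y \<in> S" "y \<in> ?Q" using \<open>S \<in> E'\<close> by (auto simp: E'_def)
      have "side S \<le> bd y" by (rule side_le_bd[OF y(1,2)])
      also have "\<dots> \<le> fr y" by (simp add: fr_def infdist_nonneg)
      finally show ?thesis using frQ[OF y(3)] by linarith
    qed
    have sub: "\<Union>E' \<subseteq> ccube p (7 * rn * t)"
    proof
      fix x assume "x \<in> \<Union>E'"
      then obtain S where S: "S \<in> E'" "x \<in> S" by blast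
      obtain y where y: "S \<in> E" "y \<in> S" "y \<in> ?Q" using S by (auto simp: E'_def)
      obtain b l where bl: "0 < l" "S = cube b l" "side S = l" using y(1) by (rule E_cubeE)
      show "x \<in> ccube p (7 * rn * t)" unfolding mem_ccube
      proof
        fix i
        have "\<bar>x$i - y$i\<bar> \<le> 6 * rn * t"
          using S(2) y(2) sE'[OF S(1)] unfolding bl(2) mem_cube bl(3)[unfolded bl(2)] by (smt (verit))
        moreover have "\<bar>y$i - p$i\<bar> \<le> t/2" using y(3) unfolding cube_eq_ccube mem_ccube p_def by blast
        ultimately show "\<bar>x$i - p$i\<bar> \<le> 7 * rn * t" using rt t by linarith
      qed
    qed
    have mQ: "measure lebesgue (ccube p (7 * rn * t)) = (14 * rn) ^ CARD('n) * measure lebesgue ?Q"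
      using t rn_pos by (simp add: ccube_def content_cube power_mult_distrib)
    obtain v where v: "v \<in> borel_measurable lebesgue"
      "\<And>S x. S \<in> E' \<Longrightarrow> x \<in> S \<Longrightarrow> ennreal \<bar>f x - mean S f\<bar> \<le> v x"
      "(\<integral>\<^sup>+x. v x \<partial>lebesgue) \<le> ennreal (B * measure lebesgue (ccube p (7 * rn * t)))"
    proof (rule osc_dominated[OF f _ sub _ B])
      show "ccube p (7 * rn * t) \<in> lmeasurable" by (simp add: ccube_def lmeasurable_cube)
      show "mean_osc S f \<le> B" if "S \<in> E'" for S using H1 sE' that by (simp add: E'_def)
    qed (auto simp: E'_def)
    have "(\<integral>\<^sup>+x. ennreal \<bar>ext f x - m\<bar> * indicator ?Q x \<partial>lebesgue) \<le>
        ennreal (layer_const 1 q * B * measure lebesgue ?Q) + (\<integral>\<^sup>+x. v x \<partial>lebesgue)"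
    proof (rule layer_nn_integral_add[where A = "\<lambda>i. {x \<in> ?Q. fr x < c * \<theta> ^ i * t}"])
      fix i
      have [measurable]: "fr \<in> borel_measurable borel" by (rule fr_measurable)
      show "{x \<in> ?Q. fr x < c * \<theta> ^ i * t} \<in> lmeasurable"
        by (rule fmeasurableI2[OF lmeasurable_cube[of a t]]) (auto intro!: sets_completionI_sets)
      show "measure lebesgue {x \<in> ?Q. fr x < c * \<theta> ^ i * t} \<le> 1 * q ^ i * measure lebesgue ?Q"
        using layers[OF t, of a i] t by (simp add: content_cube)
      fix x assume x: "x \<in> ?Q" "x \<notin> {x \<in> ?Q. fr x < c * \<theta> ^ i * t}"
      then have fx: "c * \<theta> ^ i * t \<le> fr x" by auto
      then have f0: "0 < fr x" using c t by (meson mult_pos_pos order_less_le_trans zero_less_power)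
      show "ennreal \<bar>ext f x - m\<bar> \<le> ennreal (B * (real i + 1)\<^sup>2) + v x"
      \<comment> \<open>Inside, the chain controls only the mean over the cube containing
        \<open>x\<close>, and the fluctuation of \<open>f\<close> on that cube goes into
        \<open>v\<close>. Outside, the extension is itself an average of means.\<close>
      proof (cases "x \<in> \<Omega>")
        case True
        then obtain S where S: "S \<in> E" "x \<in> S" using E_cover by blast
        have S': "S \<in> E'" using S x by (auto simp: E'_def)
        have "\<bar>ext f x - m\<bar> \<le> \<bar>mean S f - m\<bar> + \<bar>f x - mean S f\<bar>" using True by (simp add: ext_def)
        also have "\<dots> \<le> B * (real i + 1)\<^sup>2 + \<bar>f x - mean S f\<bar>"
          using close[OF x(1) fx located_inside[OF S]] by simp
        finally have "ennreal \<bar>ext f x - m\<bar> \<le> ennreal (B * (real i + 1)\<^sup>2 + \<bar>f x - mean S f\<bar>)"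
          by (rule ennreal_leI)
        also have "\<dots> = ennreal (B * (real i + 1)\<^sup>2) + ennreal \<bar>f x - mean S f\<bar>"
          using B by (intro ennreal_plus) auto
        finally have "ennreal \<bar>ext f x - m\<bar> \<le> ennreal (B * (real i + 1)\<^sup>2) + ennreal \<bar>f x - mean S f\<bar>" .
        then show ?thesis using v(2)[OF S' S(2)] by (meson add_left_mono order_trans)
      next
        case False
        have e: "fr x = infdist x \<Omega>" by (rule fr_outside[OF False])
        then have xc: "x \<notin> closure \<Omega>" using f0 in_closure_iff_infdist_zero[OF ne, of x] by auto
        have "\<bar>ext f x - m\<bar> \<le> B * (real i + 1)\<^sup>2"
          by (rule ext_close[OF xc]) (use close[OF x(1) fx] active_located(1)[OF xc] e in auto)
        then show ?thesis by (meson add_increasing2 ennreal_leI zero_le)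
      qed
    qed (use c B v(1) lmeasurable_cube in auto)
    also have "\<dots> \<le> ennreal (layer_const 1 q * B * measure lebesgue ?Q) + ennreal (B * measure lebesgue (ccube p (7 * rn * t)))"
      by (rule add_left_mono) (rule v(3))
    also have "\<dots> = ennreal (C * B * measure lebesgue ?Q)"
    proof -
      have "C * B * measure lebesgue ?Q = layer_const 1 q * B * measure lebesgue ?Q + B * measure lebesgue (ccube p (7 * rn * t))"
        unfolding mQ C_def by (simp only: distrib_right distrib_left mult_ac)
      moreover have "0 \<le> layer_const 1 q * B * measure lebesgue ?Q"
        using B layer_const_ge_1[of q 1] c by (intro mult_nonneg_nonneg) auto
      ultimately show ?thesis using B by (metis ennreal_plus measure_nonneg mult_nonneg_nonneg)
    qed
    finally show ?thesis by blast
  qed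
  have "near_const C C1" unfolding near_const_def
    by (intro conjI allI impI C0, rule key) blast+
  then show ?thesis by blast
qed

section \<open>Points off the closure of the domain\<close>

lemma active_near:
  assumes "x \<notin> closure \<Omega>" "dist x y \<le> infdist x \<Omega> / 2"
  shows "infdist x \<Omega> / 2 \<le> infdist y \<Omega>" "infdist y \<Omega> \<le> 3 / 2 * infdist x \<Omega>" "y \<notin> closure \<Omega>"
proof -
  have d: "0 < infdist x \<Omega>" by (rule outside_pos[OF assms(1)])
  show 1: "infdist x \<Omega> / 2 \<le> infdist y \<Omega>" "infdist y \<Omega> \<le> 3 / 2 * infdist x \<Omega>"
    using infdist_triangle[of x \<Omega> y] infdist_triangle[of y \<Omega> x] assms(2) by (auto simp: dist_commute)
  then show "y \<notin> closure \<Omega>" using d in_closure_iff_infdist_zero[OF ne, of y] by auto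
qed

text \<open>The two points have comparable distances from the domain, so the logarithm in
  \<open>located_wd\<close> is at most 1 in absolute value.\<close>

lemma active_wd:
  obtains CE :: nat where "\<And>x y S S'. x \<notin> closure \<Omega> \<Longrightarrow> dist x y \<le> infdist x \<Omega> / 2 \<Longrightarrow>
    S \<in> active x \<Longrightarrow> S' \<in> active y \<Longrightarrow> wd S S' \<le> CE"
proof -
  obtain CW where CW: "0 \<le> CW" and wdb: "\<And>x u x' u' S S'. located x u S \<Longrightarrow> located x' u' S' \<Longrightarrow> 0 < u \<Longrightarrow> 0 < u' \<Longrightarrow>
    dist x x' \<le> K0 * max u u' \<Longrightarrow> real (wd S S') \<le> CW * (1 + \<bar>log 2 (u / u')\<bar>)"
    using located_wd by blast
  have "wd S S' \<le> nat \<lceil>CW * 2\<rceil>"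
    if x: "x \<notin> closure \<Omega>" "dist x y \<le> infdist x \<Omega> / 2" and S: "S \<in> active x" "S' \<in> active y" for x y S S'
  proof -
    note n = active_near[OF x]
    have d: "0 < infdist x \<Omega>" "0 < infdist y \<Omega>" using outside_pos x(1) n(3) by auto
    have "dist x y \<le> 1 * infdist x \<Omega>" using x d by simp
    also have "\<dots> \<le> K0 * max (infdist x \<Omega>) (infdist y \<Omega>)"
      using rn_ge_1 d by (intro mult_mono) (auto simp: K0_def)
    finally have w: "real (wd S S') \<le> CW * (1 + \<bar>log 2 (infdist x \<Omega> / infdist y \<Omega>)\<bar>)"
      by (rule wdb[OF active_located(1)[OF x(1) S(1)] active_located(1)[OF n(3) S(2)] d])
    have "log 2 (infdist x \<Omega> / infdist y \<Omega>) \<le> log 2 2"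
      using n(1) d by (subst log_le_cancel_iff) (auto simp: field_simps)
    moreover have "log 2 (1/2) \<le> log 2 (infdist x \<Omega> / infdist y \<Omega>)"
      using n(2) d by (subst log_le_cancel_iff) (auto simp: field_simps)
    moreover have "log 2 (1/2::real) = -1" by (simp add: log_divide)
    ultimately have "\<bar>log 2 (infdist x \<Omega> / infdist y \<Omega>)\<bar> \<le> 1" by simp
    then have "CW * (1 + \<bar>log 2 (infdist x \<Omega> / infdist y \<Omega>)\<bar>) \<le> CW * 2" using CW by (intro mult_left_mono) auto
    then show ?thesis using w by linarith
  qed
  then show ?thesis using that by blast
qed

text \<open>The first bound is small when the active cubes are small. The second gains from the
  distance of the points and serves where the active cubes are not small. The factor
  \<open>s0\<close> makes \<open>s\<close> exceed the sides of all cubes on the chains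
  involved.\<close>

definition far_const :: "real \<Rightarrow> real \<Rightarrow> bool" where
  "far_const C s0 \<longleftrightarrow> 0 < C \<and> 0 < s0 \<and> (\<forall>f s B x y. osc_bd f s B \<longrightarrow> 0 \<le> B \<longrightarrow> x \<notin> closure \<Omega> \<longrightarrow>
    dist x y \<le> infdist x \<Omega> / 2 \<longrightarrow> s0 * infdist x \<Omega> \<le> s \<longrightarrow> \<bar>ext f y - ext f x\<bar> \<le> C * B \<and>
    \<bar>ext f y - ext f x\<bar> \<le> C * B * (dist x y / min (infdist x \<Omega>) D))"

lemma far_constD:
  assumes "far_const C s0" "osc_bd f s B" "0 \<le> B" "x \<notin> closure \<Omega>" "dist x y \<le> infdist x \<Omega> / 2"
    "s0 * infdist x \<Omega> \<le> s"
  shows "\<bar>ext f y - ext f x\<bar> \<le> C * B"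
    "\<bar>ext f y - ext f x\<bar> \<le> C * B * (dist x y / min (infdist x \<Omega>) D)"
  using assms unfolding far_const_def by blast+

lemma far_const_exists: "\<exists>C s0. far_const C s0"
proof -
  obtain CE :: nat where CE: "\<And>x y S S'. x \<notin> closure \<Omega> \<Longrightarrow> dist x y \<le> infdist x \<Omega> / 2 \<Longrightarrow>
    S \<in> active x \<Longrightarrow> S' \<in> active y \<Longrightarrow> wd S S' \<le> CE" using active_wd by blast
  define b where "b = real CE * CJ"
  have b0: "0 \<le> b" using CJ_pos by (simp add: b_def)
  define C where "C = 1 + 2 * b + 32 * NA / ck * b"
  have NAck: "0 \<le> 32 * NA / ck" using NA_nonneg ck(1) by simp
  have NAb: "0 \<le> 32 * NA / ck * b" by (intro mult_nonneg_nonneg NAck b0)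
  have C: "0 < C" using b0 NAb unfolding C_def by linarith
  have s0: "0 < 4 ^ (CE + 1) * (3::real)" by simp
  \<comment> \<open>Active cubes have side at most \<open>3 * infdist x \<Omega>\<close>; the power
    of 4 is the requirement of \<open>osc_chain\<close> for chains of length at most
    \<open>CE\<close>.\<close>
  have "far_const C (4 ^ (CE + 1) * 3)" unfolding far_const_def
  proof (intro conjI[OF C conjI[OF s0]] allI impI)
    fix f s B x y
    assume osc: "osc_bd f s B" "0 \<le> B" and x: "x \<notin> closure \<Omega>" "dist x y \<le> infdist x \<Omega> / 2"
      and s: "4 ^ (CE + 1) * 3 * infdist x \<Omega> \<le> s"
    have d: "0 < infdist x \<Omega>" by (rule outside_pos[OF x(1)])
    have y: "y \<notin> closure \<Omega>" by (rule active_near(3)[OF x])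
    obtain T where T: "T \<in> active x" using active_weight[OF x(1)] by blast
    have TE: "T \<in> E" using T by (simp add: active_def)
    have m: "\<bar>mean S f - mean T f\<bar> \<le> b * B" if "S \<in> active x \<union> active y" for S
    proof -
      have SE: "S \<in> E" using that by (auto simp: active_def)
      have w: "wd T S \<le> CE" using that CE[OF x T] CE[OF x(1) _ T, of x S] d by auto
      have "4 ^ (wd T S + 1) * side T \<le> 4 ^ (CE + 1) * (3 * infdist x \<Omega>)"
        using w active_located(2)[OF x(1) T] side_pos[OF TE] by (intro mult_mono power_increasing) auto
      then have "\<bar>mean T f - mean S f\<bar> \<le> real (wd T S) * (CJ * B)"
        using s by (intro osc_chain[OF osc TE SE]) (simp only: mult.assoc)
      also have "\<dots> \<le> real CE * (CJ * B)" using w osc CJ_pos by (intro mult_right_mono) auto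
      finally show ?thesis by (simp add: b_def abs_minus_commute)
    qed
    have bB: "0 \<le> b * B" using b0 osc by simp
    have CB: "2 * (b * B) \<le> C * B" "32 * NA / ck * (b * B) \<le> C * B"
    proof -
      have "2 * b \<le> C" "32 * NA / ck * b \<le> C" using b0 NAb unfolding C_def by linarith+
      then have "2 * b * B \<le> C * B" "32 * NA / ck * b * B \<le> C * B"
        using mult_right_mono[OF _ osc(2)] by blast+
      then show "2 * (b * B) \<le> C * B" "32 * NA / ck * (b * B) \<le> C * B" by (simp_all add: mult.assoc)
    qed
    have "\<bar>ext f x - mean T f\<bar> \<le> b * B" by (rule ext_close[OF x(1)]) (use m in auto)
    moreover have "\<bar>ext f y - mean T f\<bar> \<le> b * B" by (rule ext_close[OF y]) (use m in auto)
    ultimately have 1: "\<bar>ext f y - ext f x\<bar> \<le> C * B" using CB(1) by linarith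
    have q: "0 \<le> dist x y / min (infdist x \<Omega>) D" using d D_pos by simp
    have "\<bar>ext f x - ext f y\<bar> \<le> 32 * NA / ck * (b * B) * (dist x y / min (infdist x \<Omega>) D)"
      by (rule ext_lipschitz[OF x(1) y m bB])
    also have "\<dots> \<le> C * B * (dist x y / min (infdist x \<Omega>) D)" using CB(2) q by (rule mult_right_mono)
    finally show "\<bar>ext f y - ext f x\<bar> \<le> C * B \<and>
      \<bar>ext f y - ext f x\<bar> \<le> C * B * (dist x y / min (infdist x \<Omega>) D)"
      using 1 by (simp add: abs_minus_commute)
  qed
  then show ?thesis by blast
qed

text \<open>There are countably many pieces: the cubes, where the extension is \<open>f\<close>; the
  exterior, where it is continuous by the second bound of \<open>far_const\<close>; and the
  frontier, where it is constant.\<close>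

lemma ext_measurable:
  assumes osc: "\<And>s. osc_bd f s B" "0 \<le> B"
  shows "ext f \<in> borel_measurable lebesgue"
proof (rule measurable_piecewise_restrict[of "insert (closure \<Omega> - \<Omega>) (insert (- closure \<Omega>) E)"])
  show "countable (insert (closure \<Omega> - \<Omega>) (insert (- closure \<Omega>) E))" using E_countable by simp
  show "space lebesgue \<subseteq> \<Union> (insert (closure \<Omega> - \<Omega>) (insert (- closure \<Omega>) E))" using E_Union by auto
  fix X assume X: "X \<in> insert (closure \<Omega> - \<Omega>) (insert (- closure \<Omega>) E)"
  have cl: "closure \<Omega> - \<Omega> \<in> sets lebesgue" "- closure \<Omega> \<in> sets lebesgue"
    using op by (auto intro!: sets_completionI_sets)
  then show "X \<inter> space lebesgue \<in> sets lebesgue" using X E_lmeasurable by auto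
  have cont: "continuous_on (- closure \<Omega>) (ext f)"
  proof -
    obtain C s0 where far: "far_const C s0" using far_const_exists by blast
    have "isCont (ext f) x" if x: "x \<in> - closure \<Omega>" for x
    proof -
      have xc: "x \<notin> closure \<Omega>" using x by simp
      have d: "0 < infdist x \<Omega>" by (rule outside_pos[OF xc])
      let ?L = "C * B / min (infdist x \<Omega>) D"
      have "((\<lambda>y. ext f y - ext f x) \<longlongrightarrow> 0) (at x)"
      proof (rule Lim_null_comparison)
        have "\<forall>\<^sub>F y in at x. dist y x < infdist x \<Omega> / 2" unfolding eventually_at by (rule exI[of _ "infdist x \<Omega> / 2"]) (use d in auto)
        then show "\<forall>\<^sub>F y in at x. norm (ext f y - ext f x) \<le> ?L * dist y x"
        proof (rule eventually_mono)
          fix y assume "dist y x < infdist x \<Omega> / 2"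
          then show "norm (ext f y - ext f x) \<le> ?L * dist y x"
            using far_constD(2)[OF far osc(1) osc(2) xc _ order_refl, of y] by (simp add: dist_commute)
        qed
        have "((\<lambda>y. ?L * dist y x) \<longlongrightarrow> ?L * dist x x) (at x)" by (intro tendsto_intros)
        then show "((\<lambda>y. ?L * dist y x) \<longlongrightarrow> 0) (at x)" by simp
      qed
      then show ?thesis by (simp add: isCont_def LIM_zero_iff)
    qed
    then show ?thesis by (auto intro: continuous_at_imp_continuous_on)
  qed
  consider "X = closure \<Omega> - \<Omega>" | "X = - closure \<Omega>" | "X \<in> E" using X by auto
  then show "ext f \<in> borel_measurable (lebesgue_on X)"
  proof cases
    case 1
    have "ext f \<in> borel_measurable (lebesgue_on X) \<longleftrightarrow> (\<lambda>x. mean S0 f) \<in> borel_measurable (lebesgue_on X)"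
      by (rule measurable_cong) (use 1 in \<open>auto simp: ext_def\<close>)
    then show ?thesis by simp
  next
    case 2
    then show ?thesis using continuous_imp_measurable_on_sets_lebesgue[OF cont cl(2)] by simp
  next
    case 3
    have "f absolutely_integrable_on X"
      using osc(1)[of 0] E_compact[OF 3] E_subset[OF 3] by (simp add: osc_bd_def locally_integrable_on_def)
    then have "f \<in> borel_measurable (lebesgue_on X)"
      using absolutely_integrable_measurable_real[of X f] fmeasurableD[OF E_lmeasurable[OF 3]] by simp
    moreover have "ext f \<in> borel_measurable (lebesgue_on X) \<longleftrightarrow> f \<in> borel_measurable (lebesgue_on X)"
      by (rule measurable_cong) (use E_subset[OF 3] in \<open>auto simp: ext_def\<close>)
    ultimately show ?thesis by simp
  qed
qed

end

section \<open>Oscillation of the extension on all cubes and on small cubes\<close>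

context whitney_jones
begin

text \<open>The points of the cube are within \<open>rn * t / 2\<close> of its centre, which is
  small compared with the distance of the centre from the frontier. So the cube either lies in the
  domain or sees it from everywhere at a comparable distance.\<close>

lemma far_cases:
  assumes t: "0 < t" and far: "\<not> fr (a + vec (t/2)) \<le> 4 * rn * t"
  shows "cube a t \<subseteq> \<Omega> \<or> a + vec (t/2) \<notin> closure \<Omega> \<and> 4 * rn * t < infdist (a + vec (t/2)) \<Omega> \<and>
    (\<forall>x\<in>cube a t. dist (a + vec (t/2)) x \<le> infdist (a + vec (t/2)) \<Omega> / 2)"
proof (cases "a + vec (t/2) \<in> \<Omega>")
  case True
  have "0 < rn * t" using t rn_pos by simp
  then have b: "rn * (t/2) < bd (a + vec (t/2))" using far fr_inside[OF True] by simp
  have "cube a t \<subseteq> \<Omega>"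
  proof
    fix y assume "y \<in> cube a t"
    then have "dist (a + vec (t/2)) y \<le> rn * (t/2)" using cube_center[of a t] by auto
    then show "y \<in> \<Omega>" using b by (intro ball_subset[of "a + vec (t/2)"]) linarith
  qed
  then show ?thesis ..
next
  case False
  have p: "0 < rn * t" using t rn_pos by simp
  have d: "4 * rn * t < infdist (a + vec (t/2)) \<Omega>" using far fr_outside[OF False] by simp
  then have "a + vec (t/2) \<notin> closure \<Omega>" using p in_closure_iff_infdist_zero[OF ne, of "a + vec (t/2)"] by auto
  moreover have "dist (a + vec (t/2)) x \<le> infdist (a + vec (t/2)) \<Omega> / 2" if "x \<in> cube a t" for x
    using cube_center[of a t] that d p by force
  ultimately show ?thesis using d by blast
qed

lemma inside_cube:
  assumes "f locally_integrable_on \<Omega>" "0 < t" "cube a t \<subseteq> \<Omega>" "mean_osc (cube a t) f \<le> M"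
  shows "\<exists>m. (\<integral>\<^sup>+x. ennreal \<bar>ext f x - m\<bar> * indicator (cube a t) x \<partial>lebesgue) \<le> ennreal (M * measure lebesgue (cube a t))"
proof
  have "(\<integral>\<^sup>+x. ennreal \<bar>ext f x - mean (cube a t) f\<bar> * indicator (cube a t) x \<partial>lebesgue) =
     (\<integral>\<^sup>+x. ennreal \<bar>f x - mean (cube a t) f\<bar> * indicator (cube a t) x \<partial>lebesgue)"
    by (intro nn_integral_cong) (use assms(3) in \<open>auto simp: indicator_def ext_def\<close>)
  also have "\<dots> = ennreal (mean_osc (cube a t) f * measure lebesgue (cube a t))"
    by (rule nn_integral_cube_osc[OF assms(2) locally_integrable_cube[OF assms(1,3)]])
  also have "\<dots> \<le> ennreal (M * measure lebesgue (cube a t))"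
    using assms(4) by (intro ennreal_leI mult_right_mono) auto
  finally show "(\<integral>\<^sup>+x. ennreal \<bar>ext f x - mean (cube a t) f\<bar> * indicator (cube a t) x \<partial>lebesgue) \<le>
    ennreal (M * measure lebesgue (cube a t))" .
qed

lemma E_mean_osc_le: "osc_bd f s B \<Longrightarrow> S \<in> E \<Longrightarrow> side S \<le> s \<Longrightarrow> mean_osc S f \<le> B"
proof -
  assume h: "osc_bd f s B" "S \<in> E" "side S \<le> s"
  obtain b l where "0 < l" "S = cube b l" "side S = l" using h(2) by (rule E_cubeE)
  then show ?thesis using osc_bdD[OF h(1), of l b] h(3) E_subset[OF h(2)] by simp
qed

lemma ext_nn_integral_le:
  obtains C where "0 \<le> C" "\<And>f B a t. \<forall>s. osc_bd f s B \<Longrightarrow> 0 \<le> B \<Longrightarrow> 0 < t \<Longrightarrow>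
    \<exists>m. (\<integral>\<^sup>+x. ennreal \<bar>ext f x - m\<bar> * indicator (cube a t) x \<partial>lebesgue) \<le> ennreal (C * B * measure lebesgue (cube a t))"
proof -
  obtain Cn C1 where near: "near_const Cn C1" using near_const_exists by blast
  then have Cn: "0 \<le> Cn" by (simp add: near_const_def)
  obtain Cf s0 where far: "far_const Cf s0" using far_const_exists by blast
  then have Cf: "0 < Cf" "0 < s0" by (auto simp: far_const_def)
  \<comment> \<open>Chains of length \<open>C1 * (i + 1)\<close> cost
    \<open>C1 * CJ * B * (i + 1)\<close>; the 1 covers the oscillation on single cubes.\<close>
  define K where "K = 1 + real C1 * CJ"
  have K: "1 \<le> K" "real C1 * CJ \<le> K" using CJ_pos by (auto simp: K_def)
  define C where "C = Cn * K + Cf + 1"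
  have C: "0 \<le> C" using Cn Cf K by (simp add: C_def)
  show ?thesis
  proof (rule that[OF C])
    fix f B a and t :: real
    assume "\<forall>s. osc_bd f s B" and B: "0 \<le> B" and t: "0 < t"
    then have osc: "osc_bd f s B" for s by blast
    have f: "f locally_integrable_on \<Omega>" using osc[of 0] by (simp add: osc_bd_def)
    let ?R = "\<lambda>M. \<exists>m. (\<integral>\<^sup>+x. ennreal \<bar>ext f x - m\<bar> * indicator (cube a t) x \<partial>lebesgue) \<le> ennreal (M * measure lebesgue (cube a t))"
    have mono: "?R (C * B)" if "?R M" "M \<le> C * B" for M
    proof -
      have "ennreal (M * measure lebesgue (cube a t)) \<le> ennreal (C * B * measure lebesgue (cube a t))"
        using that(2) by (intro ennreal_leI mult_right_mono) auto
      then show ?thesis using that(1) order_trans by blast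
    qed
    show "?R (C * B)"
    proof (cases "fr (a + vec (t/2)) \<le> 4 * rn * t")
      case True
      have KB: "B \<le> K * B" using mult_right_mono[OF K(1) B] by simp
      have "?R (Cn * (K * B))"
      proof (rule near_constD[OF near f t True])
        show "0 \<le> K * B" using K B by simp
        show "mean_osc S f \<le> K * B" if "S \<in> E" for S
          using E_mean_osc_le[OF osc that order_refl] KB by linarith
        fix S S' i assume S: "S \<in> E" "S' \<in> E" "wd S S' \<le> C1 * (i + 1)"
        have "\<bar>mean S f - mean S' f\<bar> \<le> real (wd S S') * (CJ * B)"
          by (rule osc_chain[OF osc B S(1,2) order_refl])
        also have "\<dots> \<le> real (C1 * (i + 1)) * (CJ * B)"
          using S(3) CJ_pos B by (intro mult_right_mono of_nat_mono) auto
        also have "\<dots> = (real C1 * CJ) * (B * (real i + 1))" by (simp add: algebra_simps)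
        also have "\<dots> \<le> K * (B * (real i + 1)\<^sup>2)"
          using K B by (intro mult_mono mult_left_mono) (auto simp: power2_eq_square)
        finally show "\<bar>mean S f - mean S' f\<bar> \<le> K * B * (real i + 1)\<^sup>2" by (simp add: mult.assoc)
      qed
      then show ?thesis
        by (rule mono) (use B Cf in \<open>simp add: C_def algebra_simps\<close>)
    next
      case False
      from far_cases[OF t False] show ?thesis
      proof (elim disjE conjE)
        assume Q: "cube a t \<subseteq> \<Omega>"
        have "?R B" by (rule inside_cube[OF f t Q osc_bdD[OF osc t order_refl Q]])
        then show ?thesis
          by (rule mono) (use B Cf Cn K in \<open>simp add: C_def algebra_simps\<close>)
      next
        let ?p = "a + vec (t/2)"
        assume p: "?p \<notin> closure \<Omega>" "\<forall>x\<in>cube a t. dist ?p x \<le> infdist ?p \<Omega> / 2"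
        have "\<bar>ext f x - ext f ?p\<bar> \<le> Cf * B" if "x \<in> cube a t" for x
          using far_constD(1)[OF far osc B p(1) _ order_refl] p(2) that by blast
        then have "?R (Cf * B)"
          using Cf B by (intro exI[of _ "ext f ?p"] nn_integral_bounded_cube) auto
        then show ?thesis
          by (rule mono) (use B Cn K in \<open>simp add: C_def algebra_simps\<close>)
      qed
    qed
  qed
qed

lemma ext_integrable:
  assumes "\<And>s. osc_bd f s B" "0 \<le> B" "0 < t"
  shows "ext f absolutely_integrable_on cube a t"
proof -
  obtain C where "0 \<le> C" and C: "\<And>f B a t. \<forall>s. osc_bd f s B \<Longrightarrow> 0 \<le> B \<Longrightarrow> 0 < t \<Longrightarrow>
    \<exists>m. (\<integral>\<^sup>+x. ennreal \<bar>ext f x - m\<bar> * indicator (cube a t) x \<partial>lebesgue) \<le> ennreal (C * B * measure lebesgue (cube a t))"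
    using ext_nn_integral_le by blast
  obtain m where "(\<integral>\<^sup>+x. ennreal \<bar>ext f x - m\<bar> * indicator (cube a t) x \<partial>lebesgue) \<le> ennreal (C * B * measure lebesgue (cube a t))"
    using C[of f B t a] assms by blast
  then show ?thesis
    by (intro abs_integrable_of_nn_integral[OF ext_measurable[OF assms(1,2)], of m])
      (auto intro: order_le_less_trans)
qed

lemma ext_locally_integrable:
  assumes "\<And>s. osc_bd f s B" "0 \<le> B"
  shows "ext f locally_integrable_on UNIV"
  unfolding locally_integrable_on_def
proof (intro allI impI)
  fix K :: "(real^'n) set" assume K: "compact K \<and> K \<subseteq> UNIV"
  obtain r where r: "0 < r" "K \<subseteq> cball 0 r"
    using bounded_subset_ballD[of K 0] compact_imp_bounded K ball_subset_cball by (meson subset_trans)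
  have "K \<subseteq> cube (0 - vec r) (2 * r)" using r(2) cball_subset_ccube[of 0 r] unfolding ccube_def by blast
  moreover have "ext f absolutely_integrable_on cube (0 - vec r) (2 * r)"
    using r(1) by (intro ext_integrable[OF assms]) simp
  ultimately show "ext f absolutely_integrable_on K"
    using K by (meson set_integrable_subset lmeasurable_compact fmeasurableD)
qed

lemma ext_mean_osc:
  obtains C where "0 \<le> C" "\<And>f B a t. \<forall>s. osc_bd f s B \<Longrightarrow> 0 \<le> B \<Longrightarrow> 0 < t \<Longrightarrow> mean_osc (cube a t) (ext f) \<le> C * B"
proof -
  obtain C where C: "0 \<le> C" "\<And>f B a t. \<forall>s. osc_bd f s B \<Longrightarrow> 0 \<le> B \<Longrightarrow> 0 < t \<Longrightarrow>
    \<exists>m. (\<integral>\<^sup>+x. ennreal \<bar>ext f x - m\<bar> * indicator (cube a t) x \<partial>lebesgue) \<le> ennreal (C * B * measure lebesgue (cube a t))"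
    using ext_nn_integral_le by blast
  show ?thesis
  proof (rule that[of "2 * C"])
    fix f B a and t :: real assume h: "\<forall>s. osc_bd f s B" "0 \<le> B" "0 < t"
    then have osc: "\<And>s. osc_bd f s B" "0 \<le> B" "0 < t" by blast+
    obtain m where m: "(\<integral>\<^sup>+x. ennreal \<bar>ext f x - m\<bar> * indicator (cube a t) x \<partial>lebesgue) \<le> ennreal (C * B * measure lebesgue (cube a t))"
      using C(2)[OF h, of a] by blast
    have "mean_osc (cube a t) (ext f) \<le> 2 * (C * B)"
      by (rule mean_osc_of_nn_integral[OF osc(3) ext_integrable[OF osc] _ m]) (use C osc in simp)
    then show "mean_osc (cube a t) (ext f) \<le> 2 * C * B" by simp
  qed (use C in simp)
qed

text \<open>Near the frontier, layers with \<open>i + 1 \<le> U\<close> are reached by short chains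
  from a small cube, along which the oscillation is at most \<open>\<epsilon>1\<close>. In deeper
  layers the global bound is used, and
  \<open>A * B \<le> \<beta> * U \<le> \<beta> * (i + 1)\<close> trades its size for one more factor
  \<open>i + 1\<close>. For a cube off the closure, either the distance to the domain is small and
  so are the cubes involved, or it is bounded below and the Lipschitz bound applies.\<close>

lemma ext_small_osc:
  assumes osc: "\<And>s. osc_bd f s B" and B: "0 \<le> B" and vmo: "\<And>\<epsilon>. 0 < \<epsilon> \<Longrightarrow> \<exists>s>0. osc_bd f s \<epsilon>" and eta: "0 < \<eta>"
  shows "\<exists>t0>0. \<forall>a t. 0 < t \<longrightarrow> t \<le> t0 \<longrightarrow> mean_osc (cube a t) (ext f) \<le> \<eta>"
proof -
  obtain Cn C1 where near: "near_const Cn C1" using near_const_exists by blast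
  then have Cn: "0 \<le> Cn" by (simp add: near_const_def)
  obtain Cf s0 where far: "far_const Cf s0" using far_const_exists by blast
  then have Cf: "0 < Cf" "0 < s0" by (auto simp: far_const_def)
  have f: "f locally_integrable_on \<Omega>" using osc[of 0] by (simp add: osc_bd_def)
  define \<beta> where "\<beta> = \<eta> / (2 * (Cn + 1))"
  have beta: "0 < \<beta>" "\<beta> \<le> \<eta> / 2" "Cn * \<beta> \<le> \<eta> / 2"
    using eta Cn by (auto simp: \<beta>_def field_simps)
  define A where "A = real C1 * CJ"
  have A: "0 \<le> A" using CJ_pos by (simp add: A_def)
  define \<epsilon>1 where "\<epsilon>1 = \<beta> / (1 + A)"
  have e1: "0 < \<epsilon>1" "\<epsilon>1 \<le> \<beta>" "A * \<epsilon>1 \<le> \<beta>" using beta A by (auto simp: \<epsilon>1_def field_simps)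
  obtain s1 where s1: "0 < s1" "osc_bd f s1 \<epsilon>1" using vmo[OF e1(1)] by blast
  obtain U :: nat where U: "A * B / \<beta> \<le> real U" using real_arch_simple by blast
  then have U': "A * B \<le> \<beta> * real U" using beta by (simp add: field_simps)
  define \<epsilon>2 where "\<epsilon>2 = \<eta> / (2 * Cf)"
  have e2: "0 < \<epsilon>2" "Cf * \<epsilon>2 = \<eta> / 2" using eta Cf by (auto simp: \<epsilon>2_def)
  obtain s2 where s2: "0 < s2" "osc_bd f s2 \<epsilon>2" using vmo[OF e2(1)] by blast
  define h where "h = min (s2 / s0) D"
  have h: "0 < h" using s2 Cf D_pos by (simp add: h_def)
  \<comment> \<open>Makes the Lipschitz bound at most \<open>\<eta> / 2\<close> where the distance
    to the domain, capped at \<open>D\<close>, is at least \<open>h\<close>; \<open>B + 1\<close>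
    keeps the denominator positive.\<close>
  define t3 where "t3 = \<eta> * h / (Cf * (B + 1) * rn)"
  have t3: "0 < t3" using eta h Cf B rn_pos by (simp add: t3_def)
  \<comment> \<open>The first entry keeps the cubes of side at most \<open>6 * rn * t\<close> below
    \<open>s1\<close>, the second those on chains of length at most \<open>C1 * U\<close>.\<close>
  define t0 where "t0 = min (min (s1 / (6 * rn)) (s1 / 4 ^ (C1 * U + 1))) t3"
  have t0: "0 < t0" using s1 rn_pos t3 by (simp add: t0_def)
  have main: "mean_osc (cube a t) (ext f) \<le> \<eta>" if t: "0 < t" "t \<le> t0" for a t
  proof -
    let ?R = "\<lambda>M. \<exists>m. (\<integral>\<^sup>+x. ennreal \<bar>ext f x - m\<bar> * indicator (cube a t) x \<partial>lebesgue) \<le> ennreal (M * measure lebesgue (cube a t))"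
    have mono: "?R (\<eta> / 2)" if "?R M" "M \<le> \<eta> / 2" for M
    proof -
      have "ennreal (M * measure lebesgue (cube a t)) \<le> ennreal (\<eta> / 2 * measure lebesgue (cube a t))"
        using that(2) by (intro ennreal_leI mult_right_mono) auto
      then show ?thesis using that(1) order_trans by blast
    qed
    have "t \<le> s1 / (6 * rn)" "t \<le> s1 / 4 ^ (C1 * U + 1)" "t \<le> t3" using t(2) by (auto simp: t0_def)
    then have ts: "6 * rn * t \<le> s1" "4 ^ (C1 * U + 1) * t \<le> s1" "t \<le> t3"
      using rn_pos by (auto simp: pos_le_divide_eq mult.commute)
    have ts1: "t \<le> s1" using ts(1) mult_right_mono[OF rn_ge_1, of t] t by linarith
    have "?R (\<eta> / 2)"
    proof (cases "fr (a + vec (t/2)) \<le> 4 * rn * t")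
      case True
      have "?R (Cn * \<beta>)"
      proof (rule near_constD[OF near f t(1) True])
        show "0 \<le> \<beta>" using beta by simp
        show "mean_osc S f \<le> \<beta>" if "S \<in> E" "side S \<le> 6 * rn * t" for S
        proof -
          have "side S \<le> s1" using that(2) ts(1) by linarith
          then show ?thesis using E_mean_osc_le[OF s1(2) that(1)] e1(2) by linarith
        qed
        fix S S' i assume S: "S \<in> E" "S' \<in> E" "side S' \<le> t" "wd S S' \<le> C1 * (i + 1)"
        \<comment> \<open>The chain is run from \<open>S'\<close>, the cube whose side is known to
          be at most \<open>t\<close>.\<close>
        have w: "wd S' S \<le> C1 * (i + 1)" using S wd_sym by simp
        have chain: "\<bar>mean S f - mean S' f\<bar> \<le> A * \<epsilon> * (real i + 1)"
          if "osc_bd f s \<epsilon>" "0 \<le> \<epsilon>" "4 ^ (wd S' S + 1) * side S' \<le> s" for s \<epsilon>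
        proof -
          have "\<bar>mean S' f - mean S f\<bar> \<le> real (wd S' S) * (CJ * \<epsilon>)"
            by (rule osc_chain[OF that(1,2) S(2,1) that(3)])
          also have "\<dots> \<le> real (C1 * (i + 1)) * (CJ * \<epsilon>)"
            using w CJ_pos that(2) by (intro mult_right_mono of_nat_mono) auto
          also have "\<dots> = A * \<epsilon> * (real i + 1)" by (simp add: A_def algebra_simps)
          finally show ?thesis by (simp add: abs_minus_commute)
        qed
        have i2: "\<beta> * (real i + 1) \<le> \<beta> * (real i + 1)\<^sup>2" using beta by (simp add: power2_eq_square)
        show "\<bar>mean S f - mean S' f\<bar> \<le> \<beta> * (real i + 1)\<^sup>2"
        proof (cases "i + 1 \<le> U")
          case True
          have "wd S' S \<le> C1 * U" using w True by (meson le_trans mult_le_mono2)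
          then have "4 ^ (wd S' S + 1) * side S' \<le> 4 ^ (C1 * U + 1) * t"
            using S side_pos[OF S(2)] by (intro mult_mono power_increasing) auto
          then have "\<bar>mean S f - mean S' f\<bar> \<le> A * \<epsilon>1 * (real i + 1)"
            using ts(2) e1 by (intro chain[OF s1(2)]) auto
          also have "\<dots> \<le> \<beta> * (real i + 1)" using e1(3) by (intro mult_right_mono) auto
          finally show ?thesis using i2 by linarith
        next
          case False
          have "\<bar>mean S f - mean S' f\<bar> \<le> A * B * (real i + 1)" by (rule chain[OF osc B order_refl])
          also have "\<dots> \<le> \<beta> * real U * (real i + 1)" using U' by (intro mult_right_mono) auto
          also have "\<dots> \<le> \<beta> * (real i + 1) * (real i + 1)"
            using False beta by (intro mult_right_mono mult_left_mono) auto
          finally show ?thesis by (simp add: power2_eq_square mult.assoc)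
        qed
      qed
      then show ?thesis using beta(3) by (rule mono)
    next
      case False
      from far_cases[OF t(1) False] show ?thesis
      proof (elim disjE conjE)
        assume Q: "cube a t \<subseteq> \<Omega>"
        have "?R \<epsilon>1" by (rule inside_cube[OF f t(1) Q osc_bdD[OF s1(2) t(1) ts1 Q]])
        then show ?thesis by (rule mono) (use e1 beta in linarith)
      next
        let ?p = "a + vec (t/2)"
        assume p: "?p \<notin> closure \<Omega>" "\<forall>x\<in>cube a t. dist ?p x \<le> infdist ?p \<Omega> / 2"
        have "\<bar>ext f x - ext f ?p\<bar> \<le> \<eta> / 2" if x: "x \<in> cube a t" for x
        proof (cases "s0 * infdist ?p \<Omega> \<le> s2")
          case True
          then show ?thesis
            using far_constD(1)[OF far s2(2) less_imp_le[OF e2(1)] p(1) p(2)[rule_format, OF x] True] e2(2) by simp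
        next
          case False
          have "s2 / s0 \<le> infdist ?p \<Omega>" using False Cf by (simp add: divide_le_eq mult.commute)
          then have h1: "h \<le> min (infdist ?p \<Omega>) D" by (simp add: h_def min_le_iff_disj)
          have dx: "dist ?p x \<le> rn * (t/2)" using cube_center[of a t] x by auto
          have "\<bar>ext f x - ext f ?p\<bar> \<le> Cf * B * (dist ?p x / min (infdist ?p \<Omega>) D)"
            by (rule far_constD(2)[OF far osc B p(1) p(2)[rule_format, OF x] order_refl])
          also have "\<dots> \<le> Cf * (B + 1) * (rn * (t/2) / h)"
            using Cf B h h1 dx rn_pos t by (intro mult_mono frac_le) auto
          also have "\<dots> \<le> Cf * (B + 1) * (rn * (t3/2) / h)"
            using Cf B h rn_pos ts(3) by (intro mult_left_mono divide_right_mono) auto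
          also have "\<dots> = \<eta> / 2"
          proof -
            have "k * (rn * (\<eta> * h / (k * rn) / 2) / h) = \<eta> / 2" if "k \<noteq> 0" for k
              using that h rn_pos by (simp add: field_simps)
            moreover have "Cf * (B + 1) \<noteq> 0" using Cf B by simp
            ultimately show ?thesis unfolding t3_def by blast
          qed
          finally show ?thesis .
        qed
        then show ?thesis
          using eta by (intro exI[of _ "ext f ?p"] nn_integral_bounded_cube) auto
      qed
    qed
    then obtain m where m: "(\<integral>\<^sup>+x. ennreal \<bar>ext f x - m\<bar> * indicator (cube a t) x \<partial>lebesgue) \<le> ennreal (\<eta> / 2 * measure lebesgue (cube a t))"
      by blast
    have "mean_osc (cube a t) (ext f) \<le> 2 * (\<eta> / 2)"
      by (rule mean_osc_of_nn_integral[OF t(1) ext_integrable[OF osc B t(1)] _ m]) (use eta in simp)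
    then show ?thesis by simp
  qed
  then show ?thesis using t0 by blast
qed

section \<open>Functions in VMO, linearity and the extension theorem\<close>

lemma VMO_osc_bd:
  assumes "f \<in> VMO \<Omega>" "0 < \<epsilon>"
  shows "\<exists>s>0. osc_bd f s \<epsilon>"
proof -
  have f: "f locally_integrable_on \<Omega>" and lim: "(osc_modulus \<Omega> f \<longlongrightarrow> 0) (at_right 0)"
    using assms by (auto simp: VMO_def)
  have "\<forall>\<^sub>F t in at_right 0. osc_modulus \<Omega> f t < ennreal \<epsilon>"
    using order_tendstoD(2)[OF lim, of "ennreal \<epsilon>"] assms(2) by simp
  then obtain b where b: "0 < b" "\<And>t. 0 < t \<Longrightarrow> t < b \<Longrightarrow> osc_modulus \<Omega> f t < ennreal \<epsilon>"
    unfolding eventually_at_right_field by blast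
  \<comment> \<open>The modulus takes sides strictly below its argument; sides up to
    \<open>b / 4\<close> are covered by its value at \<open>b / 2\<close>.\<close>
  have "osc_bd f (b/4) \<epsilon>" unfolding osc_bd_def
  proof (intro conjI allI impI f)
    fix a l assume l: "0 < l" "l \<le> b/4" "cube a l \<subseteq> \<Omega>"
    have "ennreal (mean_osc (cube a l) f) \<le> osc_modulus \<Omega> f (b/2)"
      unfolding osc_modulus_def
      by (rule SUP_upper) (use l b(1) in \<open>auto simp: sidelength_cube is_cube_cube\<close>)
    also have "\<dots> < ennreal \<epsilon>" using b by simp
    finally show "mean_osc (cube a l) f \<le> \<epsilon>" using assms(2) by (simp add: ennreal_less_iff mean_osc_nonneg)
  qed
  then show ?thesis using b(1) by (intro exI[of _ "b/4"]) simp
qed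

lemma VMO_osc_bd_all:
  assumes "f \<in> VMO \<Omega>" shows "\<exists>B\<ge>0. \<forall>s. osc_bd f s B"
  using VMO_osc_bd[OF assms, of 1] osc_bd_extend[of f _ 1] by auto

lemma osc_bd_bmo_norm:
  assumes "f locally_integrable_on \<Omega>" "bmo_norm \<Omega> f \<le> ennreal B" "0 \<le> B"
  shows "osc_bd f s B"
  unfolding osc_bd_def using assms bmo_norm_leD by blast

lemma E_integrable: "f locally_integrable_on \<Omega> \<Longrightarrow> S \<in> E \<Longrightarrow> f absolutely_integrable_on S"
  using E_compact E_subset by (simp add: locally_integrable_on_def)

lemma E_const_integrable: "S \<in> E \<Longrightarrow> (\<lambda>x. c::real) absolutely_integrable_on S"
  by (erule E_cubeE) simp

lemma ext_linear:
  assumes "f locally_integrable_on \<Omega>" "g locally_integrable_on \<Omega>"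
  shows "ext (\<lambda>x. a * f x + b * g x) x = a * ext f x + b * ext g x"
proof -
  have m: "mean S (\<lambda>x. a * f x + b * g x) = a * mean S f + b * mean S g" if "S \<in> E" for S
    using E_integrable[OF assms(1) that] E_integrable[OF assms(2) that]
    by (subst mean_add) (auto simp: mean_cmult)
  have s: "(\<Sum>S\<in>active x. ext_wt x S * mean S (\<lambda>x. a * f x + b * g x)) =
      a * (\<Sum>S\<in>active x. ext_wt x S * mean S f) + b * (\<Sum>S\<in>active x. ext_wt x S * mean S g)"
    unfolding sum_distrib_left sum.distrib[symmetric]
    by (rule sum.cong) (auto simp: active_def m algebra_simps)
  show ?thesis unfolding ext_def s by (simp add: m[OF S0] add_divide_distrib)
qed

lemma ext_mod_const:
  assumes f: "f locally_integrable_on \<Omega>" and g: "g locally_integrable_on \<Omega>" and "eq_mod_const \<Omega> f g"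
  shows "eq_mod_const UNIV (ext f) (ext g)"
proof -
  obtain c where "AE x in lebesgue_on \<Omega>. f x = g x + c" using assms(3) by (auto simp: eq_mod_const_def)
  then have ae: "AE x in lebesgue. x \<in> \<Omega> \<longrightarrow> f x = g x + c"
    using op by (subst (asm) AE_restrict_space_iff) auto
  have m: "mean S f = mean S g + c" if S: "S \<in> E" for S
  proof -
    have "mean S f = mean S (\<lambda>x. g x + c)"
    proof (rule mean_cong_AE)
      show "AE x in lebesgue. x \<in> S \<longrightarrow> f x = g x + c"
        using ae by (rule AE_mp) (use E_subset[OF S] in auto)
    qed (use E_integrable[OF f S] E_integrable[OF g S] E_const_integrable[OF S] in auto)
    also have "\<dots> = mean S g + mean S (\<lambda>x. c)"
      by (rule mean_add[OF E_integrable[OF g S] E_const_integrable[OF S]])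
    also have "mean S (\<lambda>x. c) = c" using S by (rule E_cubeE) (simp add: mean_const)
    finally show ?thesis .
  qed
  have out: "ext f x = ext g x + c" if x: "x \<notin> \<Omega>" for x
  proof (cases "x \<in> closure \<Omega>")
    case True
    then show ?thesis using x m[OF S0] by (simp add: ext_def)
  next
    case False
    have AE: "active x \<subseteq> E" by (auto simp: active_def)
    note e = ext_outside(3)[OF False active_finite(1)[OF False] subset_refl AE]
    \<comment> \<open>Subtracting \<open>c\<close> from the means of \<open>f\<close> leaves the
      means of \<open>g\<close>; normalised weights carry this over to the quotients.\<close>
    have "(\<Sum>S\<in>active x. ext_wt x S * (mean S f - c)) = (\<Sum>S\<in>active x. ext_wt x S * (mean S g - 0))"
      by (rule sum.cong) (use AE m in auto)
    then show ?thesis using e[of f c] e[of g 0] by simp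
  qed
  have "AE x in lebesgue. ext f x = ext g x + c"
    using ae by (rule AE_mp) (use out in \<open>auto simp: ext_def\<close>)
  then show ?thesis unfolding eq_mod_const_def lebesgue_on_UNIV_eq by blast
qed

theorem extension_of_jones:
  "\<exists>T C. 0 \<le> C \<and> linear_extension_map \<Omega> (VMO \<Omega>) VMO_space T \<and>
     (\<forall>f\<in>VMO \<Omega>. bmo_norm UNIV (T f) \<le> ennreal C * bmo_norm \<Omega> f)"
proof -
  obtain C where C: "0 \<le> C" and osc: "\<And>f B a t. \<forall>s. osc_bd f s B \<Longrightarrow> 0 \<le> B \<Longrightarrow> 0 < t \<Longrightarrow>
      mean_osc (cube a t) (ext f) \<le> C * B"
    using ext_mean_osc by blast
  have norm: "bmo_norm UNIV (ext f) \<le> ennreal (C * B)" if "\<And>s. osc_bd f s B" "0 \<le> B" for f B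
    by (intro bmo_norm_leI osc allI that)
  have bound: "bmo_norm UNIV (ext f) \<le> ennreal C * bmo_norm \<Omega> f" if f: "f \<in> VMO \<Omega>" for f
  proof -
    have fl: "f locally_integrable_on \<Omega>" using f by (simp add: VMO_def)
    obtain B0 where B0: "0 \<le> B0" "\<And>s. osc_bd f s B0" using VMO_osc_bd_all[OF f] by blast
    have "bmo_norm \<Omega> f \<le> ennreal B0"
      by (rule bmo_norm_leI) (use B0(2) order_refl in \<open>blast intro: osc_bdD\<close>)
    then have "bmo_norm \<Omega> f < \<infinity>" by (simp add: order_le_less_trans)
    \<comment> \<open>The norm is finite and can itself serve as the bound \<open>B\<close>, so the
      constant does not depend on \<open>f\<close>.\<close>
    then have e: "bmo_norm \<Omega> f = ennreal (enn2real (bmo_norm \<Omega> f))" by simp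
    then have "bmo_norm UNIV (ext f) \<le> ennreal (C * enn2real (bmo_norm \<Omega> f))"
      by (intro norm osc_bd_bmo_norm[OF fl]) auto
    also have "\<dots> = ennreal C * bmo_norm \<Omega> f" using C e by (simp add: ennreal_mult)
    finally show ?thesis .
  qed
  have mem: "ext f \<in> VMO_space" if f: "f \<in> VMO \<Omega>" for f
  proof -
    obtain B where B: "0 \<le> B" "\<And>s. osc_bd f s B" using VMO_osc_bd_all[OF f] by blast
    have "bmo_norm UNIV (ext f) < \<infinity>" using norm[OF B(2,1)] by (simp add: order_le_less_trans)
    then have bmo: "ext f \<in> BMO UNIV" using ext_locally_integrable[OF B(2,1)] by (simp add: BMO_def)
    have "(osc_modulus UNIV (ext f) \<longlongrightarrow> 0) (at_right 0)"
    proof (rule order_tendstoI)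
      fix e :: ennreal assume "0 < e"
      then obtain y where y: "0 < y" "y < e" using dense by blast
      then obtain \<eta> where eta: "y = ennreal \<eta>" "0 < \<eta>" by (cases y) (auto simp: ennreal_less_zero_iff)
      obtain t0 where t0: "0 < t0" "\<And>a t. 0 < t \<Longrightarrow> t \<le> t0 \<Longrightarrow> mean_osc (cube a t) (ext f) \<le> \<eta>"
        using ext_small_osc[OF B(2,1) VMO_osc_bd[OF f] eta(2)] by blast
      have "osc_modulus UNIV (ext f) t < e" if "0 < t" "t < t0" for t
      proof -
        have "osc_modulus UNIV (ext f) t \<le> ennreal \<eta>" by (rule osc_modulus_leI) (use t0 that in auto)
        then show ?thesis using y eta by simp
      qed
      then show "\<forall>\<^sub>F t in at_right 0. osc_modulus UNIV (ext f) t < e"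
        unfolding eventually_at_right_field using t0(1) by blast
    qed simp
    then show ?thesis using bmo by (simp add: VMO_space_def)
  qed
  have ae: "AE x in lebesgue_on \<Omega>. ext f x = f x" for f
    by (rule AE_I2) (simp add: ext_def)
  have "linear_extension_map \<Omega> (VMO \<Omega>) VMO_space ext"
    unfolding linear_extension_map_def
  proof (intro conjI ballI allI impI mem ae)
    fix f g assume "f \<in> VMO \<Omega>" "g \<in> VMO \<Omega>"
    then have l: "f locally_integrable_on \<Omega>" "g locally_integrable_on \<Omega>" by (auto simp: VMO_def)
    show "eq_mod_const UNIV (ext f) (ext g)" if "eq_mod_const \<Omega> f g" by (rule ext_mod_const[OF l that])
    show "eq_mod_const UNIV (ext (\<lambda>x. a * f x + b * g x)) (\<lambda>x. a * ext f x + b * ext g x)" for a b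
      unfolding eq_mod_const_def ext_linear[OF l] by (intro exI[of _ 0]) simp
  qed
  then show ?thesis using C bound by blast
qed

end

text \<open>Any two functions agree almost everywhere on the empty set, so the zero map is an
  extension map.\<close>

lemma extension_empty:
  "\<exists>T C. 0 \<le> C \<and> linear_extension_map ({} :: (real^'n) set) (VMO {}) VMO_space T \<and>
     (\<forall>f\<in>VMO {}. bmo_norm UNIV (T f) \<le> ennreal C * bmo_norm ({} :: (real^'n) set) f)"
proof -
  let ?z = "\<lambda>x :: real^'n. 0 :: real"
  have osc: "mean_osc (cube a l) ?z \<le> 0" for a l by (simp add: mean_osc_def mean_def)
  have norm: "bmo_norm UNIV ?z = 0"
    using bmo_norm_leI[of UNIV ?z 0] osc by simp
  have "osc_modulus UNIV ?z = (\<lambda>t. 0)"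
    using osc_modulus_leI[of _ UNIV ?z 0] osc by (simp add: fun_eq_iff)
  then have "?z \<in> VMO_space"
    using norm by (simp add: VMO_space_def BMO_def continuous_locally_integrable)
  then have "linear_extension_map ({} :: (real^'n) set) (VMO {}) VMO_space (\<lambda>f. ?z)"
    unfolding linear_extension_map_def eq_mod_const_def
    by (auto intro!: exI[of _ 0] simp: AE_restrict_space_iff)
  then show ?thesis using norm by (intro exI[of _ "\<lambda>f. ?z"] exI[of _ 0]) auto
qed

theorem theorem1:
  fixes \<Omega> :: "(real ^ 'n) set" and E :: "(real ^ 'n) set set"
  assumes "CARD('n) \<ge> 2"
    and "open \<Omega>" and "connected \<Omega>" and "bounded \<Omega>"
    and "whitney_decomposition \<Omega> E"
  shows "(jones_condition E \<longrightarrow>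
           (\<exists>T C. 0 \<le> C \<and> linear_extension_map \<Omega> (VMO \<Omega>) VMO_space T \<and>
              (\<forall>f\<in>VMO \<Omega>. bmo_norm UNIV (T f) \<le> ennreal C * bmo_norm \<Omega> f)))
       \<and> ((\<exists>T C. 0 \<le> C \<and> linear_extension_map \<Omega> (VMO \<Omega>) (BMO UNIV) T \<and>
              (\<forall>f\<in>VMO \<Omega>. bmo_norm UNIV (T f) \<le> ennreal C * bmo_norm \<Omega> f))
           \<longrightarrow> jones_condition E)"
proof (cases "\<Omega> = {}")
  \<comment> \<open>\<open>connected\<close> admits the empty set; the decomposition then has no
    cubes.\<close>
  case True
  then have "S \<notin> E" for S
    using assms(5) unfolding whitney_decomposition_def
    by (metis Union_upper cube_nonempty dyadic_cube_cube less_imp_le subset_empty)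
  then have "jones_condition E" unfolding jones_condition_def by (intro exI[of _ 1]) auto
  then show ?thesis using True extension_empty by blast
next
  case False
  then interpret whitney \<Omega> E using assms by unfold_locales
  show ?thesis
  proof (intro conjI impI)
    assume "jones_condition E"
    then obtain \<kappa> where "0 < \<kappa>" "\<And>S S'. S \<in> E \<Longrightarrow> S' \<in> E \<Longrightarrow> real (whitney_dist E S S') \<le> \<kappa> * log_dist S S'"
      unfolding jones_condition_def by blast
    then interpret whitney_jones \<Omega> E \<kappa> by unfold_locales
    show "\<exists>T C. 0 \<le> C \<and> linear_extension_map \<Omega> (VMO \<Omega>) VMO_space T \<and>
        (\<forall>f\<in>VMO \<Omega>. bmo_norm UNIV (T f) \<le> ennreal C * bmo_norm \<Omega> f)"
      by (rule extension_of_jones)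
  next
    assume "\<exists>T C. 0 \<le> C \<and> linear_extension_map \<Omega> (VMO \<Omega>) (BMO UNIV) T \<and>
        (\<forall>f\<in>VMO \<Omega>. bmo_norm UNIV (T f) \<le> ennreal C * bmo_norm \<Omega> f)"
    then show "jones_condition E" using jones_of_extension by blast
  qed
qed

end
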